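(* Let $L\subset\mathbb{P}^n$ be a linear space of dimension $d<n$ not contained in a coordinate hyperplane. The zero locus of the principal matroid determinant $E_L$ is $$V(E_L)\;=\;\bigcup_{F\in\mathcal{F}(M(L))}\nabla(L^{-1}\cap\Lambda_F)\;\subseteq\;(\mathbb{P}^n)^\vee .$$
   Context: Let $T\subset\mathbb{P}^n$ be the set of points with all homogeneous coordinates nonzero. For $k=1,2$, $L^{-k}$ is the Zariski closure of $\{(x_0^{-k}:\cdots:x_n^{-k}): x\in L\cap T\}$. Fix $A\in\mathbb{C}^{(d+1)\times(n+1)}$ whose projectivized row span is $L$. $M(L)$ is the matroid on $\{0,\dots,n\}$ of linear independence of the columns of $A$, and $\mathcal{F}(M(L))$ is its set of flats. For $F\subseteq\{0,\dots,n\}$, $\Lambda_F=\{x\in\mathbb{P}^n: x_i=0 \text{ for all } i\notin F\}$ (so the empty flat contributes the empty set). For an irreducible closed $X\subset\mathbb{P}^n$, $\nabla(X)\subset(\mathbb{P}^n)^\vee$ is its projective dual variety: the closure of the set of hyperplanes $\{z_0x_0+\cdots+z_nx_n=0\}$ which contain the projective tangent space of $X$ at some smooth point. Principal matroid determinant: for an irreducible $X\subset\mathbb{P}^n$ of dimension $d$, the Chow form ${\rm Chow}(X)$ is the defining equation, in primal Pl\"ucker coordinates, of the hypersurface $\{[\Lambda]: X\cap\Lambda\ne\emptyset\}\subset\mathbb{G}(n-d-1,n)$. The $X$-resultant ${\rm Res}(X)$ is the polynomial in the entries of a $(d+1)\times(n+1)$ matrix $U$ obtained by substituting the maximal minors of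 $U$ (primal Pl\"ucker coordinates of $\{x:Ux=0\}$) in ${\rm Chow}(X)$. $E_L\in\mathbb{C}[z_0,\dots,z_n]$ is obtained from ${\rm Res}(L^{-2})$ by substituting $U=A\cdot{\rm diag}(z_0,\dots,z_n)$ (well defined up to a nonzero constant). *)

theory Defs
  imports "HOL-Analysis.Analysis" "HOL-Library.Poly_Mapping"
begin

section \<open>Polynomials in finitely many variables over the complex numbers\<close>

type_synonym 'v mpoly = "('v \<Rightarrow>\<^sub>0 nat) \<Rightarrow>\<^sub>0 complex"

definition Var :: "'v \<Rightarrow> 'v mpoly" where
  "Var v = Poly_Mapping.single (Poly_Mapping.single v 1) 1"

definition Const :: "complex \<Rightarrow> 'v mpoly" where
  "Const c = Poly_Mapping.single 0 c"

text \<open>Evaluation of a polynomial in a commutative algebra with structure map \<open>h\<close>.\<close>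

definition insertion ::
  "(complex \<Rightarrow> 'a::comm_semiring_1) \<Rightarrow> ('v \<Rightarrow> 'a) \<Rightarrow> 'v mpoly \<Rightarrow> 'a" where
  "insertion h s p =
     (\<Sum>m\<in>Poly_Mapping.keys p. h (Poly_Mapping.lookup p m) *
        (\<Prod>v\<in>Poly_Mapping.keys m. s v ^ Poly_Mapping.lookup m v))"

definition peval :: "'v mpoly \<Rightarrow> ('v \<Rightarrow> complex) \<Rightarrow> complex" where
  "peval p x = insertion (\<lambda>c. c) x p"

definition psubst :: "('v \<Rightarrow> 'w mpoly) \<Rightarrow> 'v mpoly \<Rightarrow> 'w mpoly" where
  "psubst s p = insertion Const s p"

definition partial :: "'v \<Rightarrow> 'v mpoly \<Rightarrow> 'v mpoly" where
  "partial i p =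
     (\<Sum>m\<in>Poly_Mapping.keys p.
        Poly_Mapping.single (m - Poly_Mapping.single i 1)
          (of_nat (Poly_Mapping.lookup m i) * Poly_Mapping.lookup p m))"

definition homogeneous :: "'v mpoly \<Rightarrow> bool" where
  "homogeneous p \<longleftrightarrow>
     (\<exists>k. \<forall>m\<in>Poly_Mapping.keys p. (\<Sum>v\<in>Poly_Mapping.keys m. Poly_Mapping.lookup m v) = k)"


section \<open>Projective varieties\<close>

text \<open>
  The index type \<open>'n\<close> plays the role of \<open>{0, ..., n}\<close>, so \<open>CARD('n) = n + 1\<close>. A point of projective
  \<open>n\<close>-space, or of its dual, is given by its nonzero vectors of homogeneous coordinates: a set of
  points is represented by the set of all homogeneous coordinate vectors of its points, a subset
  of \<open>complex ^ 'n\<close> that does not contain 0 and is invariant under multiplication by nonzero scalars.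
\<close>

definition proj_ideal :: "(complex ^ 'n) set \<Rightarrow> 'n mpoly set" where
  "proj_ideal S = {p. homogeneous p \<and> (\<forall>x\<in>S. peval p (\<lambda>i. x $ i) = 0)}"

definition proj_zeros :: "'n mpoly set \<Rightarrow> (complex ^ 'n) set" where
  "proj_zeros I = {x. x \<noteq> 0 \<and> (\<forall>p\<in>I. peval p (\<lambda>i. x $ i) = 0)}"

definition zariski_closure :: "(complex ^ 'n) set \<Rightarrow> (complex ^ 'n) set" where
  "zariski_closure S = proj_zeros (proj_ideal S)"

definition proj_closed :: "(complex ^ 'n) set \<Rightarrow> bool" where
  "proj_closed Z \<longleftrightarrow> zariski_closure Z = Z"

definition proj_irreducible :: "(complex ^ 'n) set \<Rightarrow> bool" where
  "proj_irreducible Z \<longleftrightarrow> proj_closed Z \<and> Z \<noteq> {} \<and>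
     (\<forall>Y1 Y2. proj_closed Y1 \<and> proj_closed Y2 \<and> Z = Y1 \<union> Y2 \<longrightarrow> Z = Y1 \<or> Z = Y2)"

text \<open>Krull dimension: the maximal length of a chain of irreducible closed subsets.\<close>

definition proj_dim :: "(complex ^ 'n) set \<Rightarrow> nat" where
  "proj_dim X = Sup {k. \<exists>Z :: nat \<Rightarrow> (complex ^ 'n) set.
     (\<forall>i\<le>k. proj_irreducible (Z i) \<and> Z i \<subseteq> X) \<and> (\<forall>i<k. Z i \<subset> Z (Suc i))}"

text \<open>
  The linear subspace of \<open>complex ^ 'n\<close> whose projectivization is the projective tangent space of
  \<open>X\<close> at \<open>x\<close>. Its vector space dimension exceeds that of the projective tangent space by one.
\<close>

definition tangent_space :: "(complex ^ 'n) set \<Rightarrow> complex ^ 'n \<Rightarrow> (complex ^ 'n) set" where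
  "tangent_space X x =
     {y. \<forall>p\<in>proj_ideal X. (\<Sum>i\<in>UNIV. peval (partial i p) (\<lambda>j. x $ j) * y $ i) = 0}"

definition smooth_point :: "(complex ^ 'n) set \<Rightarrow> complex ^ 'n \<Rightarrow> bool" where
  "smooth_point X x \<longleftrightarrow> x \<in> X \<and> vec.dim (tangent_space X x) = proj_dim X + 1"

text \<open>The projective dual variety of an irreducible closed set; the dual of the empty set is empty.\<close>

definition dual_variety :: "(complex ^ 'n) set \<Rightarrow> (complex ^ 'n) set" where
  "dual_variety X = zariski_closure
     {z. z \<noteq> 0 \<and> (\<exists>x. smooth_point X x \<and> (\<forall>y\<in>tangent_space X x. (\<Sum>i\<in>UNIV. z $ i * y $ i) = 0))}"

definition zero_locus :: "'n mpoly \<Rightarrow> (complex ^ 'n) set" where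
  "zero_locus p = {z. z \<noteq> 0 \<and> peval p (\<lambda>i. z $ i) = 0}"


section \<open>Linear spaces, their reciprocals and matroids\<close>

definition proj_row_span :: "complex ^ 'n ^ 'm \<Rightarrow> (complex ^ 'n) set" where
  "proj_row_span A = vec.span (rows A) - {0}"

definition recip_power :: "nat \<Rightarrow> (complex ^ 'n) set \<Rightarrow> (complex ^ 'n) set" where
  "recip_power k L = zariski_closure {(\<chi> i. inverse (x $ i ^ k)) | x. x \<in> L \<and> (\<forall>i. x $ i \<noteq> 0)}"

definition coord_space :: "'n set \<Rightarrow> (complex ^ 'n) set" where
  "coord_space F = {x. x \<noteq> 0 \<and> (\<forall>i. i \<notin> F \<longrightarrow> x $ i = 0)}"

text \<open>
  The matroid of linear independence of the columns of \<open>A\<close>, on the index set of the columns;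
  injectivity excludes sets containing the indices of two equal columns.
\<close>

definition matroid_indep :: "complex ^ 'n ^ 'm \<Rightarrow> 'n set \<Rightarrow> bool" where
  "matroid_indep A I \<longleftrightarrow> inj_on (\<lambda>i. column i A) I \<and> vec.independent ((\<lambda>i. column i A) ` I)"

definition matroid_rank :: "complex ^ 'n ^ 'm \<Rightarrow> 'n set \<Rightarrow> nat" where
  "matroid_rank A S = Max {card I | I. I \<subseteq> S \<and> matroid_indep A I}"

definition flats :: "complex ^ 'n ^ 'm \<Rightarrow> 'n set set" where
  "flats A = {F. \<forall>e. e \<notin> F \<longrightarrow> matroid_rank A (insert e F) > matroid_rank A F}"


section \<open>Chow forms, resultants and the principal matroid determinant\<close>

text \<open>
  The index type \<open>'m\<close> of the rows plays the role of \<open>{0, ..., d}\<close>, so \<open>CARD('m) = d + 1\<close>. Maximal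
  minors, and hence Pluecker coordinates, are indexed by all tuples of columns \<open>'m \<Rightarrow> 'n\<close> and not
  only by the increasing ones. They are alternating in the tuple, so that the increasing ones
  determine the others; the extra coordinates are eliminated by the alternating relations, which
  hold on all of the Grassmannian.
\<close>

definition minor :: "'a::comm_ring_1 ^ 'n ^ 'm \<Rightarrow> ('m \<Rightarrow> 'n) \<Rightarrow> 'a" where
  "minor U f = det (\<chi> i j. U $ i $ f j)"

text \<open>
  The hypersurface \<open>{[\<Lambda>]. X \<inter> \<Lambda> \<noteq> {}}\<close> of the Grassmannian of subspaces of codimension \<open>d + 1\<close>,
  where a subspace is presented as the kernel of a matrix of full rank.
\<close>

definition chow_hypersurface :: "(complex ^ 'n) set \<Rightarrow> (complex ^ 'n ^ 'm) set" where
  "chow_hypersurface X = {U. rank U = CARD('m) \<and> X \<inter> {x. x \<noteq> 0 \<and> U *v x = 0} \<noteq> {}}"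

text \<open>
  \<open>P\<close> is a Chow form of the irreducible set \<open>X\<close> of dimension \<open>CARD('m) - 1\<close>: a homogeneous polynomial
  in the primal Pluecker coordinates whose class in the coordinate ring of the Grassmannian
  generates the ideal of the functions that vanish on the hypersurface above. The class of \<open>P\<close> is
  unique up to a nonzero constant.
\<close>

definition is_chow_form :: "(complex ^ 'n) set \<Rightarrow> ('m::finite \<Rightarrow> 'n) mpoly \<Rightarrow> bool" where
  "is_chow_form X P \<longleftrightarrow> homogeneous P \<and>
     (\<forall>Q. (\<forall>U \<in> (chow_hypersurface X :: (complex ^ 'n ^ 'm) set). peval Q (minor U) = 0) \<longleftrightarrow>
          (\<exists>R. \<forall>U :: complex ^ 'n ^ 'm. rank U = CARD('m) \<longrightarrow>
                 peval Q (minor U) = peval P (minor U) * peval R (minor U)))"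

definition generic_matrix :: "('m \<times> 'n) mpoly ^ 'n ^ 'm" where
  "generic_matrix = (\<chi> i j. Var (i, j))"

definition is_resultant :: "(complex ^ 'n) set \<Rightarrow> ('m::finite \<times> 'n) mpoly \<Rightarrow> bool" where
  "is_resultant X p \<longleftrightarrow> (\<exists>P. is_chow_form X P \<and> p = psubst (minor generic_matrix) P)"

definition is_principal_matroid_determinant :: "complex ^ 'n ^ 'm \<Rightarrow> 'n mpoly \<Rightarrow> bool" where
  "is_principal_matroid_determinant A E \<longleftrightarrow>
     (\<exists>p :: ('m \<times> 'n) mpoly. is_resultant (recip_power 2 (proj_row_span A)) p \<and>
          E = psubst (\<lambda>(i, j). Const (A $ i $ j) * Var j) p)"

end

theory Submission
  imports Defs "HOL-Computational_Algebra.Fundamental_Theorem_Algebra"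
begin

text \<open>
  For a flat \<open>F\<close>, let \<open>T\<^sub>F\<close> be the set of points with support \<open>F\<close> whose reciprocals on \<open>F\<close> extend to a
  vector of the row space. Clearing denominators in the linear relations among the columns of \<open>A\<close> gives
  equations which show that \<open>L\<^sup>-\<^sup>1\<close> is the union of the \<open>T\<^sub>F\<close>, and adding large multiples of a vector that
  cuts out \<open>F\<close> shows that \<open>L\<^sup>-\<^sup>1 \<inter> \<Lambda>\<^sub>F\<close> is the closure of \<open>T\<^sub>F\<close>. Its tangent space at \<open>x \<in> T\<^sub>F\<close> is
  \<open>{x\<^sup>2v. v \<in> row space}\<close>, with coordinatewise product, so \<open>z\<close> is conormal at \<open>x\<close> iff \<open>A\<cdot>diag(z)\<cdot>x\<^sup>2 = 0\<close>.
  Since the tangent spaces of \<open>L\<^sup>-\<^sup>1 \<inter> \<Lambda>\<^sub>F\<close> contain those of the strata in it, the union of the dual varieties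
  consists of all \<open>z\<close> such that \<open>A\<cdot>diag(z)\<close> kills \<open>x\<^sup>2\<close> for some \<open>x\<close> in \<open>L\<^sup>-\<^sup>1\<close>. By elimination theory this is
  the zero locus of \<open>E\<^sub>L\<close>. The points of \<open>T\<^sub>F\<close> are smooth because \<open>L\<^sup>-\<^sup>1 \<inter> \<Lambda>\<^sub>F\<close> has dimension \<open>rank F - 1\<close>: a
  chain of flats gives a chain of irreducible closed subsets, and the growth of the number of independent
  homogeneous functions bounds the length of every such chain.
\<close>

section \<open>Polynomial functions\<close>

text \<open>The Chow form \<open>P\<close> is given by a universal property: a polynomial in the
  maximal minors vanishes on the Chow hypersurface iff it is a multiple of \<open>P\<close> on
  matrices of full rank. So one inclusion only needs that the right matrices belong to the
  hypersurface. For the other, if no point of \<open>L\<^sup>-\<^sup>1\<close> is conormal to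
  \<open>z\<close>, a polynomial in the minors must be produced that vanishes on the hypersurface
  but not at \<open>A\<cdot>diag(z)\<close>. Elimination gives such polynomials in matrix entries;
  Cramer's rule replaces the matrix by one whose entries are minors, without changing its kernel.
  Where \<open>A\<cdot>diag(z)\<close> drops rank the universal property is silent, and both
  inclusions need a separate argument. \<open>L\<^sup>-\<^sup>2\<close> enters only as the closure
  of the squares of points of \<open>L\<^sup>-\<^sup>1\<close>. Smoothness is defined through Krull
  dimension, so the tangent spaces alone do not decide it; this is why Hilbert functions appear.
  Polynomials are treated as functions, because every notion involved depends only on their values
  and derivatives.\<close>

definition mono_fun :: "('v::finite \<Rightarrow> nat) \<Rightarrow> ('v \<Rightarrow> complex) \<Rightarrow> complex" where
  "mono_fun a x = (\<Prod>v\<in>UNIV. x v ^ a v)"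

definition mono_span :: "('v::finite \<Rightarrow> nat) set \<Rightarrow> (('v \<Rightarrow> complex) \<Rightarrow> complex) set" where
  "mono_span K = {f. \<exists>c. f = (\<lambda>x. \<Sum>a\<in>K. c a * mono_fun a x)}"

inductive_set pfun :: "(('v \<Rightarrow> complex) \<Rightarrow> complex) set" where
  pfun_const: "(\<lambda>x. c) \<in> pfun"
| pfun_var: "(\<lambda>x. x v) \<in> pfun"
| pfun_add: "f \<in> pfun \<Longrightarrow> g \<in> pfun \<Longrightarrow> (\<lambda>x. f x + g x) \<in> pfun"
| pfun_mult: "f \<in> pfun \<Longrightarrow> g \<in> pfun \<Longrightarrow> (\<lambda>x. f x * g x) \<in> pfun"

text \<open>Forms of degree \<open>k\<close> in the variables from \<open>B\<close>. The zero
  function gets every degree, so that each degree is a vector space. The set \<open>B\<close>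
  matters in the upper bound for Hilbert functions, where only the variables of a basis of a flat
  may occur.\<close>

inductive is_hfun :: "'v set \<Rightarrow> nat \<Rightarrow> (('v \<Rightarrow> complex) \<Rightarrow> complex) \<Rightarrow> bool" for B where
  const: "is_hfun B 0 (\<lambda>x. c)"
| zero: "is_hfun B k (\<lambda>x. 0)"
| var: "v \<in> B \<Longrightarrow> is_hfun B 1 (\<lambda>x. x v)"
| add: "is_hfun B k f \<Longrightarrow> is_hfun B k g \<Longrightarrow> is_hfun B k (\<lambda>x. f x + g x)"
| mult: "is_hfun B k f \<Longrightarrow> is_hfun B l g \<Longrightarrow> is_hfun B (k + l) (\<lambda>x. f x * g x)"

definition hfun :: "'v set \<Rightarrow> nat \<Rightarrow> (('v \<Rightarrow> complex) \<Rightarrow> complex) set" where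
  "hfun B k = Collect (is_hfun B k)"

lemma
  shows hfun_const: "(\<lambda>x. c) \<in> hfun B 0"
    and hfun_zero: "(\<lambda>x. 0) \<in> hfun B k"
    and hfun_var: "v \<in> B \<Longrightarrow> (\<lambda>x. x v) \<in> hfun B 1"
    and hfun_add: "f \<in> hfun B k \<Longrightarrow> g \<in> hfun B k \<Longrightarrow> (\<lambda>x. f x + g x) \<in> hfun B k"
    and hfun_mult: "f \<in> hfun B k \<Longrightarrow> g \<in> hfun B l \<Longrightarrow> (\<lambda>x. f x * g x) \<in> hfun B (k + l)"
  unfolding hfun_def mem_Collect_eq by (rule is_hfun.intros; assumption)+

lemma hfun_induct [consumes 1, case_names hfun_const hfun_zero hfun_var hfun_add hfun_mult]:
  assumes "f \<in> hfun B k"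
    and "\<And>c. P 0 (\<lambda>x. c)" "\<And>k. P k (\<lambda>x. 0)" "\<And>v. v \<in> B \<Longrightarrow> P 1 (\<lambda>x. x v)"
    and "\<And>k f g. f \<in> hfun B k \<Longrightarrow> P k f \<Longrightarrow> g \<in> hfun B k \<Longrightarrow> P k g \<Longrightarrow> P k (\<lambda>x. f x + g x)"
    and "\<And>k f l g. f \<in> hfun B k \<Longrightarrow> P k f \<Longrightarrow> g \<in> hfun B l \<Longrightarrow> P l g \<Longrightarrow>
      P (k + l) (\<lambda>x. f x * g x)"
  shows "P k f"
  using assms(1) unfolding hfun_def mem_Collect_eq
proof (induction rule: is_hfun.induct)
  case (add k f g)
  then show ?case using assms(5) by (simp add: hfun_def)
next
  case (mult k f l g)
  then show ?case using assms(6) by (simp add: hfun_def)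
qed (simp_all add: assms(2-4) del: One_nat_def)

lemma pfun_sum: "(\<And>s. s \<in> S \<Longrightarrow> f s \<in> pfun) \<Longrightarrow> (\<lambda>x. \<Sum>s\<in>S. f s x) \<in> pfun"
  by (induction S rule: infinite_finite_induct) (auto intro: pfun.intros)

lemma pfun_prod: "(\<And>s. s \<in> S \<Longrightarrow> f s \<in> pfun) \<Longrightarrow> (\<lambda>x. \<Prod>s\<in>S. f s x) \<in> pfun"
  by (induction S rule: infinite_finite_induct) (auto intro: pfun.intros)

lemma pfun_cmult: "f \<in> pfun \<Longrightarrow> (\<lambda>x. c * f x) \<in> pfun"
  by (intro pfun.intros)

lemma pfun_diff: "f \<in> pfun \<Longrightarrow> g \<in> pfun \<Longrightarrow> (\<lambda>x. f x - g x) \<in> pfun"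
  using pfun_add[OF _ pfun_cmult[of g "-1"], of f] by simp

lemma pfun_compose:
  assumes "f \<in> pfun" "\<And>v. s v \<in> pfun"
  shows "(\<lambda>x. f (\<lambda>v. s v x)) \<in> pfun"
  using assms(1) by induction (auto intro: pfun.intros assms(2))

lemma hfun_imp_pfun: "f \<in> hfun B k \<Longrightarrow> f \<in> pfun"
  by (induction rule: hfun_induct) (auto intro: pfun.intros)

lemma hfun_cmult: "f \<in> hfun B k \<Longrightarrow> (\<lambda>x. c * f x) \<in> hfun B k"
  using hfun_mult[OF hfun_const, of f B k c] by simp

lemma hfun_sum: "(\<And>s. s \<in> S \<Longrightarrow> f s \<in> hfun B k) \<Longrightarrow> (\<lambda>x. \<Sum>s\<in>S. f s x) \<in> hfun B k"
  by (induction S rule: infinite_finite_induct) (simp_all add: hfun_zero hfun_add)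

lemma hfun_prod:
  "(\<And>s. s \<in> S \<Longrightarrow> f s \<in> hfun B (k s)) \<Longrightarrow> (\<lambda>x. \<Prod>s\<in>S. f s x) \<in> hfun B (\<Sum>s\<in>S. k s)"
  by (induction S rule: infinite_finite_induct) (simp_all add: hfun_const hfun_mult)

lemma hfun_power: "f \<in> hfun B k \<Longrightarrow> (\<lambda>x. f x ^ n) \<in> hfun B (n * k)"
  by (induction n) (simp_all add: hfun_const hfun_mult)

lemma hfun_compose:
  assumes "f \<in> hfun B k" "\<And>v. v \<in> B \<Longrightarrow> s v \<in> hfun C l"
  shows "(\<lambda>x. f (\<lambda>v. s v x)) \<in> hfun C (k * l)"
  using assms(1)
proof (induction rule: hfun_induct)
  case mult: (hfun_mult k f l g)
  then show ?case by (simp add: add_mult_distrib hfun_mult)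
qed (simp_all add: hfun_const hfun_zero hfun_add assms(2))

lemma hfun_scale: "f \<in> hfun B k \<Longrightarrow> f (\<lambda>v. t * x v) = t ^ k * f x"
  by (induction rule: hfun_induct) (auto simp: algebra_simps power_add)

lemma pfun_tendsto:
  assumes "f \<in> pfun" "\<And>v. (\<lambda>n. X n v) \<longlonglongrightarrow> x v"
  shows "(\<lambda>n. f (X n)) \<longlonglongrightarrow> f x"
  using assms(1)
proof induction
  case (pfun_add f g)
  then show ?case by (intro tendsto_add)
next
  case (pfun_mult f g)
  then show ?case by (intro tendsto_mult)
qed (simp_all add: assms(2))

text \<open>Along a polynomial curve a polynomial function is a polynomial in the parameter. This
  reduces irreducibility to the absence of zero divisors among univariate polynomials.\<close>

lemma pfun_line:
  assumes "f \<in> pfun"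
  shows "\<exists>q. \<forall>t. f (\<lambda>v. poly (s v) t) = poly q t"
  using assms
proof induction
  case (pfun_const c)
  have "\<forall>t. c = poly [:c:] t" by simp
  then show ?case by blast
next
  case (pfun_var v)
  show ?case by blast
next
  case (pfun_add f g)
  from pfun_add.IH(1) obtain p where p: "\<forall>t. f (\<lambda>v. poly (s v) t) = poly p t" ..
  from pfun_add.IH(2) obtain q where q: "\<forall>t. g (\<lambda>v. poly (s v) t) = poly q t" ..
  have "\<forall>t. f (\<lambda>v. poly (s v) t) + g (\<lambda>v. poly (s v) t) = poly (p + q) t"
    using p q by simp
  then show ?case by blast
next
  case (pfun_mult f g)
  from pfun_mult.IH(1) obtain p where p: "\<forall>t. f (\<lambda>v. poly (s v) t) = poly p t" ..
  from pfun_mult.IH(2) obtain q where q: "\<forall>t. g (\<lambda>v. poly (s v) t) = poly q t" ..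
  have "\<forall>t. f (\<lambda>v. poly (s v) t) * g (\<lambda>v. poly (s v) t) = poly (p * q) t"
    using p q by simp
  then show ?case by blast
qed

text \<open>\<open>M\<close> bounds the degree of \<open>f\<close>. Every \<open>N \<ge> M\<close>
  is allowed, so that summands of different degrees can be brought to a common one. The identity is
  restricted to \<open>x e \<noteq> 0\<close>, where the quotient has its proper meaning.\<close>

lemma homogenize:
  assumes "f \<in> pfun"
  shows "\<exists>M. \<forall>N\<ge>M. \<exists>h\<in>hfun UNIV N. \<forall>x. x e \<noteq> 0 \<longrightarrow> h x = x e ^ N * f (\<lambda>i. x i / x e)"
  using assms
proof induction
  case (pfun_const c)
  have "(\<lambda>x. x e ^ N * c) \<in> hfun UNIV N" for N
    using hfun_cmult[OF hfun_power[OF hfun_var[of e UNIV]], of c N] by (simp add: mult.commute)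
  then have "\<exists>h\<in>hfun UNIV N. \<forall>x. x e \<noteq> 0 \<longrightarrow> h x = x e ^ N * c" for N
    by (intro bexI[where x = "\<lambda>x. x e ^ N * c"]) simp_all
  then show ?case by blast
next
  case (pfun_var v)
  have "(\<lambda>x. x v * x e ^ (N - 1)) \<in> hfun UNIV N" if "N \<ge> 1" for N
    using hfun_mult[OF hfun_var hfun_power[OF hfun_var, of e UNIV "N - 1"], of v] that by simp
  moreover have "x v * x e ^ (N - 1) = x e ^ N * (x v / x e)" if "N \<ge> 1" "x e \<noteq> 0" for N and x :: "'a \<Rightarrow> complex"
    using that by (cases N) (auto simp: field_simps)
  ultimately have "\<exists>h\<in>hfun UNIV N. \<forall>x. x e \<noteq> 0 \<longrightarrow> h x = x e ^ N * (x v / x e)" if "N \<ge> 1" for N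
    using that by (intro bexI[where x = "\<lambda>x. x v * x e ^ (N - 1)"]) simp_all
  then show ?case by blast
next
  case (pfun_add f g)
  then obtain M1 M2
    where *: "\<forall>N\<ge>M1. \<exists>h\<in>hfun UNIV N. \<forall>x. x e \<noteq> 0 \<longrightarrow> h x = x e ^ N * f (\<lambda>i. x i / x e)"
      "\<forall>N\<ge>M2. \<exists>h\<in>hfun UNIV N. \<forall>x. x e \<noteq> 0 \<longrightarrow> h x = x e ^ N * g (\<lambda>i. x i / x e)" by auto
  show ?case
  proof (intro exI[of _ "max M1 M2"] allI impI)
    fix N assume "max M1 M2 \<le> N"
    then have "M1 \<le> N" "M2 \<le> N" by auto
    then obtain h h' where "h \<in> hfun UNIV N" "\<forall>x. x e \<noteq> 0 \<longrightarrow> h x = x e ^ N * f (\<lambda>i. x i / x e)"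
        "h' \<in> hfun UNIV N" "\<forall>x. x e \<noteq> 0 \<longrightarrow> h' x = x e ^ N * g (\<lambda>i. x i / x e)"
      using * by meson
    then show "\<exists>h\<in>hfun UNIV N. \<forall>x. x e \<noteq> 0 \<longrightarrow> h x = x e ^ N * (f (\<lambda>i. x i / x e) + g (\<lambda>i. x i / x e))"
      by (intro bexI[OF _ hfun_add[of h _ _ h']]) (auto simp: algebra_simps)
  qed
next
  case (pfun_mult f g)
  then obtain M1 M2
    where *: "\<forall>N\<ge>M1. \<exists>h\<in>hfun UNIV N. \<forall>x. x e \<noteq> 0 \<longrightarrow> h x = x e ^ N * f (\<lambda>i. x i / x e)"
      "\<forall>N\<ge>M2. \<exists>h\<in>hfun UNIV N. \<forall>x. x e \<noteq> 0 \<longrightarrow> h x = x e ^ N * g (\<lambda>i. x i / x e)" by auto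
  show ?case
  proof (intro exI[of _ "M1 + M2"] allI impI)
    fix N assume N: "M1 + M2 \<le> N"
    then have "M1 \<le> M1" "M2 \<le> N - M1" by auto
    then obtain h h' where h: "h \<in> hfun UNIV M1" "\<forall>x. x e \<noteq> 0 \<longrightarrow> h x = x e ^ M1 * f (\<lambda>i. x i / x e)"
        "h' \<in> hfun UNIV (N - M1)" "\<forall>x. x e \<noteq> 0 \<longrightarrow> h' x = x e ^ (N - M1) * g (\<lambda>i. x i / x e)"
      using * by meson
    have "x e ^ N = x e ^ M1 * x e ^ (N - M1)" for x :: "'a \<Rightarrow> complex"
      using N by (simp flip: power_add)
    moreover have "(\<lambda>x. h x * h' x) \<in> hfun UNIV N"
      using hfun_mult[OF h(1,3)] N by simp
    ultimately show "\<exists>h\<in>hfun UNIV N. \<forall>x. x e \<noteq> 0 \<longrightarrow> h x = x e ^ N * (f (\<lambda>i. x i / x e) * g (\<lambda>i. x i / x e))"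
      using h by (intro bexI[of _ "\<lambda>x. h x * h' x"]) (auto simp: algebra_simps)
  qed
qed

subsection \<open>Spans of monomials\<close>

lemma mono_fun_add: "mono_fun (\<lambda>v. a v + b v) x = mono_fun a x * mono_fun b x"
  by (simp add: mono_fun_def power_add prod.distrib)

lemma mono_fun_0: "mono_fun (\<lambda>v. 0) x = 1"
  by (simp add: mono_fun_def)

lemma mono_fun_axis: "mono_fun (\<lambda>w. if w = v then k else 0) x = x v ^ k"
proof -
  have "mono_fun (\<lambda>w. if w = v then k else 0) x = (\<Prod>w\<in>UNIV. if w = v then x w ^ k else 1)"
    unfolding mono_fun_def by (intro prod.cong refl) (simp split: if_split)
  then show ?thesis by (simp add: prod.delta)
qed

lemma mono_span_add:
  "f \<in> mono_span K \<Longrightarrow> g \<in> mono_span K \<Longrightarrow> (\<lambda>x. f x + g x) \<in> mono_span K"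
proof (unfold mono_span_def, safe, goal_cases)
  case (1 c d)
  show ?case by (intro exI[of _ "\<lambda>a. c a + d a"]) (simp add: sum.distrib algebra_simps)
qed

lemma mono_span_cmult:
  "f \<in> mono_span K \<Longrightarrow> (\<lambda>x. c * f x) \<in> mono_span K"
proof (unfold mono_span_def, safe, goal_cases)
  case (1 d)
  show ?case by (intro exI[of _ "\<lambda>a. c * d a"]) (simp add: sum_distrib_left algebra_simps)
qed

lemma mono_span_0: "(\<lambda>x. 0) \<in> mono_span K"
  unfolding mono_span_def by (simp, rule exI[of _ "\<lambda>a. 0"]) simp

lemma mono_span_sum: "(\<And>s. s \<in> S \<Longrightarrow> f s \<in> mono_span K) \<Longrightarrow> (\<lambda>x. \<Sum>s\<in>S. f s x) \<in> mono_span K"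
  by (induction S rule: infinite_finite_induct) (simp_all add: mono_span_0 mono_span_add)

lemma mono_span_mono_fun:
  assumes "finite K" "a \<in> K"
  shows "mono_fun a \<in> mono_span K"
  unfolding mono_span_def
proof (intro CollectI exI[of _ "\<lambda>b. if b = a then 1 else 0"] ext)
  fix x
  have "(\<Sum>b\<in>K. (if b = a then 1 else 0) * mono_fun b x) = (\<Sum>b\<in>K. if b = a then mono_fun b x else 0)"
    by (rule sum.cong) auto
  then show "mono_fun a x = (\<Sum>b\<in>K. (if b = a then 1 else 0) * mono_fun b x)"
    using assms by simp
qed

lemma mono_span_mult:
  assumes "f \<in> mono_span K" "g \<in> mono_span K'" "finite K''"
    and "\<And>a b. a \<in> K \<Longrightarrow> b \<in> K' \<Longrightarrow> (\<lambda>v. a v + b v) \<in> K''"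
  shows "(\<lambda>x. f x * g x) \<in> mono_span K''"
proof -
  obtain c d where f: "f = (\<lambda>x. \<Sum>a\<in>K. c a * mono_fun a x)" and g: "g = (\<lambda>x. \<Sum>b\<in>K'. d b * mono_fun b x)"
    using assms(1,2) by (auto simp: mono_span_def)
  have "(\<lambda>x. f x * g x) = (\<lambda>x. \<Sum>a\<in>K. \<Sum>b\<in>K'. (c a * d b) * mono_fun (\<lambda>v. a v + b v) x)"
    unfolding f g sum_product mono_fun_add by (simp add: mult.assoc mult.left_commute)
  then show ?thesis
    using assms(3,4) by (simp add: mono_span_sum mono_span_cmult mono_span_mono_fun)
qed

lemma mono_span_subset:
  assumes "K \<subseteq> K'" "finite K'" "f \<in> mono_span K"
  shows "f \<in> mono_span K'"
proof -
  obtain c where f: "f = (\<lambda>x. \<Sum>a\<in>K. c a * mono_fun a x)"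
    using assms by (auto simp: mono_span_def)
  show ?thesis unfolding f using assms by (intro mono_span_sum mono_span_cmult mono_span_mono_fun) auto
qed

definition exps :: "'v::finite set \<Rightarrow> nat \<Rightarrow> ('v \<Rightarrow> nat) set" where
  "exps B k = {a. (\<forall>v. v \<notin> B \<longrightarrow> a v = 0) \<and> (\<Sum>v\<in>UNIV. a v) = k}"

definition exp_box :: "nat \<Rightarrow> ('v::finite \<Rightarrow> nat) set" where
  "exp_box N = {a. \<forall>v. a v \<le> N}"

lemma finite_exp_box: "finite (exp_box N :: ('v::finite \<Rightarrow> nat) set)"
proof -
  have "exp_box N = PiE UNIV (\<lambda>v::'v. {..N})" by (auto simp: exp_box_def)
  then show ?thesis by (simp add: finite_PiE)
qed

lemma exps_le: "a \<in> exps B k \<Longrightarrow> a v \<le> k"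
  using member_le_sum[of v UNIV a] by (auto simp: exps_def)

lemma exps_subset_exp_box: "exps B k \<subseteq> exp_box k"
  by (auto simp: exp_box_def exps_le)

lemma finite_exps: "finite (exps B k)"
  using exps_subset_exp_box finite_exp_box finite_subset by blast

text \<open>One exponent is determined by the total degree, and each of the other \<open>r\<close>
  exponents is at most \<open>k\<close>.\<close>

lemma card_exps_le:
  assumes "card B = Suc r"
  shows "card (exps B k) \<le> (k + 1) ^ r"
proof -
  obtain b where b: "b \<in> B" using assms by fastforce
  have fin: "finite (B - {b})" by simp
  have "inj_on (\<lambda>a. restrict a (B - {b})) (exps B k)"
  proof (rule inj_onI)
    fix a a' assume *: "a \<in> exps B k" "a' \<in> exps B k" "restrict a (B - {b}) = restrict a' (B - {b})"
    have eq: "a v = a' v" if "v \<noteq> b" for v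
    proof (cases "v \<in> B")
      case True
      then show ?thesis using fun_cong[OF *(3), of v] that by auto
    next
      case False
      then show ?thesis using * by (auto simp: exps_def)
    qed
    have "a b + (\<Sum>v\<in>UNIV - {b}. a v) = a' b + (\<Sum>v\<in>UNIV - {b}. a' v)"
      using * by (simp add: exps_def flip: sum.remove)
    moreover have "(\<Sum>v\<in>UNIV - {b}. a v) = (\<Sum>v\<in>UNIV - {b}. a' v)" using eq by (intro sum.cong) auto
    ultimately show "a = a'" using eq by (metis add_right_cancel ext)
  qed
  then have "card (exps B k) \<le> card (PiE (B - {b}) (\<lambda>v. {..k}))"
    by (rule card_inj_on_le) (auto simp: finite_PiE exps_le split: if_splits)
  also have "\<dots> = (k + 1) ^ r" using assms b by (simp add: card_PiE)
  finally show ?thesis .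
qed

lemma mono_fun_hfun: "a \<in> exps B k \<Longrightarrow> mono_fun a \<in> hfun B k"
proof -
  assume a: "a \<in> exps B k"
  have "(\<lambda>x. x v ^ a v) \<in> hfun B (a v)" for v
  proof (cases "v \<in> B")
    case True
    then show ?thesis using hfun_power[OF hfun_var, of v B "a v"] by simp
  next
    case False
    then show ?thesis using a hfun_const[of 1 B] by (simp add: exps_def)
  qed
  then have "(\<lambda>x. \<Prod>v\<in>UNIV. x v ^ a v) \<in> hfun B (\<Sum>v\<in>UNIV. a v)"
    by (intro hfun_prod)
  then show ?thesis using a by (simp add: exps_def mono_fun_def[abs_def])
qed

lemma hfun_mono_span: "f \<in> hfun B k \<Longrightarrow> f \<in> mono_span (exps B k)"
proof (induction rule: hfun_induct)
  case (hfun_const c)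
  have "(\<lambda>x. c * mono_fun (\<lambda>v. 0) x) \<in> mono_span (exps B 0)"
    by (intro mono_span_cmult mono_span_mono_fun finite_exps) (auto simp: exps_def)
  then show ?case by (simp add: mono_fun_0)
next
  case (hfun_var v)
  have "mono_fun (\<lambda>w. if w = v then 1 else 0) \<in> mono_span (exps B 1)"
    using hfun_var by (intro mono_span_mono_fun finite_exps) (auto simp: exps_def)
  then show ?case by (simp add: mono_fun_axis[abs_def])
next
  case (hfun_mult f k g l)
  show ?case
    by (rule mono_span_mult[OF hfun_mult.IH finite_exps]) (auto simp: exps_def sum.distrib)
qed (simp_all add: mono_span_0 mono_span_add)

text \<open>The polynomial functions are thus a countable union of finite-dimensional spaces, which
  is what the proof of the Nullstellensatz uses.\<close>

lemma pfun_mono_span: "f \<in> pfun \<Longrightarrow> \<exists>N. f \<in> mono_span (exp_box N)"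
proof (induction rule: pfun.induct)
  case (pfun_const c)
  have "(\<lambda>x. c * mono_fun (\<lambda>v. 0) x) \<in> mono_span (exp_box 0)"
    by (intro mono_span_cmult mono_span_mono_fun finite_exp_box) (auto simp: exp_box_def)
  then show ?case by (auto simp: mono_fun_0)
next
  case (pfun_var v)
  have "mono_fun (\<lambda>w. if w = v then 1 else 0) \<in> mono_span (exp_box 1)"
    by (intro mono_span_mono_fun finite_exp_box) (auto simp: exp_box_def)
  then show ?case by (auto simp: mono_fun_axis[abs_def])
next
  case (pfun_add f g)
  then obtain N N' where *: "f \<in> mono_span (exp_box N)" "g \<in> mono_span (exp_box N')" by auto
  have "exp_box N \<subseteq> exp_box (N + N')" "exp_box N' \<subseteq> exp_box (N + N')" by (auto simp: exp_box_def intro: trans_le_add1 trans_le_add2)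
  then show ?case using * mono_span_subset[OF _ finite_exp_box] by (blast intro: mono_span_add)
next
  case (pfun_mult f g)
  then obtain N N' where *: "f \<in> mono_span (exp_box N)" "g \<in> mono_span (exp_box N')" by auto
  have "(\<lambda>x. f x * g x) \<in> mono_span (exp_box (N + N'))"
    by (rule mono_span_mult[OF * finite_exp_box]) (auto simp: exp_box_def intro: add_mono)
  then show ?case ..
qed

section \<open>Linear systems and elimination\<close>

text \<open>Induction on the equations: if some coefficient of the equation \<open>t\<close> is
  nonzero, solve it for the unknown \<open>p\<close> and substitute into the others.\<close>

lemma linear_system_nontrivial:
  fixes c :: "'s \<Rightarrow> 't \<Rightarrow> complex"
  assumes "finite T" "finite S" "card T < card S"
  shows "\<exists>b. (\<exists>s\<in>S. b s \<noteq> 0) \<and> (\<forall>t\<in>T. (\<Sum>s\<in>S. b s * c s t) = 0)"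
  using assms
proof (induction T arbitrary: S c rule: finite_induct)
  case empty
  then have "S \<noteq> {}" by auto
  then show ?case by (intro exI[of _ "\<lambda>s. 1"]) auto
next
  case (insert t T)
  show ?case
  proof (cases "\<forall>s\<in>S. c s t = 0")
    case True
    have "card T < card S" using insert by simp
    then obtain b where "\<exists>s\<in>S. b s \<noteq> 0" "\<forall>t\<in>T. (\<Sum>s\<in>S. b s * c s t) = 0"
      using insert.IH[OF insert.prems(1)] by blast
    then show ?thesis using True by (intro exI[of _ b]) auto
  next
    case False
    then obtain p where p: "p \<in> S" "c p t \<noteq> 0" by auto
    define c' where "c' s u = c s u - c s t / c p t * c p u" for s u
    have "card T < card (S - {p})" using insert p by auto
    then obtain b where b: "\<exists>s\<in>S - {p}. b s \<noteq> 0" "\<forall>u\<in>T. (\<Sum>s\<in>S - {p}. b s * c' s u) = 0"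
      using insert.IH[of "S - {p}" c'] insert.prems by auto
    define b' where "b' s = (if s = p then - (\<Sum>s\<in>S - {p}. b s * c s t / c p t) else b s)" for s
    have eq: "(\<Sum>s\<in>S. b' s * c s u) = (\<Sum>s\<in>S - {p}. b s * c' s u)" for u
    proof -
      have "(\<Sum>s\<in>S. b' s * c s u) = b' p * c p u + (\<Sum>s\<in>S - {p}. b' s * c s u)"
        by (rule sum.remove[OF insert.prems(1) p(1)])
      also have "(\<Sum>s\<in>S - {p}. b' s * c s u) = (\<Sum>s\<in>S - {p}. b s * c s u)"
        by (rule sum.cong) (auto simp: b'_def)
      finally have "(\<Sum>s\<in>S. b' s * c s u) =
        (\<Sum>s\<in>S - {p}. b s * c s u) - (\<Sum>s\<in>S - {p}. b s * c s t / c p t) * c p u"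
        by (simp add: b'_def)
      also have "\<dots> = (\<Sum>s\<in>S - {p}. b s * c' s u)"
        unfolding sum_distrib_right sum_subtractf[symmetric] c'_def
        by (rule sum.cong) (simp_all add: right_diff_distrib)
      finally show ?thesis .
    qed
    have "(\<Sum>s\<in>S - {p}. b s * c' s t) = 0" using p by (simp add: c'_def)
    then have "\<forall>u\<in>insert t T. (\<Sum>s\<in>S. b' s * c s u) = 0" using b eq by auto
    moreover have "\<exists>s\<in>S. b' s \<noteq> 0" using b by (auto simp: b'_def)
    ultimately show ?thesis by blast
  qed
qed

lemma mono_span_dependent:
  assumes "finite K" "finite S" "card K < card S" "\<And>s. s \<in> S \<Longrightarrow> f s \<in> mono_span K"
  shows "\<exists>b. (\<exists>s\<in>S. b s \<noteq> 0) \<and> (\<forall>x. (\<Sum>s\<in>S. b s * f s x) = 0)"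
proof -
  have "\<forall>s\<in>S. \<exists>c. f s = (\<lambda>x. \<Sum>a\<in>K. c a * mono_fun a x)" using assms(4) by (auto simp: mono_span_def)
  then obtain c where c: "\<And>s. s \<in> S \<Longrightarrow> f s = (\<lambda>x. \<Sum>a\<in>K. c s a * mono_fun a x)" by metis
  obtain b where b: "\<exists>s\<in>S. b s \<noteq> 0" "\<forall>a\<in>K. (\<Sum>s\<in>S. b s * c s a) = 0"
    using linear_system_nontrivial[OF assms(1-3)] by blast
  have "(\<Sum>s\<in>S. b s * f s x) = 0" for x
  proof -
    have "(\<Sum>s\<in>S. b s * f s x) = (\<Sum>s\<in>S. \<Sum>a\<in>K. (b s * c s a) * mono_fun a x)"
      by (simp add: c sum_distrib_left mult.assoc)
    also have "\<dots> = (\<Sum>a\<in>K. (\<Sum>s\<in>S. b s * c s a) * mono_fun a x)"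
      by (subst sum.swap) (simp add: sum_distrib_right)
    finally show ?thesis using b by simp
  qed
  then show ?thesis using b by blast
qed

text \<open>Gaussian elimination with the Schur complement as a substitute for a determinant.\<close>

lemma singular_locus_equation:
  fixes C :: "'s \<Rightarrow> 's \<Rightarrow> ('v \<Rightarrow> complex) \<Rightarrow> complex"
  assumes "finite S" "\<And>i j. i \<in> S \<Longrightarrow> j \<in> S \<Longrightarrow> C i j \<in> pfun"
    and "\<And>i j. i \<in> S \<Longrightarrow> j \<in> S \<Longrightarrow> C i j u0 = (if i = j then 1 else 0)"
  shows "\<exists>G\<in>pfun. G u0 \<noteq> 0 \<and>
    (\<forall>u v. (\<exists>i\<in>S. v i \<noteq> 0) \<and> (\<forall>i\<in>S. (\<Sum>j\<in>S. C i j u * v j) = 0) \<longrightarrow> G u = 0)"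
  using assms
proof (induction S arbitrary: C rule: finite_induct)
  case empty
  show ?case by (rule bexI[of _ "\<lambda>u. 1"]) (auto intro: pfun.intros)
next
  case (insert s S)
  \<comment> \<open>The Schur complement multiplied by the pivot, so that no division occurs. At
    \<open>u0\<close> the pivot is 1 and \<open>D\<close> is again the identity.\<close>
  define D where "D i j u = C s s u * C i j u - C i s u * C s j u" for i j u
  have "\<exists>G\<in>pfun. G u0 \<noteq> 0 \<and>
    (\<forall>u v. (\<exists>i\<in>S. v i \<noteq> 0) \<and> (\<forall>i\<in>S. (\<Sum>j\<in>S. D i j u * v j) = 0) \<longrightarrow> G u = 0)"
  proof (rule insert.IH)
    show "D i j \<in> pfun" if "i \<in> S" "j \<in> S" for i j
      unfolding D_def[abs_def] using that by (intro pfun_diff pfun.intros insert.prems) auto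
    show "D i j u0 = (if i = j then 1 else 0)" if "i \<in> S" "j \<in> S" for i j
      unfolding D_def using that insert by auto
  qed
  then obtain G where G: "G \<in> pfun" "G u0 \<noteq> 0"
    "\<And>u v. (\<exists>i\<in>S. v i \<noteq> 0) \<Longrightarrow> (\<forall>i\<in>S. (\<Sum>j\<in>S. D i j u * v j) = 0) \<Longrightarrow> G u = 0" by blast
  show ?case
  \<comment> \<open>The factor \<open>C s s\<close> covers the points where the pivot vanishes and
    the elimination breaks down.\<close>
  proof (rule bexI[of _ "\<lambda>u. C s s u * G u"], intro conjI allI impI)
    show "(\<lambda>u. C s s u * G u) \<in> pfun" using G insert.prems by (intro pfun.intros) auto
    show "C s s u0 * G u0 \<noteq> 0" using insert.prems(2)[of s s] G(2) by simp
    fix u v assume *: "(\<exists>i\<in>insert s S. v i \<noteq> 0) \<and> (\<forall>i\<in>insert s S. (\<Sum>j\<in>insert s S. C i j u * v j) = 0)"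
    then have row: "C i s u * v s = - (\<Sum>j\<in>S. C i j u * v j)" if "i \<in> insert s S" for i
      using that insert.hyps by (metis (no_types, lifting) add_eq_0_iff2 sum.insert)
    show "C s s u * G u = 0"
    proof (cases "C s s u = 0")
      case False
      have "\<exists>i\<in>S. v i \<noteq> 0"
      proof (rule ccontr)
        assume "\<not> (\<exists>i\<in>S. v i \<noteq> 0)"
        then have "v s \<noteq> 0" "(\<Sum>j\<in>S. C s j u * v j) = 0" using * by auto
        then show False using row[of s] False by simp
      qed
      moreover have "(\<Sum>j\<in>S. D i j u * v j) = 0" if "i \<in> S" for i
      proof -
        have "(\<Sum>j\<in>S. D i j u * v j) = C s s u * (\<Sum>j\<in>S. C i j u * v j) - C i s u * (\<Sum>j\<in>S. C s j u * v j)"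
          by (simp add: D_def sum_distrib_left sum_subtractf left_diff_distrib mult.assoc)
        also have "(\<Sum>j\<in>S. C i j u * v j) = - (C i s u * v s)" using row[of i] that by simp
        also have "(\<Sum>j\<in>S. C s j u * v j) = - (C s s u * v s)" using row[of s] by simp
        finally show ?thesis by simp
      qed
      ultimately show ?thesis using G(3) by simp
    qed simp
  qed
qed

section \<open>Evaluation of polynomials\<close>

lemma peval_sum_superset:
  assumes "finite K" "Poly_Mapping.keys p \<subseteq> K"
  shows "peval p x = (\<Sum>m\<in>K. Poly_Mapping.lookup p m * (\<Prod>v\<in>Poly_Mapping.keys m. x v ^ Poly_Mapping.lookup m v))"
  unfolding peval_def insertion_def
  by (rule sum.mono_neutral_left) (use assms in \<open>auto simp: in_keys_iff\<close>)

lemma monomial_prod_superset: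
  fixes x :: "'v \<Rightarrow> 'a :: comm_semiring_1"
  assumes "finite V" "Poly_Mapping.keys m \<subseteq> V"
  shows "(\<Prod>v\<in>Poly_Mapping.keys m. x v ^ Poly_Mapping.lookup m v) = (\<Prod>v\<in>V. x v ^ Poly_Mapping.lookup m v)"
  by (rule prod.mono_neutral_left) (use assms in \<open>auto simp: in_keys_iff\<close>)

lemma peval_0: "peval 0 x = 0"
  by (simp add: peval_def insertion_def)

lemma peval_add: "peval (p + q) x = peval p x + peval q x"
proof -
  let ?K = "Poly_Mapping.keys p \<union> Poly_Mapping.keys q"
  have "Poly_Mapping.keys (p + q) \<subseteq> ?K" by (rule keys_add)
  then show ?thesis
    by (simp add: peval_sum_superset[of ?K] lookup_add algebra_simps sum.distrib)
qed

lemma peval_sum: "peval (\<Sum>s\<in>S. p s) x = (\<Sum>s\<in>S. peval (p s) x)"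
  by (induction S rule: infinite_finite_induct) (simp_all add: peval_0 peval_add)

lemma peval_single:
  "peval (Poly_Mapping.single m c) x = c * (\<Prod>v\<in>Poly_Mapping.keys m. x v ^ Poly_Mapping.lookup m v)"
  by (subst peval_sum_superset[of "{m}"]) auto

lemma poly_mapping_sum_singles:
  "p = (\<Sum>m\<in>Poly_Mapping.keys p. Poly_Mapping.single m (Poly_Mapping.lookup p m))"
  by (rule poly_mapping_eqI) (auto simp: lookup_sum lookup_single when_def in_keys_iff)

lemma peval_single_mult:
  "peval (Poly_Mapping.single m c * Poly_Mapping.single m' c') x =
     peval (Poly_Mapping.single m c) x * peval (Poly_Mapping.single m' c') x"
proof -
  let ?V = "Poly_Mapping.keys m \<union> Poly_Mapping.keys m'"
  have V: "finite ?V" "Poly_Mapping.keys m \<subseteq> ?V" "Poly_Mapping.keys m' \<subseteq> ?V"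
    "Poly_Mapping.keys (m + m') \<subseteq> ?V" using keys_add[of m m'] by auto
  show ?thesis
    unfolding mult_single peval_single
      monomial_prod_superset[OF V(1,2)] monomial_prod_superset[OF V(1,3)] monomial_prod_superset[OF V(1,4)]
    by (simp add: lookup_add power_add prod.distrib)
qed

lemma peval_mult: "peval (p * q) x = peval p x * peval q x"
proof -
  let ?s = "\<lambda>p m. Poly_Mapping.single m (Poly_Mapping.lookup p m)"
  have "p * q = (\<Sum>m\<in>Poly_Mapping.keys p. \<Sum>m'\<in>Poly_Mapping.keys q. ?s p m * ?s q m')"
    by (subst poly_mapping_sum_singles[of p], subst poly_mapping_sum_singles[of q]) (simp add: sum_product)
  then have "peval (p * q) x =
      (\<Sum>m\<in>Poly_Mapping.keys p. \<Sum>m'\<in>Poly_Mapping.keys q. peval (?s p m) x * peval (?s q m') x)"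
    by (simp add: peval_sum peval_single_mult)
  also have "\<dots> = peval (\<Sum>m\<in>Poly_Mapping.keys p. ?s p m) x * peval (\<Sum>m\<in>Poly_Mapping.keys q. ?s q m) x"
    by (simp add: peval_sum sum_product)
  finally show ?thesis by (simp flip: poly_mapping_sum_singles)
qed

lemma peval_Const: "peval (Const c) x = c"
  by (simp add: Const_def peval_single)

lemma peval_Var: "peval (Var v) x = x v"
  by (simp add: Var_def peval_single)

lemma peval_1: "peval 1 x = 1"
  using peval_Const[of 1 x] by (simp add: Const_def single_one)

lemma peval_power: "peval (p ^ n) x = peval p x ^ n"
  by (induction n) (simp_all add: peval_1 peval_mult)

lemma peval_prod: "peval (\<Prod>s\<in>S. p s) x = (\<Prod>s\<in>S. peval (p s) x)"
  by (induction S rule: infinite_finite_induct) (simp_all add: peval_1 peval_mult)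

lemma peval_psubst: "peval (psubst s p) x = peval p (\<lambda>v. peval (s v) x)"
  by (simp add: psubst_def insertion_def peval_def[of p] peval_sum peval_mult peval_Const peval_prod peval_power)

lemma peval_of_int: "peval (of_int k) x = of_int k"
proof -
  have nat: "peval (of_nat n) x = of_nat n" for n
    by (induction n) (simp_all add: peval_0 peval_add peval_1)
  have "peval (- p) x + peval p x = 0" for p :: "'a mpoly" using peval_add[of "- p" p x] by (simp add: peval_0)
  then have "peval (- p) x = - peval p x" for p :: "'a mpoly" by (simp add: add_eq_0_iff2)
  then show ?thesis by (cases k) (simp_all add: nat del: of_nat_Suc)
qed

lemma peval_det: "peval (det M) x = det (\<chi> i j. peval (M $ i $ j) x)"
  by (simp add: det_def peval_sum peval_mult peval_prod peval_of_int)

subsection \<open>Homogeneous polynomials and homogeneous functions\<close>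

definition hom_degree :: "nat \<Rightarrow> 'v mpoly \<Rightarrow> bool" where
  "hom_degree k p \<longleftrightarrow> (\<forall>m\<in>Poly_Mapping.keys p. (\<Sum>v\<in>Poly_Mapping.keys m. Poly_Mapping.lookup m v) = k)"

lemma homogeneous_iff_hom_degree: "homogeneous p \<longleftrightarrow> (\<exists>k. hom_degree k p)"
  by (simp add: homogeneous_def hom_degree_def)

lemma hom_add: "hom_degree k p \<Longrightarrow> hom_degree k q \<Longrightarrow> hom_degree k (p + q)"
  using keys_add[of p q] by (auto simp: hom_degree_def)

lemma monomial_degree_add:
  fixes m m' :: "'v \<Rightarrow>\<^sub>0 nat"
  shows "(\<Sum>v\<in>Poly_Mapping.keys (m + m'). Poly_Mapping.lookup (m + m') v) =
     (\<Sum>v\<in>Poly_Mapping.keys m. Poly_Mapping.lookup m v) + (\<Sum>v\<in>Poly_Mapping.keys m'. Poly_Mapping.lookup m' v)"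
  by (rule setsum_keys_plus_distrib) auto

lemma hom_mult: "hom_degree k p \<Longrightarrow> hom_degree l q \<Longrightarrow> hom_degree (k + l) (p * q)"
  using keys_mult[of p q] by (fastforce simp: hom_degree_def monomial_degree_add)

lemma hfun_imp_hom: "f \<in> hfun B k \<Longrightarrow> \<exists>p. hom_degree k p \<and> (\<forall>x. peval p x = f x)"
proof (induction rule: hfun_induct)
  case (hfun_const c)
  show ?case by (rule exI[of _ "Const c"]) (simp add: peval_Const, simp add: hom_degree_def Const_def)
next
  case (hfun_zero k)
  show ?case by (rule exI[of _ 0]) (simp add: peval_0 hom_degree_def)
next
  case (hfun_var v)
  show ?case by (rule exI[of _ "Var v"]) (simp add: peval_Var, simp add: hom_degree_def Var_def)
next
  case (hfun_add k f g)
  then obtain p q where "hom_degree k p" "\<forall>x. peval p x = f x" "hom_degree k q" "\<forall>x. peval q x = g x" by blast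
  then show ?case by (intro exI[of _ "p + q"]) (simp add: peval_add hom_add)
next
  case (hfun_mult k f l g)
  then obtain p q where "hom_degree k p" "\<forall>x. peval p x = f x" "hom_degree l q" "\<forall>x. peval q x = g x" by blast
  then show ?case by (intro exI[of _ "p * q"]) (simp add: peval_mult hom_mult)
qed

lemma pfun_imp_peval: "f \<in> pfun \<Longrightarrow> \<exists>p. \<forall>x. peval p x = f x"
proof (induction rule: pfun.induct)
  case (pfun_const c)
  show ?case by (rule exI[of _ "Const c"]) (simp add: peval_Const)
next
  case (pfun_var v)
  show ?case by (rule exI[of _ "Var v"]) (simp add: peval_Var)
next
  case (pfun_add f g)
  then show ?case by (metis peval_add)
next
  case (pfun_mult f g)
  then show ?case by (metis peval_mult)
qed

lemma hom_imp_hfun: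
  assumes "hom_degree k p"
  shows "peval p \<in> hfun UNIV k"
proof -
  have "(\<lambda>x. \<Prod>v\<in>Poly_Mapping.keys m. x v ^ Poly_Mapping.lookup m v) \<in> hfun UNIV k"
    if "m \<in> Poly_Mapping.keys p" for m
  proof -
    have "(\<lambda>x. x v ^ Poly_Mapping.lookup m v) \<in> hfun UNIV (Poly_Mapping.lookup m v)" for v
      using hfun_power[OF hfun_var, of v UNIV "Poly_Mapping.lookup m v"] by simp
    then have "(\<lambda>x. \<Prod>v\<in>Poly_Mapping.keys m. x v ^ Poly_Mapping.lookup m v)
      \<in> hfun UNIV (\<Sum>v\<in>Poly_Mapping.keys m. Poly_Mapping.lookup m v)"
      by (rule hfun_prod)
    then show ?thesis using assms that by (simp add: hom_degree_def)
  qed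
  then have "(\<lambda>x. \<Sum>m\<in>Poly_Mapping.keys p. Poly_Mapping.lookup p m *
      (\<Prod>v\<in>Poly_Mapping.keys m. x v ^ Poly_Mapping.lookup m v)) \<in> hfun UNIV k"
    by (intro hfun_sum hfun_cmult)
  then show ?thesis by (simp add: peval_def[abs_def] insertion_def)
qed

section \<open>Zariski closures\<close>

text \<open>The bridge from \<open>mpoly\<close> to functions: closures depend only on the values of
  homogeneous polynomials, and these values are exactly the functions in
  \<open>hfun UNIV k\<close>.\<close>

lemma zariski_closure_iff:
  "x \<in> zariski_closure S \<longleftrightarrow>
     x \<noteq> 0 \<and> (\<forall>k. \<forall>f\<in>hfun UNIV k. (\<forall>y\<in>S. f (($) y) = 0) \<longrightarrow> f (($) x) = 0)"
proof -
  have "peval p (($) x) = 0"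
    if "\<forall>k. \<forall>f\<in>hfun UNIV k. (\<forall>y\<in>S. f (($) y) = 0) \<longrightarrow> f (($) x) = 0" "homogeneous p"
      "\<forall>y\<in>S. peval p (($) y) = 0" for p
    using that hom_imp_hfun[of _ p] unfolding homogeneous_iff_hom_degree by blast
  moreover have "f (($) x) = 0"
    if *: "\<forall>p. homogeneous p \<and> (\<forall>y\<in>S. peval p (($) y) = 0) \<longrightarrow> peval p (($) x) = 0"
      "f \<in> hfun UNIV k" "\<forall>y\<in>S. f (($) y) = 0" for f k
    using hfun_imp_hom[OF *(2)] *(1,3) unfolding homogeneous_iff_hom_degree by metis
  ultimately show ?thesis
    unfolding zariski_closure_def proj_zeros_def proj_ideal_def by blast
qed

lemma zariski_closureD:
  "x \<in> zariski_closure S \<Longrightarrow> f \<in> hfun UNIV k \<Longrightarrow> (\<And>y. y \<in> S \<Longrightarrow> f (($) y) = 0) \<Longrightarrow> f (($) x) = 0"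
  unfolding zariski_closure_iff by blast

lemma zariski_closure_mono: "S \<subseteq> T \<Longrightarrow> zariski_closure S \<subseteq> zariski_closure T"
  unfolding zariski_closure_iff subset_iff by blast

lemma zariski_closure_nonzero: "x \<in> zariski_closure S \<Longrightarrow> x \<noteq> 0"
  unfolding zariski_closure_iff by blast

lemma zariski_closure_superset: "S - {0} \<subseteq> zariski_closure S"
  unfolding zariski_closure_iff subset_iff by blast

lemma zariski_closure_base: "x \<in> S \<Longrightarrow> x \<noteq> 0 \<Longrightarrow> x \<in> zariski_closure S"
  using zariski_closure_superset[of S] by blast

lemma proj_closedI: "(\<And>x. x \<in> zariski_closure Z \<Longrightarrow> x \<in> Z) \<Longrightarrow> 0 \<notin> Z \<Longrightarrow> proj_closed Z"
  using zariski_closure_superset[of Z] unfolding proj_closed_def by blast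

lemma proj_closed_nonzero: "proj_closed Z \<Longrightarrow> x \<in> Z \<Longrightarrow> x \<noteq> 0"
  using zariski_closure_nonzero unfolding proj_closed_def by blast

lemma proj_closed_zariski_closure: "proj_closed (zariski_closure S)"
proof (rule proj_closedI)
  fix x assume "x \<in> zariski_closure (zariski_closure S)"
  then show "x \<in> zariski_closure S"
    unfolding zariski_closure_iff[of x] using zariski_closureD by blast
qed (use zariski_closure_nonzero in blast)

lemma proj_closed_Int: "proj_closed Y \<Longrightarrow> proj_closed Z \<Longrightarrow> proj_closed (Y \<inter> Z)"
  using zariski_closure_mono[of "Y \<inter> Z" Y] zariski_closure_mono[of "Y \<inter> Z" Z] proj_closed_nonzero[of Y]
  by (intro proj_closedI) (blast | simp add: proj_closed_def; blast)+

lemma proj_closed_zeros: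
  assumes "f \<in> hfun UNIV k"
  shows "proj_closed {x. x \<noteq> 0 \<and> f (($) x) = 0}"
  by (rule proj_closedI) (use zariski_closure_nonzero zariski_closureD[OF _ assms] in auto)

lemma proj_closed_separate:
  assumes "proj_closed Z" "x \<notin> Z" "x \<noteq> 0"
  obtains k f where "f \<in> hfun UNIV k" "\<And>y. y \<in> Z \<Longrightarrow> f (($) y) = 0" "f (($) x) \<noteq> 0"
  using assms unfolding proj_closed_def zariski_closure_iff set_eq_iff by blast

text \<open>The homogeneous ideal of an irreducible set is prime: the zero loci of \<open>f\<close>
  and \<open>g\<close> in \<open>Z\<close> are closed and cover \<open>Z\<close>.\<close>

lemma proj_irreducible_product:
  assumes Z: "proj_irreducible Z" and f: "f \<in> hfun UNIV k" and g: "g \<in> hfun UNIV l"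
    and fg: "\<And>x. x \<in> Z \<Longrightarrow> f (($) x) * g (($) x) = 0"
  shows "(\<forall>x\<in>Z. f (($) x) = 0) \<or> (\<forall>x\<in>Z. g (($) x) = 0)"
proof -
  let ?V = "\<lambda>f. Z \<inter> {x. x \<noteq> 0 \<and> f (($) x) = 0}"
  have "proj_closed Z" using Z by (simp add: proj_irreducible_def)
  then have "proj_closed (?V f)" "proj_closed (?V g)"
    using proj_closed_zeros[OF f] proj_closed_zeros[OF g] by (auto intro: proj_closed_Int)
  moreover have "Z = ?V f \<union> ?V g" using fg proj_closed_nonzero[OF \<open>proj_closed Z\<close>] by fastforce
  ultimately have "Z = ?V f \<or> Z = ?V g" using Z unfolding proj_irreducible_def by blast
  then show ?thesis by blast
qed

section \<open>Hilbert's Nullstellensatz\<close>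

definition is_ideal :: "(('v::finite \<Rightarrow> complex) \<Rightarrow> complex) set \<Rightarrow> bool" where
  "is_ideal J \<longleftrightarrow> J \<subseteq> pfun \<and> (\<lambda>x. 0) \<in> J \<and> (\<forall>f\<in>J. \<forall>g\<in>J. (\<lambda>x. f x + g x) \<in> J) \<and>
     (\<forall>f\<in>pfun. \<forall>g\<in>J. (\<lambda>x. f x * g x) \<in> J)"

text \<open>Maximality in the form in which it is applied: the quotient by \<open>M\<close> is a
  field.\<close>

definition is_maximal_ideal :: "(('v::finite \<Rightarrow> complex) \<Rightarrow> complex) set \<Rightarrow> bool" where
  "is_maximal_ideal M \<longleftrightarrow> is_ideal M \<and> (\<lambda>x. 1) \<notin> M \<and>
     (\<forall>f\<in>pfun. f \<notin> M \<longrightarrow> (\<exists>g\<in>pfun. (\<lambda>x. 1 - f x * g x) \<in> M))"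

lemma
  assumes "is_ideal J"
  shows ideal_pfun: "f \<in> J \<Longrightarrow> f \<in> pfun"
    and ideal_0: "(\<lambda>x. 0) \<in> J"
    and ideal_add: "f \<in> J \<Longrightarrow> g \<in> J \<Longrightarrow> (\<lambda>x. f x + g x) \<in> J"
    and ideal_mult: "f \<in> pfun \<Longrightarrow> g \<in> J \<Longrightarrow> (\<lambda>x. f x * g x) \<in> J"
  using assms unfolding is_ideal_def by blast+

lemma ideal_sum: "is_ideal J \<Longrightarrow> (\<And>s. s \<in> S \<Longrightarrow> f s \<in> J) \<Longrightarrow> (\<lambda>x. \<Sum>s\<in>S. f s x) \<in> J"
  by (induction S rule: infinite_finite_induct) (simp_all add: ideal_0 ideal_add)

lemma maximal_ideal_exists:
  assumes J: "is_ideal J" "(\<lambda>x. 1) \<notin> J"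
  shows "\<exists>M. is_maximal_ideal M \<and> J \<subseteq> M"
proof -
  define A where "A = {I. is_ideal I \<and> (\<lambda>x. 1) \<notin> I \<and> J \<subseteq> I}"
  have "\<exists>M\<in>A. \<forall>X\<in>A. M \<subseteq> X \<longrightarrow> X = M"
  proof (rule subset_Zorn_nonempty)
    show "A \<noteq> {}" using J by (auto simp: A_def)
    fix C assume C: "C \<noteq> {}" "subset.chain A C"
    then have CA: "\<And>I. I \<in> C \<Longrightarrow> is_ideal I \<and> (\<lambda>x. 1) \<notin> I \<and> J \<subseteq> I"
      by (auto simp: A_def subset.chain_def)
    obtain I0 where I0: "I0 \<in> C" using C by blast
    have "is_ideal (\<Union>C)"
      unfolding is_ideal_def
    proof (intro conjI ballI)
      show "\<Union>C \<subseteq> pfun"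
      proof
        fix f assume "f \<in> \<Union>C"
        then obtain X where "X \<in> C" "f \<in> X" by blast
        then show "f \<in> pfun" using ideal_pfun[of X f] CA by simp
      qed
      show "(\<lambda>x. 0) \<in> \<Union>C" using ideal_0[of I0] CA[OF I0] I0 by auto
      fix f g assume "g \<in> \<Union>C"
      then obtain I' where I': "g \<in> I'" "I' \<in> C" by blast
      show "(\<lambda>x. f x * g x) \<in> \<Union>C" if "f \<in> pfun"
        using ideal_mult[OF _ that I'(1)] CA[OF I'(2)] I'(2) by auto
      show "(\<lambda>x. f x + g x) \<in> \<Union>C" if f: "f \<in> \<Union>C"
      proof -
        obtain I where I: "f \<in> I" "I \<in> C" using f by blast
        then have "I \<subseteq> I' \<or> I' \<subseteq> I" using C(2) I' by (auto simp: subset.chain_def)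
        then obtain I'' where I'': "I'' \<in> C" "f \<in> I''" "g \<in> I''" using I I' by blast
        then have "(\<lambda>x. f x + g x) \<in> I''" using ideal_add[of I'' f g] CA by simp
        then show ?thesis using I'' by (intro UnionI)
      qed
    qed
    then show "\<Union>C \<in> A" using CA I0 by (auto simp: A_def)
  qed
  then obtain M where MA: "M \<in> A" and max': "\<And>X. X \<in> A \<Longrightarrow> M \<subseteq> X \<Longrightarrow> X = M" by blast
  have M: "is_ideal M" "(\<lambda>x. 1) \<notin> M" "J \<subseteq> M" using MA by (simp_all add: A_def)
  have max: "X = M" if "is_ideal X" "(\<lambda>x. 1) \<notin> X" "M \<subseteq> X" for X
    using max'[of X] that M(3) by (simp add: A_def)
  have "\<exists>g\<in>pfun. (\<lambda>x. 1 - f x * g x) \<in> M" if f: "f \<in> pfun" "f \<notin> M" for f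
  proof -
    \<comment> \<open>The ideal generated by \<open>f\<close> and \<open>M\<close>. By maximality it
      contains 1, and the cofactor of \<open>f\<close> is the inverse modulo
      \<open>M\<close>.\<close>
    define I where "I = {k. \<exists>g\<in>pfun. \<exists>h\<in>M. k = (\<lambda>x. f x * g x + h x)}"
    have I_intro: "(\<lambda>x. f x * g x + h x) \<in> I" if "g \<in> pfun" "h \<in> M" for g h
      using that unfolding I_def by blast
    have "is_ideal I"
      unfolding is_ideal_def
    proof (intro conjI ballI)
      show "I \<subseteq> pfun"
      proof
        fix k assume "k \<in> I"
        then obtain g h where k: "g \<in> pfun" "h \<in> M" "k = (\<lambda>x. f x * g x + h x)" unfolding I_def by blast
        show "k \<in> pfun" unfolding k(3) using pfun_add[OF pfun_mult[OF f(1) k(1)] ideal_pfun[OF M(1) k(2)]] .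
      qed
      show "(\<lambda>x. 0) \<in> I" using I_intro[OF pfun_const[of 0] ideal_0[OF M(1)]] by simp
      fix k k' assume "k' \<in> I"
      then obtain g' h' where k': "g' \<in> pfun" "h' \<in> M" "k' = (\<lambda>x. f x * g' x + h' x)"
        unfolding I_def by blast
      show "(\<lambda>x. k x * k' x) \<in> I" if "k \<in> pfun"
      proof -
        have "(\<lambda>x. k x * k' x) = (\<lambda>x. f x * (k x * g' x) + k x * h' x)"
          using k' by (simp add: algebra_simps)
        then show ?thesis using I_intro[OF pfun_mult[OF that k'(1)] ideal_mult[OF M(1) that k'(2)]] by simp
      qed
      show "(\<lambda>x. k x + k' x) \<in> I" if kI: "k \<in> I"
      proof -
        obtain g h where k: "g \<in> pfun" "h \<in> M" "k = (\<lambda>x. f x * g x + h x)"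
          using kI unfolding I_def by blast
        have "(\<lambda>x. k x + k' x) = (\<lambda>x. f x * (g x + g' x) + (h x + h' x))"
          using k k' by (simp add: algebra_simps)
        then show ?thesis using I_intro[OF pfun_add[OF k(1) k'(1)] ideal_add[OF M(1) k(2) k'(2)]] by simp
      qed
    qed
    have "h \<in> I" if "h \<in> M" for h
      using I_intro[OF pfun_const[of 0] that] by simp
    moreover have "f \<in> I"
      using I_intro[OF pfun_const[of 1] ideal_0[OF M(1)]] by simp
    ultimately have "(\<lambda>x. 1) \<in> I" using max[OF \<open>is_ideal I\<close>] f(2) by blast
    then obtain g h where gh: "g \<in> pfun" "h \<in> M" "(\<lambda>x. 1) = (\<lambda>x. f x * g x + h x)"
      unfolding I_def by blast
    have "h = (\<lambda>x. 1 - f x * g x)"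
    proof
      fix x show "h x = 1 - f x * g x" using fun_cong[OF gh(3), of x] by (simp add: algebra_simps)
    qed
    then show ?thesis using gh(1,2) by (intro bexI[where x = g]) simp_all
  qed
  then show ?thesis using M unfolding is_maximal_ideal_def by blast
qed

lemma maximal_ideal_prime:
  assumes M: "is_maximal_ideal M" and f: "f \<in> pfun" "f \<notin> M" and g: "g \<in> pfun" "g \<notin> M"
  shows "(\<lambda>x. f x * g x) \<notin> M"
proof
  assume fg: "(\<lambda>x. f x * g x) \<in> M"
  have I: "is_ideal M" and "(\<lambda>x. 1) \<notin> M" using M by (auto simp: is_maximal_ideal_def)
  obtain f' g' where f': "f' \<in> pfun" "(\<lambda>x. 1 - f x * f' x) \<in> M"
    and g': "g' \<in> pfun" "(\<lambda>x. 1 - g x * g' x) \<in> M"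
    using M f g unfolding is_maximal_ideal_def by blast
  \<comment> \<open>A combination of three members of \<open>M\<close> in which everything cancels
    except 1.\<close>
  have "(\<lambda>x. (1 - f x * f' x) + ((f x * f' x) * (1 - g x * g' x) + (f' x * g' x) * (f x * g x))) \<in> M"
    by (rule ideal_add[OF I f'(2) ideal_add[OF I ideal_mult[OF I pfun_mult[OF f(1) f'(1)] g'(2)]
      ideal_mult[OF I pfun_mult[OF f'(1) g'(1)] fg]]])
  moreover have "(\<lambda>x. (1 - f x * f' x) + ((f x * f' x) * (1 - g x * g' x) + (f' x * g' x) * (f x * g x))) = (\<lambda>x. 1)"
    by (simp add: algebra_simps)
  ultimately show False using \<open>(\<lambda>x. 1) \<notin> M\<close> by simp
qed

lemma pfun_poly: "(\<lambda>x. poly q (x v)) \<in> pfun"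
proof (induction q)
  case (pCons a q)
  then show ?case by (simp add: pfun_add pfun_mult pfun_const pfun_var)
qed (simp add: pfun_const)

lemma ideal_const:
  assumes "is_ideal M" "(\<lambda>x. 1) \<notin> M" "(\<lambda>x. c) \<in> M"
  shows "c = 0"
  using ideal_mult[OF assms(1) pfun_const assms(3), of "1 / c"] assms(2) by (cases "c = 0") auto

text \<open>Over the complex numbers \<open>q\<close> splits into linear factors; none of them lies
  in \<open>M\<close>, and \<open>M\<close> is prime.\<close>

lemma maximal_ideal_poly:
  assumes M: "is_maximal_ideal M" and no: "\<And>c. (\<lambda>x. x v - c) \<notin> M"
  shows "q \<noteq> 0 \<Longrightarrow> (\<lambda>x. poly q (x v)) \<notin> M"
proof (induction "degree q" arbitrary: q)
  case 0
  then obtain c where "q = [:c:]" "c \<noteq> 0" by (metis degree_eq_zeroE pCons_eq_0_iff)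
  then show ?case using ideal_const[of M c] M by (auto simp: is_maximal_ideal_def)
next
  case (Suc n)
  then have "\<not> constant (poly q)" using constant_degree[of q] by simp
  then obtain r where "poly q r = 0" using fundamental_theorem_of_algebra by blast
  then obtain q' where q': "q = [:- r, 1:] * q'" by (metis dvdE poly_eq_0_iff_dvd)
  then have "q' \<noteq> 0" using Suc by auto
  then have "degree q = Suc (degree q')" unfolding q' by (subst degree_mult_eq) auto
  then have "(\<lambda>x. poly q' (x v)) \<notin> M" using Suc \<open>q' \<noteq> 0\<close> by simp
  then have "(\<lambda>x. (x v - r) * poly q' (x v)) \<notin> M"
    by (intro maximal_ideal_prime[OF M] pfun_diff[OF pfun_var pfun_const] no pfun_poly)
  then show ?case by (simp add: q' algebra_simps)
qed

text \<open>
  Otherwise all \<open>1 / (x v - c)\<close> exist modulo \<open>M\<close>. They are uncountably many elements of a space of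
  countable dimension; clearing denominators in a linear relation gives a nonzero polynomial in
  \<open>x v\<close> in \<open>M\<close>.
\<close>

lemma maximal_ideal_coordinate:
  fixes M :: "(('v::finite \<Rightarrow> complex) \<Rightarrow> complex) set"
  assumes M: "is_maximal_ideal M"
  shows "\<exists>c. (\<lambda>x. x v - c) \<in> M"
proof (rule ccontr)
  assume "\<not> ?thesis"
  then have no: "\<And>c. (\<lambda>x. x v - c) \<notin> M" by blast
  have I: "is_ideal M" using M by (simp add: is_maximal_ideal_def)
  have "\<exists>g\<in>pfun. (\<lambda>x. 1 - (x v - c) * g x) \<in> M" for c
    using M no[of c] pfun_diff[OF pfun_var pfun_const, of v c] unfolding is_maximal_ideal_def by blast
  then obtain g where g: "\<And>c. g c \<in> pfun" "\<And>c. (\<lambda>x. 1 - (x v - c) * g c x) \<in> M" by metis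
  obtain N where N: "\<And>c. g c \<in> mono_span (exp_box (N c))" using pfun_mono_span[OF g(1)] by metis
  \<comment> \<open>Uncountably many \<open>c\<close> are distributed over countably many bounds, so
    infinitely many \<open>g c\<close> share one finite-dimensional space.\<close>
  have "\<exists>k. infinite (N -` {k})"
  proof (rule ccontr)
    assume "\<not> ?thesis"
    then have "countable (\<Union>k. N -` {k})" by (intro countable_UN) (auto simp: countable_finite)
    moreover have "(\<Union>k. N -` {k}) = UNIV" by auto
    ultimately show False using uncountable_UNIV_complex by simp
  qed
  then obtain k where "infinite (N -` {k})" by blast
  then obtain C where C: "C \<subseteq> N -` {k}" "finite C" "card C = Suc (card (exp_box k :: ('v \<Rightarrow> nat) set))"
    using infinite_arbitrarily_large by blast
  have "g c \<in> mono_span (exp_box k)" if "c \<in> C" for c using N[of c] that C(1) by auto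
  then obtain b where b: "\<exists>c\<in>C. b c \<noteq> 0" "\<And>x. (\<Sum>c\<in>C. b c * g c x) = 0"
    using mono_span_dependent[OF finite_exp_box C(2), of k g] C(3) by auto
  \<comment> \<open>The numerator of \<Sum> \<open>b c / (t - c)\<close> over the common
    denominator. At \<open>c0\<close> only the summand of \<open>c0\<close> survives, hence
    \<open>q \<noteq> 0\<close>.\<close>
  define q where "q = (\<Sum>c\<in>C. smult (b c) (\<Prod>l\<in>C - {c}. [:- l, 1:]))"
  have q: "poly q t = (\<Sum>c\<in>C. b c * (\<Prod>l\<in>C - {c}. t - l))" for t
    by (simp add: q_def poly_sum poly_prod)
  obtain c0 where c0: "c0 \<in> C" "b c0 \<noteq> 0" using b by blast
  have "poly q c0 = b c0 * (\<Prod>l\<in>C - {c0}. c0 - l) + (\<Sum>c\<in>C - {c0}. b c * (\<Prod>l\<in>C - {c}. c0 - l))"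
    unfolding q by (rule sum.remove[OF C(2) c0(1)])
  also have "(\<Sum>c\<in>C - {c0}. b c * (\<Prod>l\<in>C - {c}. c0 - l)) = 0"
  proof (rule sum.neutral, rule ballI)
    fix c assume c: "c \<in> C - {c0}"
    then have "(\<Prod>l\<in>C - {c}. c0 - l) = 0" using c0 C(2) by (intro prod_zero) auto
    then show "b c * (\<Prod>l\<in>C - {c}. c0 - l) = 0" by simp
  qed
  finally have "poly q c0 \<noteq> 0" using c0 C(2) by simp
  then have "q \<noteq> 0" by auto
  then have "(\<lambda>x. poly q (x v)) \<notin> M" by (rule maximal_ideal_poly[OF M no])
  moreover have "(\<lambda>x. poly q (x v)) \<in> M"
  proof -
    \<comment> \<open>Modulo \<open>M\<close> the function \<open>(x v - c) * g c\<close> is 1. In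
      this sum the terms with \<open>g c\<close> collect into the full product times the linear
      relation, which is 0, and what remains is \<open>q\<close>.\<close>
    have "(\<lambda>x. \<Sum>c\<in>C. (b c * (\<Prod>l\<in>C - {c}. x v - l)) * (1 - (x v - c) * g c x)) \<in> M"
      by (rule ideal_sum[OF I], rule ideal_mult[OF I _ g(2)])
        (intro pfun_mult pfun_const pfun_prod pfun_diff pfun_var)
    moreover have "(\<Sum>c\<in>C. (b c * (\<Prod>l\<in>C - {c}. x v - l)) * (1 - (x v - c) * g c x)) = poly q (x v)" for x
    proof -
      have "(b c * (\<Prod>l\<in>C - {c}. x v - l)) * (1 - (x v - c) * g c x) =
          b c * (\<Prod>l\<in>C - {c}. x v - l) - (\<Prod>l\<in>C. x v - l) * (b c * g c x)" if "c \<in> C" for c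
        unfolding prod.remove[OF C(2) that, of "\<lambda>l. x v - l"] by (simp add: algebra_simps)
      then have "(\<Sum>c\<in>C. (b c * (\<Prod>l\<in>C - {c}. x v - l)) * (1 - (x v - c) * g c x)) =
          (\<Sum>c\<in>C. b c * (\<Prod>l\<in>C - {c}. x v - l)) - (\<Prod>l\<in>C. x v - l) * (\<Sum>c\<in>C. b c * g c x)"
        by (simp add: sum_subtractf sum_distrib_left)
      then show ?thesis using b(2) q by simp
    qed
    ultimately show ?thesis by simp
  qed
  ultimately show False by blast
qed

text \<open>A maximal ideal above \<open>J\<close> contains some \<open>x v - c v\<close> for each
  \<open>v\<close>, so every \<open>f\<close> is congruent to the constant \<open>f c\<close>; the
  only constant in a proper ideal is 0.\<close>

theorem nullstellensatz:
  fixes J :: "(('v::finite \<Rightarrow> complex) \<Rightarrow> complex) set"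
  assumes "is_ideal J" "(\<lambda>x. 1) \<notin> J"
  shows "\<exists>c. \<forall>f\<in>J. f c = 0"
proof -
  obtain M where M: "is_maximal_ideal M" "J \<subseteq> M" using maximal_ideal_exists[OF assms] by blast
  have I: "is_ideal M" "(\<lambda>x. 1) \<notin> M" using M by (auto simp: is_maximal_ideal_def)
  obtain c where c: "\<And>v. (\<lambda>x. x v - c v) \<in> M" using maximal_ideal_coordinate[OF M(1)] by metis
  have eval: "(\<lambda>x. f x - f c) \<in> M" if "f \<in> pfun" for f
    using that
  proof induction
    case (pfun_const a)
    show ?case using ideal_0[OF I(1)] by simp
  next
    case (pfun_add f g)
    then show ?case using ideal_add[OF I(1) pfun_add.IH] by (simp add: algebra_simps)
  next
    case (pfun_mult f g)
    have "(\<lambda>x. f x * (g x - g c) + g c * (f x - f c)) \<in> M"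
      using ideal_add[OF I(1) ideal_mult[OF I(1) pfun_mult.hyps(1) pfun_mult.IH(2)]
          ideal_mult[OF I(1) pfun.pfun_const pfun_mult.IH(1)]] .
    then show ?case by (simp add: algebra_simps)
  qed (simp add: c)
  have "f c = 0" if "f \<in> J" for f
  proof -
    have "f \<in> M" using that M by blast
    have "(\<lambda>x. f x + (- 1) * (f x - f c)) \<in> M"
      by (rule ideal_add[OF I(1) \<open>f \<in> M\<close> ideal_mult[OF I(1) pfun_const eval[OF ideal_pfun[OF I(1) \<open>f \<in> M\<close>]]]])
    then show ?thesis using ideal_const[OF I] by simp
  qed
  then show ?thesis by blast
qed

text \<open>
  A family \<open>K\<close> of homogeneous parts of a homogeneous ideal is dehomogenized by setting a coordinate
  to 1, and the relation \<open>1 \<in> J\<close> is homogenized again.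
\<close>

theorem homogeneous_nullstellensatz:
  fixes K :: "nat \<Rightarrow> (('v::finite \<Rightarrow> complex) \<Rightarrow> complex) set"
  assumes K: "\<And>N. K N \<subseteq> hfun UNIV N"
    and K0: "\<And>N. (\<lambda>x. 0) \<in> K N"
    and K_add: "\<And>N f g. f \<in> K N \<Longrightarrow> g \<in> K N \<Longrightarrow> (\<lambda>x. f x + g x) \<in> K N"
    and K_mult: "\<And>N M f g. f \<in> hfun UNIV M \<Longrightarrow> g \<in> K N \<Longrightarrow> (\<lambda>x. f x * g x) \<in> K (M + N)"
    and no_zero: "\<And>x. (\<forall>N. \<forall>f\<in>K N. f x = 0) \<Longrightarrow> x = (\<lambda>v. 0)"
  shows "\<exists>N. (\<lambda>x. x i ^ N) \<in> K N"
proof -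
  \<comment> \<open>The functions whose homogenizations of all large degrees lie in
    \<open>K\<close>. Asking for all large \<open>N\<close> lets two members be added in a common
    degree.\<close>
  define J where "J = {p\<in>pfun. \<exists>N0. \<forall>N\<ge>N0. \<exists>h\<in>K N. \<forall>x. x i \<noteq> 0 \<longrightarrow> h x = x i ^ N * p (\<lambda>v. x v / x i)}"
  have J: "is_ideal J"
    unfolding is_ideal_def
  proof (intro conjI ballI)
    show "J \<subseteq> pfun" by (auto simp: J_def)
    have "\<exists>h\<in>K N. \<forall>x. x i \<noteq> 0 \<longrightarrow> h x = x i ^ N * 0" for N using K0[of N] by (intro bexI[where x = "\<lambda>x. 0"]) simp_all
    then show "(\<lambda>x. 0) \<in> J" by (auto simp: J_def pfun.pfun_const)
    fix p q assume "q \<in> J"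
    then obtain N2 where q: "q \<in> pfun"
      "\<And>N. N \<ge> N2 \<Longrightarrow> \<exists>h\<in>K N. \<forall>x. x i \<noteq> 0 \<longrightarrow> h x = x i ^ N * q (\<lambda>v. x v / x i)" by (auto simp: J_def)
    show "(\<lambda>x. p x + q x) \<in> J" if "p \<in> J"
    proof -
      obtain N1 where p: "p \<in> pfun"
        "\<And>N. N \<ge> N1 \<Longrightarrow> \<exists>h\<in>K N. \<forall>x. x i \<noteq> 0 \<longrightarrow> h x = x i ^ N * p (\<lambda>v. x v / x i)"
        using \<open>p \<in> J\<close> by (auto simp: J_def)
      have "\<exists>h\<in>K N. \<forall>x. x i \<noteq> 0 \<longrightarrow> h x = x i ^ N * (p (\<lambda>v. x v / x i) + q (\<lambda>v. x v / x i))"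
        if N: "N \<ge> max N1 N2" for N
      proof -
        obtain h h' where "h \<in> K N" "h' \<in> K N" "\<forall>x. x i \<noteq> 0 \<longrightarrow> h x = x i ^ N * p (\<lambda>v. x v / x i)"
          "\<forall>x. x i \<noteq> 0 \<longrightarrow> h' x = x i ^ N * q (\<lambda>v. x v / x i)"
        proof -
          have "N1 \<le> N" "N2 \<le> N" using N by simp_all
          then show thesis using p(2) q(2) that by meson
        qed
        then show ?thesis
          by (intro bexI[where x = "\<lambda>x. h x + h' x"]) (simp_all add: K_add distrib_left)
      qed
      then show ?thesis unfolding J_def using pfun_add[OF p(1) q(1)] by blast
    qed
    show "(\<lambda>x. p x * q x) \<in> J" if p: "p \<in> pfun"
    proof -
      obtain M where M: "\<And>N. N \<ge> M \<Longrightarrow> \<exists>h\<in>hfun UNIV N. \<forall>x. x i \<noteq> 0 \<longrightarrow> h x = x i ^ N * p (\<lambda>v. x v / x i)"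
        using homogenize[OF p, of i] by blast
      obtain h where h: "h \<in> hfun UNIV M" "\<forall>x. x i \<noteq> 0 \<longrightarrow> h x = x i ^ M * p (\<lambda>v. x v / x i)"
        using M by blast
      have "\<exists>h\<in>K N. \<forall>x. x i \<noteq> 0 \<longrightarrow> h x = x i ^ N * (p (\<lambda>v. x v / x i) * q (\<lambda>v. x v / x i))"
        if NM: "N \<ge> M + N2" for N
      proof -
        obtain h' where h': "h' \<in> K (N - M)"
          "\<forall>x. x i \<noteq> 0 \<longrightarrow> h' x = x i ^ (N - M) * q (\<lambda>v. x v / x i)"
        proof -
          have "N2 \<le> N - M" using NM by simp
          then show thesis using q(2) that by blast
        qed
        have N: "x i ^ N = x i ^ M * x i ^ (N - M)" for x :: "'v \<Rightarrow> complex"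
          using NM by (simp flip: power_add)
        have "(\<lambda>x. h x * h' x) \<in> K N" using K_mult[OF h(1) h'(1)] NM by simp
        then show ?thesis using h h'
          by (intro bexI[where x = "\<lambda>x. h x * h' x"]) (simp_all add: N mult.assoc mult.left_commute)
      qed
      then show ?thesis unfolding J_def using pfun_mult[OF p q(1)] by blast
    qed
  qed
  have K_J: "f \<in> J" if f: "f \<in> K M" for f M
  proof -
    have "\<exists>h\<in>K N. \<forall>x. x i \<noteq> 0 \<longrightarrow> h x = x i ^ N * f (\<lambda>v. x v / x i)" if N: "N \<ge> M" for N
    proof (rule bexI[where x = "\<lambda>x. x i ^ (N - M) * f x"], intro allI impI)
      have "(\<lambda>x. x i ^ (N - M)) \<in> hfun UNIV (N - M)" using hfun_power[OF hfun_var, of i UNIV "N - M"] by simp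
      then show "(\<lambda>x. x i ^ (N - M) * f x) \<in> K N" using K_mult[OF _ f, of _ "N - M"] N by simp
      fix x :: "'v \<Rightarrow> complex" assume "x i \<noteq> 0"
      then have "f (\<lambda>v. inverse (x i) * x v) = inverse (x i) ^ M * f x"
        using hfun_scale[of f UNIV M "inverse (x i)" x] K f by auto
      moreover have "x i ^ N = x i ^ (N - M) * x i ^ M" using N by (simp flip: power_add)
      ultimately show "x i ^ (N - M) * f x = x i ^ N * f (\<lambda>v. x v / x i)"
        using \<open>x i \<noteq> 0\<close> by (simp add: field_simps)
    qed
    moreover have "f \<in> pfun" using K f hfun_imp_pfun by blast
    ultimately show ?thesis unfolding J_def by blast
  qed
  \<comment> \<open>On the chart \<open>x i = 1\<close> this function is 0, so the zero form is a
    homogenization of it. It forces a common zero of \<open>J\<close> to have \<open>i\<close>-th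
    coordinate 1, hence to be nonzero.\<close>
  have "(\<lambda>x. x i - 1) \<in> J"
  proof -
    have "\<exists>h\<in>K N. \<forall>x. x i \<noteq> 0 \<longrightarrow> h x = x i ^ N * (x i / x i - 1)" for N
      using K0[of N] by (intro bexI[where x = "\<lambda>x. 0"]) simp_all
    then show ?thesis unfolding J_def using pfun_diff[OF pfun_var pfun_const, of i 1] by blast
  qed
  have "(\<lambda>x. 1) \<in> J"
  proof (rule ccontr)
    assume "\<not> ?thesis"
    then obtain c where c: "\<And>f. f \<in> J \<Longrightarrow> f c = 0" using nullstellensatz[OF J] by blast
    have "c i - 1 = 0" using c[OF \<open>(\<lambda>x. x i - 1) \<in> J\<close>] .
    moreover have "c = (\<lambda>v. 0)" using no_zero c K_J by blast
    ultimately show False by simp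
  qed
  then obtain N h where h: "h \<in> K N" "\<forall>x. x i \<noteq> 0 \<longrightarrow> h x = x i ^ N" by (auto simp: J_def)
  \<comment> \<open>The extra factor \<open>x i\<close> makes the identity with the power of
    \<open>x i\<close> hold also where \<open>x i = 0\<close>, about which nothing is known for
    \<open>h\<close>.\<close>
  have "(\<lambda>x. x i * h x) \<in> K (1 + N)" by (rule K_mult[OF hfun_var h(1)]) simp
  moreover have "(\<lambda>x. x i * h x) = (\<lambda>x. x i ^ (1 + N))"
  proof
    fix x show "x i * h x = x i ^ (1 + N)" using h(2) by (cases "x i = 0") simp_all
  qed
  ultimately have "(\<lambda>x. x i ^ (1 + N)) \<in> K (1 + N)" by (simp only:)
  then show ?thesis by (rule exI)
qed

text \<open>By the pigeonhole principle, a monomial of large degree is divisible by a high power of a variable.\<close>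

corollary homogeneous_nullstellensatz_degree:
  fixes K :: "nat \<Rightarrow> (('v::finite \<Rightarrow> complex) \<Rightarrow> complex) set"
  assumes K: "\<And>N. K N \<subseteq> hfun UNIV N"
    and K0: "\<And>N. (\<lambda>x. 0) \<in> K N"
    and K_add: "\<And>N f g. f \<in> K N \<Longrightarrow> g \<in> K N \<Longrightarrow> (\<lambda>x. f x + g x) \<in> K N"
    and K_mult: "\<And>N M f g. f \<in> hfun UNIV M \<Longrightarrow> g \<in> K N \<Longrightarrow> (\<lambda>x. f x * g x) \<in> K (M + N)"
    and no_zero: "\<And>x. (\<forall>N. \<forall>f\<in>K N. f x = 0) \<Longrightarrow> x = (\<lambda>v. 0)"
  shows "\<exists>D>0. \<forall>a\<in>exps UNIV D. mono_fun a \<in> K D"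
proof -
  have "\<forall>i. \<exists>N. (\<lambda>x. x i ^ N) \<in> K N"
    using homogeneous_nullstellensatz[OF assms] by (intro allI)
  then obtain N where N: "\<And>i. (\<lambda>x. x i ^ N i) \<in> K (N i)" unfolding choice_iff by blast
  define D where "D = Suc (\<Sum>i\<in>UNIV. N i)"
  have "mono_fun a \<in> K D" if a: "a \<in> exps UNIV D" for a
  proof -
    have "\<exists>i. N i \<le> a i"
    proof (rule ccontr)
      assume "\<not> ?thesis"
      then have "(\<Sum>i\<in>UNIV. a i) \<le> (\<Sum>i\<in>UNIV. N i)" by (intro sum_mono) (simp add: not_le less_imp_le)
      then show False using a by (simp add: exps_def D_def)
    qed
    then obtain i where i: "N i \<le> a i" by blast
    define b where "b v = (if v = i then a i - N i else a v)" for v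
    have split: "a v = b v + (if v = i then N i else 0)" for v using i by (simp add: b_def)
    have "(\<Sum>v\<in>UNIV. a v) = (\<Sum>v\<in>UNIV. b v) + N i" unfolding split by (simp add: sum.distrib)
    then have D: "D = (\<Sum>v\<in>UNIV. b v) + N i" using a by (simp add: exps_def)
    have "mono_fun b \<in> hfun UNIV (\<Sum>v\<in>UNIV. b v)" by (rule mono_fun_hfun) (simp add: exps_def)
    then have "(\<lambda>x. mono_fun b x * x i ^ N i) \<in> K D" unfolding D using N by (rule K_mult)
    moreover have "mono_fun a = (\<lambda>x. mono_fun b x * x i ^ N i)"
    proof
      fix x
      have "a = (\<lambda>v. b v + (if v = i then N i else 0))" using split by (rule ext)
      then show "mono_fun a x = mono_fun b x * x i ^ N i" by (simp only: mono_fun_add mono_fun_axis)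
    qed
    ultimately show ?thesis by (simp only:)
  qed
  then show ?thesis unfolding D_def by blast
qed

section \<open>The row space, the column matroid and its flats\<close>

definition row_space :: "complex ^ 'n ^ 'm \<Rightarrow> (complex ^ 'n) set" where
  "row_space A = vec.span (rows A)"

text \<open>The linear dependencies among the columns, which are also the linear forms that vanish
  on the row space.\<close>

definition relation :: "complex ^ 'n ^ 'm \<Rightarrow> ('n \<Rightarrow> complex) \<Rightarrow> bool" where
  "relation A a \<longleftrightarrow> (\<forall>r. (\<Sum>i\<in>UNIV. A $ r $ i * a i) = 0)"

definition col_span :: "complex ^ 'n ^ 'm \<Rightarrow> 'n set \<Rightarrow> (complex ^ 'm) set" where
  "col_span A F = vec.span ((\<lambda>i. column i A) ` F)"

definition is_flat :: "complex ^ 'n ^ 'm \<Rightarrow> 'n set \<Rightarrow> bool" where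
  "is_flat A F \<longleftrightarrow> (\<forall>e. e \<notin> F \<longrightarrow> column e A \<notin> col_span A F)"

lemma
  shows row_space_add: "x \<in> row_space A \<Longrightarrow> y \<in> row_space A \<Longrightarrow> x + y \<in> row_space A"
    and row_space_scale: "x \<in> row_space A \<Longrightarrow> c *s x \<in> row_space A"
    and row_space_0: "0 \<in> row_space A"
  by (simp_all add: row_space_def vec.span_add vec.span_scale vec.span_zero)

lemma row_space_combination: "(\<chi> i. \<Sum>r\<in>UNIV. u r * A $ r $ i) \<in> row_space (A :: complex ^ 'n ^ 'm)"
proof -
  have "(\<Sum>r\<in>UNIV. u r *s row r A) \<in> row_space A"
    unfolding row_space_def by (intro vec.span_sum vec.span_scale vec.span_base) (auto simp: rows_def)
  moreover have "(\<Sum>r\<in>UNIV. u r *s row r A) = (\<chi> i. \<Sum>r\<in>UNIV. u r * A $ r $ i)"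
    by (simp add: vec_eq_iff row_def)
  ultimately show ?thesis by simp
qed

lemma row_space_relation:
  assumes "y \<in> row_space A" "relation A a"
  shows "(\<Sum>i\<in>UNIV. a i * y $ i) = 0"
  using assms(1) unfolding row_space_def
proof (induction rule: vec.span_induct_alt)
  case base
  show ?case by simp
next
  case (step c x y)
  then obtain r where "x = row r A" by (auto simp: rows_def)
  then have "(\<Sum>i\<in>UNIV. a i * x $ i) = 0"
    using assms(2) by (simp add: relation_def row_def mult.commute)
  moreover have "(\<Sum>i\<in>UNIV. a i * (c *s x + y) $ i) = c * (\<Sum>i\<in>UNIV. a i * x $ i) + (\<Sum>i\<in>UNIV. a i * y $ i)"
    by (simp add: algebra_simps sum.distrib sum_distrib_left)
  ultimately show ?case using step by simp
qed

lemma col_span_combination: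
  assumes "c \<in> col_span A F"
  shows "\<exists>k. (\<forall>i. i \<notin> F \<longrightarrow> k i = 0) \<and> (\<forall>r. c $ r = (\<Sum>i\<in>UNIV. A $ r $ i * k i))"
  using assms unfolding col_span_def
proof (induction rule: vec.span_induct_alt)
  case base
  show ?case by (rule exI[of _ "\<lambda>i. 0"]) simp
next
  case (step t x y)
  then obtain k e where k: "\<forall>i. i \<notin> F \<longrightarrow> k i = 0" "\<forall>r. y $ r = (\<Sum>i\<in>UNIV. A $ r $ i * k i)"
    and e: "x = column e A" "e \<in> F" by blast
  have "(\<Sum>i\<in>UNIV. A $ r $ i * (k i + (if i = e then t else 0))) = (t *s x + y) $ r" for r
    using k e by (simp add: distrib_left sum.distrib column_def if_distrib[of "\<lambda>x. _ * x"] cong: if_cong)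
  then show ?case using k e by (intro exI[of _ "\<lambda>i. k i + (if i = e then t else 0)"]) auto
qed

text \<open>A linear functional that kills the columns in \<open>F\<close> and is 1 on column
  \<open>e\<close> is given by coefficients of the rows; its values on all columns form the required
  vector.\<close>

lemma row_space_separate:
  assumes "column e A \<notin> col_span A F"
  shows "\<exists>x\<in>row_space (A :: complex ^ 'n ^ 'm). (\<forall>i\<in>F. x $ i = 0) \<and> x $ e = 1"
proof -
  let ?S = "(\<lambda>i. column i A) ` F"
  obtain C where C: "C \<subseteq> ?S" "vec.independent C" "?S \<subseteq> vec.span C" by (rule vec.basis_exists)
  have "vec.span C = col_span A F"
    unfolding col_span_def using C vec.span_mono[of C ?S] vec.span_minimal[OF C(3) vec.subspace_span] by blast
  then have "column e A \<notin> vec.span C" using assms by simp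
  then have "vec.independent (insert (column e A) C)" using C(2) by (rule vec.independent_insertI)
  \<comment> \<open>The extension is vector-valued, with 1 denoting the all-ones vector; any
    component \<open>k\<close> of it serves as the functional.\<close>
  from vec.linear_independent_extend[OF this, of "\<lambda>c. if c = column e A then 1 else 0"]
  obtain g :: "complex ^ 'm \<Rightarrow> complex ^ 'm"
    where g: "Vector_Spaces.linear (*s) (*s) g"
      "\<forall>c\<in>insert (column e A) C. g c = (if c = column e A then 1 else 0)" by blast
  have "column e A \<notin> C" using \<open>column e A \<notin> vec.span C\<close> vec.span_base by blast
  then have gC: "g c = 0" if "c \<in> C" for c using g(2) that by auto
  define G where "G = matrix g"
  have G: "G *v c = g c" for c unfolding G_def by (rule matrix_works[OF g(1)])
  have g0: "g c = 0" if "c \<in> vec.span C" for c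
    using that
  proof (induction rule: vec.span_induct_alt)
    case base
    show ?case by (simp flip: G)
  next
    case (step t x y)
    then show ?case using gC[of x]
      by (simp add: matrix_vector_right_distrib vector_scalar_commute flip: G)
  qed
  obtain k :: 'm where True by blast
  define x where "x = (\<chi> i. \<Sum>r\<in>UNIV. (G $ k $ r) * A $ r $ i)"
  have x: "x $ i = g (column i A) $ k" for i
    by (simp add: x_def column_def matrix_vector_mult_def flip: G)
  have "x $ i = 0" if "i \<in> F" for i
    using g0[of "column i A"] that C(3) by (auto simp: x)
  moreover have "x $ e = 1" using g(2) by (simp add: x)
  moreover have "x \<in> row_space A" unfolding x_def by (rule row_space_combination)
  ultimately show ?thesis by blast
qed

text \<open>A partial vector on \<open>F\<close> extends to the row space if it satisfies all
  relations supported on \<open>F\<close>. When \<open>e\<close> is added, its column either depends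
  on \<open>F\<close>, and the relation forces the value already present, or the value can be
  corrected by a separating vector.\<close>

lemma row_space_extend:
  fixes A :: "complex ^ 'n ^ 'm"
  assumes "\<And>a. relation A a \<Longrightarrow> (\<And>i. i \<notin> F \<Longrightarrow> a i = 0) \<Longrightarrow> (\<Sum>i\<in>UNIV. a i * v i) = 0"
  shows "\<exists>y\<in>row_space A. \<forall>i\<in>F. y $ i = v i"
  using finite[of F] assms
proof (induction F rule: finite_induct)
  case empty
  show ?case using row_space_0 by auto
next
  case (insert e F)
  have "\<exists>y\<in>row_space A. \<forall>i\<in>F. y $ i = v i"
    by (rule insert.IH, rule insert.prems) auto
  then obtain y where y: "y \<in> row_space A" "\<forall>i\<in>F. y $ i = v i" by blast
  show ?case
  proof (cases "column e A \<in> col_span A F")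
    case True
    then obtain k where k: "\<And>i. i \<notin> F \<Longrightarrow> k i = 0" "\<And>r. column e A $ r = (\<Sum>i\<in>UNIV. A $ r $ i * k i)"
      using col_span_combination by blast
    define a where "a i = k i - (if i = e then 1 else 0)" for i
    have rel: "relation A a"
      using k(2) unfolding relation_def a_def
      by (simp add: right_diff_distrib sum_subtractf column_def if_distrib[of "\<lambda>x. _ * x"] cong: if_cong)
    have split: "(\<Sum>i\<in>UNIV. a i * w i) = (\<Sum>i\<in>F. k i * w i) - w e" for w
    proof -
      have "(\<Sum>i\<in>UNIV. a i * w i) = (\<Sum>i\<in>UNIV. k i * w i) - w e"
        by (simp add: a_def left_diff_distrib sum_subtractf if_distrib[of "\<lambda>x. x * _"] cong: if_cong)
      moreover have "(\<Sum>i\<in>UNIV. k i * w i) = (\<Sum>i\<in>F. k i * w i)"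
        by (rule sum.mono_neutral_right) (auto simp: k(1))
      ultimately show ?thesis by simp
    qed
    have "(\<Sum>i\<in>UNIV. a i * v i) = 0" by (rule insert.prems[OF rel]) (auto simp: a_def k(1))
    moreover have "(\<Sum>i\<in>UNIV. a i * y $ i) = 0" by (rule row_space_relation[OF y(1) rel])
    moreover have "(\<Sum>i\<in>F. k i * y $ i) = (\<Sum>i\<in>F. k i * v i)" using y by simp
    ultimately have "y $ e = v e" unfolding split by simp
    then show ?thesis using y by blast
  next
    case False
    then obtain x where x: "x \<in> row_space A" "\<forall>i\<in>F. x $ i = 0" "x $ e = 1" using row_space_separate by blast
    have "y + (v e - y $ e) *s x \<in> row_space A" by (intro row_space_add row_space_scale y x)
    moreover have "\<forall>i\<in>insert e F. (y + (v e - y $ e) *s x) $ i = v i" using x y by auto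
    ultimately show ?thesis by blast
  qed
qed

text \<open>A generic combination works: for each new index a multiple of its witness is added,
  avoiding finitely many bad factors.\<close>

lemma row_space_nonvanishing:
  assumes "\<And>s. s \<in> S \<Longrightarrow> \<exists>x\<in>row_space (A :: complex ^ 'n ^ 'm). x $ s \<noteq> 0 \<and> (\<forall>i\<in>G. x $ i = 0)"
  shows "\<exists>x\<in>row_space A. (\<forall>s\<in>S. x $ s \<noteq> 0) \<and> (\<forall>i\<in>G. x $ i = 0)"
  using finite[of S] assms
proof (induction S rule: finite_induct)
  case empty
  show ?case using row_space_0 by (intro bexI[of _ 0]) auto
next
  case (insert s S)
  then obtain x where x: "x \<in> row_space A" "\<forall>s\<in>S. x $ s \<noteq> 0" "\<forall>i\<in>G. x $ i = 0" by blast
  obtain x' where x': "x' \<in> row_space A" "x' $ s \<noteq> 0" "\<forall>i\<in>G. x' $ i = 0" using insert.prems[of s] by auto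
  \<comment> \<open>If \<open>x' $ j = 0\<close>, the quotient is 0 by convention; such a coordinate
    is unaffected by \<open>t\<close> and \<open>x $ j\<close> is already nonzero.\<close>
  have "infinite (UNIV - (\<lambda>j. - x $ j / x' $ j) ` insert s S)" by (simp add: infinite_UNIV_char_0)
  then obtain t where t: "t \<notin> (\<lambda>j. - x $ j / x' $ j) ` insert s S" by (metis Diff_iff ex_in_conv finite.emptyI)
  have "x $ j + t * x' $ j \<noteq> 0" if j: "j \<in> insert s S" for j
  proof
    assume *: "x $ j + t * x' $ j = 0"
    have "x' $ j \<noteq> 0"
    proof
      assume "x' $ j = 0"
      then have "x $ j = 0" "j \<noteq> s" using * x' by auto
      then show False using x j by auto
    qed
    then have "t = - x $ j / x' $ j" using * by (simp add: field_simps add_eq_0_iff)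
    then show False using t j by blast
  qed
  then have "\<forall>j\<in>insert s S. (x + t *s x') $ j \<noteq> 0" by simp
  moreover have "x + t *s x' \<in> row_space A" by (intro row_space_add row_space_scale x x')
  moreover have "\<forall>i\<in>G. (x + t *s x') $ i = 0" using x x' by simp
  ultimately show ?case by blast
qed

lemma flat_cutout:
  assumes "is_flat A G"
  shows "\<exists>x\<in>row_space A. \<forall>i. x $ i = 0 \<longleftrightarrow> i \<in> G"
proof -
  have "\<exists>x\<in>row_space A. (\<forall>s\<in>- G. x $ s \<noteq> 0) \<and> (\<forall>i\<in>G. x $ i = 0)"
  proof (rule row_space_nonvanishing)
    fix s assume "s \<in> - G"
    then show "\<exists>x\<in>row_space A. x $ s \<noteq> 0 \<and> (\<forall>i\<in>G. x $ i = 0)"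
      using row_space_separate[of s A G] assms unfolding is_flat_def by force
  qed
  then show ?thesis by blast
qed

text \<open>That the empty set is a flat means that no column is 0. In this form the hypothesis that
  \<open>L\<close> lies in no coordinate hyperplane is used.\<close>

lemma row_space_nonvanishing_flat:
  assumes "is_flat A {}"
  shows "\<exists>x\<in>row_space A. \<forall>i. x $ i \<noteq> 0"
  using flat_cutout[OF assms] by simp

subsection \<open>Independent sets\<close>

lemma col_span_mono: "F \<subseteq> G \<Longrightarrow> col_span A F \<subseteq> col_span A G"
  unfolding col_span_def by (intro vec.span_mono image_mono)

lemma col_span_base: "i \<in> F \<Longrightarrow> column i A \<in> col_span A F"
  unfolding col_span_def by (intro vec.span_base) auto

lemma col_span_subset: "(\<And>i. i \<in> F \<Longrightarrow> column i A \<in> col_span A G) \<Longrightarrow> col_span A F \<subseteq> col_span A G"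
  unfolding col_span_def by (intro vec.span_minimal vec.subspace_span) auto

lemma matroid_indep_insert:
  assumes "e \<notin> I"
  shows "matroid_indep A (insert e I) \<longleftrightarrow> matroid_indep A I \<and> column e A \<notin> col_span A I"
proof -
  have "column e A \<notin> (\<lambda>i. column i A) ` I" if "column e A \<notin> col_span A I"
    using that col_span_base[of _ I A] by auto
  then show ?thesis
    using assms vec.independent_insert[of "column e A" "(\<lambda>i. column i A) ` I"]
    by (auto simp: matroid_indep_def col_span_def)
qed

lemma matroid_indep_subset: "matroid_indep A I \<Longrightarrow> J \<subseteq> I \<Longrightarrow> matroid_indep A J"
  using vec.independent_mono[of "(\<lambda>i. column i A) ` I" "(\<lambda>i. column i A) ` J"]
  by (auto simp: matroid_indep_def inj_on_subset)

lemma matroid_indep_card_le: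
  fixes I B :: "'n::finite set"
  assumes "matroid_indep A I" "\<And>i. i \<in> I \<Longrightarrow> column i A \<in> col_span A B"
  shows "card I \<le> card B"
proof -
  have "card ((\<lambda>i. column i A) ` I) \<le> card ((\<lambda>i. column i A) ` B)"
    using vec.independent_span_bound[of "(\<lambda>i. column i A) ` B" "(\<lambda>i. column i A) ` I"] assms
    by (auto simp: matroid_indep_def col_span_def)
  then show ?thesis using assms(1) card_image_le[of B "\<lambda>i. column i A"]
    by (auto simp: matroid_indep_def card_image)
qed

lemma matroid_indep_empty: "matroid_indep A {}"
  by (simp add: matroid_indep_def vec.independent_empty)

lemma matroid_rank_ge:
  fixes A :: "complex ^ 'n ^ 'm"
  assumes "I \<subseteq> S" "matroid_indep A I"
  shows "card I \<le> matroid_rank A S"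
  unfolding matroid_rank_def using assms by (intro Max_ge) auto

lemma matroid_basis:
  fixes A :: "complex ^ 'n ^ 'm"
  shows "\<exists>B\<subseteq>S. matroid_indep A B \<and> card B = matroid_rank A S \<and> (\<forall>i\<in>S. column i A \<in> col_span A B)"
proof -
  have "matroid_rank A S \<in> {card I | I. I \<subseteq> S \<and> matroid_indep A I}"
    unfolding matroid_rank_def using matroid_indep_empty[of A] by (intro Max_in) auto
  then obtain B where B: "B \<subseteq> S" "matroid_indep A B" "card B = matroid_rank A S" by auto
  have "column i A \<in> col_span A B" if "i \<in> S" for i
  proof (rule ccontr)
    assume *: "column i A \<notin> col_span A B"
    then have "i \<notin> B" using col_span_base by blast
    then have "matroid_indep A (insert i B)" using * B by (simp add: matroid_indep_insert)
    then have "card (insert i B) \<le> matroid_rank A S" using B that by (intro matroid_rank_ge) auto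
    then show False using \<open>i \<notin> B\<close> B by simp
  qed
  then show ?thesis using B by blast
qed

text \<open>A basis \<open>B\<close> of \<open>F\<close> spans the same space as \<open>F\<close>,
  and the rank grows exactly if \<open>insert e B\<close> is still independent.\<close>

lemma flats_iff: "F \<in> flats A \<longleftrightarrow> is_flat A F"
proof -
  have "matroid_rank A (insert e F) > matroid_rank A F \<longleftrightarrow> column e A \<notin> col_span A F"
    if e: "e \<notin> F" for e
  proof -
    obtain B where B: "B \<subseteq> F" "matroid_indep A B" "card B = matroid_rank A F" "\<forall>i\<in>F. column i A \<in> col_span A B"
      using matroid_basis by blast
    have eq: "col_span A F = col_span A B" using col_span_mono[OF B(1)] col_span_subset[of F A B] B(4) by blast
    show ?thesis
    proof
      assume "column e A \<notin> col_span A F"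
      then have "matroid_indep A (insert e B)" using B e by (subst matroid_indep_insert) (auto simp: eq)
      then have "card (insert e B) \<le> matroid_rank A (insert e F)" using B by (intro matroid_rank_ge) auto
      moreover have "e \<notin> B" using e B by auto
      ultimately show "matroid_rank A (insert e F) > matroid_rank A F" using B by simp
    next
      assume *: "matroid_rank A (insert e F) > matroid_rank A F"
      obtain I where I: "I \<subseteq> insert e F" "matroid_indep A I" "card I = matroid_rank A (insert e F)"
        using matroid_basis[of "insert e F" A] by blast
      show "column e A \<notin> col_span A F"
      proof
        assume "column e A \<in> col_span A F"
        then have "card I \<le> card B"
          using I B(4) eq by (intro matroid_indep_card_le[OF I(2)]) auto
        then show False using * I B by simp
      qed
    qed
  qed
  then show ?thesis unfolding flats_def is_flat_def by blast
qed

section \<open>Closure of a set of columns, and coordinates on the row space\<close>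

definition flat_closure :: "complex ^ 'n ^ 'm \<Rightarrow> 'n set \<Rightarrow> 'n set" where
  "flat_closure A S = {i. column i A \<in> col_span A S}"

lemma flat_closure_superset: "S \<subseteq> flat_closure A S"
  using col_span_base by (auto simp: flat_closure_def)

lemma is_flat_flat_closure: "is_flat A (flat_closure A S)"
proof -
  have "col_span A (flat_closure A S) \<subseteq> col_span A S" by (rule col_span_subset) (simp add: flat_closure_def)
  then show ?thesis by (auto simp: is_flat_def flat_closure_def)
qed

lemma flat_closure_subset: "is_flat A F \<Longrightarrow> S \<subseteq> F \<Longrightarrow> flat_closure A S \<subseteq> F"
  using col_span_mono[of S F A] by (auto simp: is_flat_def flat_closure_def)

text \<open>Each dependency of a column in \<open>F\<close> on the columns in \<open>B\<close> is a
  relation, and relations hold among the coordinates of all row-space vectors.\<close>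

lemma row_space_coordinates:
  assumes B: "\<And>i. i \<in> F \<Longrightarrow> column i A \<in> col_span A B"
  shows "\<exists>c. \<forall>y\<in>row_space (A :: complex ^ 'n ^ 'm). \<forall>i\<in>F. y $ i = (\<Sum>b\<in>B. c i b * y $ b)"
proof -
  have "\<exists>k. \<forall>y\<in>row_space A. y $ i = (\<Sum>b\<in>B. k b * y $ b)" if i: "i \<in> F" for i
  proof -
    obtain k where k: "\<And>j. j \<notin> B \<Longrightarrow> k j = 0" "\<And>r. column i A $ r = (\<Sum>j\<in>UNIV. A $ r $ j * k j)"
      using col_span_combination[OF B[OF i]] by blast
    have "y $ i = (\<Sum>b\<in>B. k b * y $ b)" if y: "y \<in> row_space A" for y
    proof -
      define a where "a j = k j - (if j = i then 1 else 0)" for j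
      have "relation A a"
        using k(2) unfolding relation_def a_def
        by (simp add: right_diff_distrib sum_subtractf column_def if_distrib[of "\<lambda>x. _ * x"] cong: if_cong)
      then have "(\<Sum>j\<in>UNIV. a j * y $ j) = 0" by (rule row_space_relation[OF y])
      moreover have "(\<Sum>j\<in>UNIV. a j * y $ j) = (\<Sum>j\<in>UNIV. k j * y $ j) - y $ i"
        by (simp add: a_def left_diff_distrib sum_subtractf if_distrib[of "\<lambda>x. x * _"] cong: if_cong)
      moreover have "(\<Sum>j\<in>UNIV. k j * y $ j) = (\<Sum>b\<in>B. k b * y $ b)"
        by (rule sum.mono_neutral_right) (auto simp: k(1))
      ultimately show ?thesis by simp
    qed
    then show ?thesis by blast
  qed
  then have "\<forall>i. \<exists>k. i \<in> F \<longrightarrow> (\<forall>y\<in>row_space A. y $ i = (\<Sum>b\<in>B. k b * y $ b))" by blast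
  then obtain c where "\<forall>i. i \<in> F \<longrightarrow> (\<forall>y\<in>row_space A. y $ i = (\<Sum>b\<in>B. c i b * y $ b))"
    unfolding choice_iff by blast
  then show ?thesis by blast
qed

text \<open>A row-space vector that vanishes on \<open>B\<close> except at \<open>i\<close> isolates
  the coefficient \<open>a i\<close>.\<close>

lemma matroid_indep_relation:
  assumes "matroid_indep A B" "relation A a" "\<And>i. i \<notin> B \<Longrightarrow> a i = 0"
  shows "a i = 0"
proof (rule ccontr)
  assume "a i \<noteq> 0"
  then have i: "i \<in> B" using assms(3) by blast
  have "matroid_indep A (insert i (B - {i}))" using assms(1) i by (simp add: insert_absorb)
  then have "column i A \<notin> col_span A (B - {i})" by (subst (asm) matroid_indep_insert) auto
  then obtain x where x: "x \<in> row_space A" "\<forall>j\<in>B - {i}. x $ j = 0" "x $ i = 1" using row_space_separate by blast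
  have "(\<Sum>j\<in>UNIV. a j * x $ j) = (\<Sum>j\<in>UNIV. if j = i then a i else 0)"
    by (rule sum.cong) (use x assms(3) in auto)
  then show False using row_space_relation[OF x(1) assms(2)] \<open>a i \<noteq> 0\<close> by simp
qed

lemma row_space_extend_indep:
  assumes "matroid_indep A B"
  shows "\<exists>y\<in>row_space A. \<forall>b\<in>B. y $ b = v b"
proof (rule row_space_extend)
  fix a assume "relation A a" "\<And>i. i \<notin> B \<Longrightarrow> a i = 0"
  then have "a i = 0" for i using matroid_indep_relation[OF assms] by blast
  then show "(\<Sum>i\<in>UNIV. a i * v i) = 0" by simp
qed

section \<open>Reciprocals of linear spaces\<close>

text \<open>The vector \<open>y\<close> is free off \<open>F\<close>. In the absence of zero columns
  the stratum is therefore nonempty for every \<open>F\<close>, although it lies in the reciprocal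
  space only if \<open>F\<close> is a nonempty flat.\<close>

definition stratum :: "complex ^ 'n ^ 'm \<Rightarrow> 'n set \<Rightarrow> (complex ^ 'n) set" where
  "stratum A F = {w. (\<forall>i. w $ i = 0 \<longleftrightarrow> i \<notin> F) \<and> (\<exists>y\<in>row_space A. \<forall>i\<in>F. y $ i = inverse (w $ i))}"

definition recip_section :: "complex ^ 'n ^ 'm \<Rightarrow> 'n set \<Rightarrow> (complex ^ 'n) set" where
  "recip_section A F = recip_power 1 (proj_row_span A) \<inter> coord_space F"

lemma stratumI:
  assumes "y \<in> row_space A" "\<And>i. i \<in> F \<Longrightarrow> y $ i \<noteq> 0"
  shows "(\<chi> i. if i \<in> F then inverse (y $ i) else 0) \<in> stratum A F"
  using assms by (auto simp: stratum_def intro!: bexI[of _ y])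

lemma stratum_nonempty:
  assumes "is_flat A {}"
  shows "\<exists>w. w \<in> stratum A F"
proof -
  obtain y where "y \<in> row_space A" "\<forall>i. y $ i \<noteq> 0" using row_space_nonvanishing_flat[OF assms] by blast
  then show ?thesis using stratumI[of y A F] by blast
qed

text \<open>Adding large multiples of a vector that cuts out the flat sends the remaining reciprocals to 0.\<close>

lemma stratum_limit:
  assumes G: "is_flat A G" and w: "w \<in> stratum A G"
  shows "\<exists>Y. (\<forall>n. Y n \<in> row_space A \<and> (\<forall>i. Y n $ i \<noteq> 0)) \<and>
    (\<forall>i. (\<lambda>n. inverse (Y n $ i)) \<longlonglongrightarrow> w $ i)"
proof -
  obtain x where x: "x \<in> row_space A" "\<And>i. x $ i = 0 \<longleftrightarrow> i \<in> G" using flat_cutout[OF G] by blast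
  obtain y where y: "y \<in> row_space A" "\<And>i. i \<in> G \<Longrightarrow> y $ i = inverse (w $ i)"
    and w0: "\<And>i. w $ i = 0 \<longleftrightarrow> i \<notin> G" using w by (auto simp: stratum_def)
  \<comment> \<open>From \<open>N\<close> on, the multiple of \<open>x\<close> exceeds
    \<open>y\<close> at every coordinate off \<open>G\<close>, so that \<open>Y n\<close> has no
    zero entry there. On \<open>G\<close> the quotients are 0 by convention.\<close>
  obtain N where N: "(\<Sum>i\<in>UNIV. norm (y $ i / x $ i)) < of_nat N" using reals_Archimedean2 by blast
  define Y where "Y n = y + of_nat (n + N) *s x" for n
  have Y0: "Y n $ i \<noteq> 0" for n i
  proof (cases "i \<in> G")
    case True
    then show ?thesis using x(2)[of i] y(2)[of i] w0[of i] by (simp add: Y_def)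
  next
    case False
    then have xi: "x $ i \<noteq> 0" using x(2) by blast
    show ?thesis
    proof
      assume "Y n $ i = 0"
      then have "y $ i + of_nat (n + N) * x $ i = 0" by (simp add: Y_def del: of_nat_add)
      then have "y $ i = - (of_nat (n + N) * x $ i)" by (rule eq_neg_iff_add_eq_0[THEN iffD2])
      then have "norm (y $ i / x $ i) = of_nat (n + N)" using xi by (simp del: of_nat_add)
      moreover have "norm (y $ i / x $ i) \<le> (\<Sum>i\<in>UNIV. norm (y $ i / x $ i))"
        by (rule member_le_sum) auto
      ultimately show False using N by simp
    qed
  qed
  have "(\<lambda>n. inverse (Y n $ i)) \<longlonglongrightarrow> w $ i" for i
  proof (cases "i \<in> G")
    case True
    then have "inverse (Y n $ i) = w $ i" for n using x(2)[of i] y(2)[of i] by (simp add: Y_def)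
    then show ?thesis by simp
  next
    case False
    then have xi: "x $ i \<noteq> 0" "w $ i = 0" using x(2) w0 by blast+
    have "filterlim (\<lambda>n. of_nat (n + N) :: complex) at_infinity sequentially"
      using filterlim_compose[OF tendsto_of_nat filterlim_add_const_nat_at_top] .
    then have "filterlim (\<lambda>n. x $ i * of_nat (n + N)) at_infinity sequentially"
      by (intro tendsto_mult_filterlim_at_infinity[OF tendsto_const xi(1)])
    then have "filterlim (\<lambda>n. y $ i + x $ i * of_nat (n + N)) at_infinity sequentially"
      by (intro tendsto_add_filterlim_at_infinity[OF tendsto_const])
    then have "(\<lambda>n. inverse (y $ i + x $ i * of_nat (n + N))) \<longlonglongrightarrow> 0"
      by (rule filterlim_compose[OF tendsto_inverse_0])
    then show ?thesis using xi by (simp add: Y_def algebra_simps)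
  qed
  moreover have "Y n \<in> row_space A" for n unfolding Y_def by (intro row_space_add row_space_scale x y)
  ultimately show ?thesis using Y0 by blast
qed

text \<open>Homogeneous equations are continuous, so they pass to the limit of
  \<open>stratum_limit\<close>. The exponent is kept general because both the first and the second
  reciprocal power are needed.\<close>

lemma stratum_power_recip:
  assumes G: "is_flat A G" "G \<noteq> {}" and w: "w \<in> stratum A G" and k: "k > 0"
  shows "(\<chi> i. w $ i ^ k) \<in> recip_power k (proj_row_span A)"
  unfolding recip_power_def zariski_closure_iff
proof (intro conjI allI ballI impI)
  obtain i where "i \<in> G" using G by blast
  then have "w $ i \<noteq> 0" using w by (auto simp: stratum_def)
  then have "(\<chi> i. w $ i ^ k) $ i \<noteq> 0" by simp
  then show "(\<chi> i. w $ i ^ k) \<noteq> 0" by (metis zero_index)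
  fix l f
  assume f: "f \<in> hfun UNIV l"
    and 0: "\<forall>y\<in>{\<chi> i. inverse (x $ i ^ k) |x. x \<in> proj_row_span A \<and> (\<forall>i. x $ i \<noteq> 0)}. f (($) y) = 0"
  obtain Y where Y: "\<And>n. Y n \<in> row_space A" "\<And>n i. Y n $ i \<noteq> 0"
    "\<And>i. (\<lambda>n. inverse (Y n $ i)) \<longlonglongrightarrow> w $ i" using stratum_limit[OF G(1) w] by blast
  have "f (\<lambda>i. inverse (Y n $ i) ^ k) = 0" for n
  proof -
    have "Y n \<noteq> 0" using Y(2)[of n] by auto
    then have "(\<chi> i. inverse (Y n $ i ^ k)) \<in> {\<chi> i. inverse (x $ i ^ k) |x. x \<in> proj_row_span A \<and> (\<forall>i. x $ i \<noteq> 0)}"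
      using Y(1,2)[of n] unfolding proj_row_span_def row_space_def by blast
    then have "f (($) (\<chi> i. inverse (Y n $ i ^ k))) = 0" using 0 by blast
    moreover have "($) (\<chi> i. inverse (Y n $ i ^ k)) = (\<lambda>i. inverse (Y n $ i) ^ k)"
      by (simp add: fun_eq_iff power_inverse)
    ultimately show ?thesis by simp
  qed
  moreover have "(\<lambda>n. f (\<lambda>i. inverse (Y n $ i) ^ k)) \<longlonglongrightarrow> f (\<lambda>i. w $ i ^ k)"
    by (intro pfun_tendsto[OF hfun_imp_pfun[OF f]] tendsto_power Y(3))
  moreover have "($) (\<chi> i. w $ i ^ k) = (\<lambda>i. w $ i ^ k)" by (simp add: fun_eq_iff)
  ultimately show "f (($) (\<chi> i. w $ i ^ k)) = 0" by (simp add: LIMSEQ_const_iff)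
qed

lemma stratum_subset_recip_section:
  assumes "is_flat A G" "G \<noteq> {}" "G \<subseteq> F"
  shows "stratum A G \<subseteq> recip_section A F"
proof
  fix w assume w: "w \<in> stratum A G"
  have "w \<in> recip_power 1 (proj_row_span A)" using stratum_power_recip[OF assms(1,2) w, of 1] by simp
  moreover obtain i where "i \<in> G" using assms by blast
  then have "w \<noteq> 0" using w by (auto simp: stratum_def)
  ultimately show "w \<in> recip_section A F"
    using w assms(3) by (auto simp: recip_section_def coord_space_def stratum_def)
qed

text \<open>
  The equation of the reciprocal linear space that comes from the relation
  \<open>\<Sum>i. a i / x i = 0\<close> by clearing denominators.
\<close>

definition relpoly :: "('n::finite \<Rightarrow> complex) \<Rightarrow> ('n \<Rightarrow> complex) \<Rightarrow> complex" where
  "relpoly a x = (\<Sum>i | a i \<noteq> 0. a i * (\<Prod>j\<in>{j. a j \<noteq> 0} - {i}. x j))"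

lemma relpoly_hfun: "relpoly a \<in> hfun UNIV (card {i. a i \<noteq> 0} - 1)"
  unfolding relpoly_def[abs_def]
proof (intro hfun_sum hfun_cmult)
  fix i assume "i \<in> {i. a i \<noteq> 0}"
  moreover have "(\<lambda>x. \<Prod>j\<in>{j. a j \<noteq> 0} - {i}. x j) \<in> hfun UNIV (\<Sum>j\<in>{j. a j \<noteq> 0} - {i}. 1)"
    by (intro hfun_prod hfun_var) simp
  ultimately show "(\<lambda>x. \<Prod>j\<in>{j. a j \<noteq> 0} - {i}. x j) \<in> hfun UNIV (card {i. a i \<noteq> 0} - 1)" by simp
qed

lemma relpoly_nonzero:
  assumes "\<And>j. a j \<noteq> 0 \<Longrightarrow> x j \<noteq> 0"
  shows "relpoly a x = (\<Prod>j | a j \<noteq> 0. x j) * (\<Sum>i\<in>UNIV. a i * inverse (x i))"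
proof -
  let ?S = "{i. a i \<noteq> 0}"
  have "(\<Prod>j\<in>?S. x j) * (a i * inverse (x i)) = a i * (\<Prod>j\<in>?S - {i}. x j)" if "i \<in> ?S" for i
    using assms[of i] that by (simp add: prod.remove[OF _ that])
  then have "relpoly a x = (\<Sum>i\<in>?S. (\<Prod>j\<in>?S. x j) * (a i * inverse (x i)))"
    unfolding relpoly_def by (intro sum.cong) simp_all
  also have "\<dots> = (\<Prod>j\<in>?S. x j) * (\<Sum>i\<in>?S. a i * inverse (x i))"
    by (simp add: sum_distrib_left)
  also have "(\<Sum>i\<in>?S. a i * inverse (x i)) = (\<Sum>i\<in>UNIV. a i * inverse (x i))"
    by (rule sum.mono_neutral_left) auto
  finally show ?thesis .
qed

lemma relpoly_recip:
  assumes "relation A a" "w \<in> recip_power 1 (proj_row_span A)"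
  shows "relpoly a (($) w) = 0"
proof (rule zariski_closureD[OF assms(2)[unfolded recip_power_def] relpoly_hfun])
  fix y assume "y \<in> {\<chi> i. inverse (x $ i ^ 1) |x. x \<in> proj_row_span A \<and> (\<forall>i. x $ i \<noteq> 0)}"
  then obtain x where x: "x \<in> row_space A" "\<forall>i. x $ i \<noteq> 0" "y = (\<chi> i. inverse (x $ i))"
    by (auto simp: proj_row_span_def row_space_def)
  have "relpoly a (($) y) = (\<Prod>j | a j \<noteq> 0. y $ j) * (\<Sum>i\<in>UNIV. a i * inverse (y $ i))"
    by (rule relpoly_nonzero) (use x in simp)
  then show "relpoly a (($) y) = 0" using row_space_relation[OF x(1) assms(1)] by (simp add: x(3))
qed

text \<open>Both assertions come from the equations \<open>relpoly a\<close>. On a relation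
  supported on \<open>G\<close> the denominators can be restored. If column \<open>e\<close> off
  \<open>G\<close> depended on \<open>G\<close>, the relation expressing this would give an equation
  with a single nonzero term.\<close>

lemma recip_power_stratum:
  fixes A :: "complex ^ 'n ^ 'm"
  assumes w: "w \<in> recip_power 1 (proj_row_span A)"
  defines "G \<equiv> {i. w $ i \<noteq> 0}"
  shows "is_flat A G" "G \<noteq> {}" "w \<in> stratum A G"
proof -
  have "w \<noteq> 0" using w zariski_closure_nonzero unfolding recip_power_def by blast
  then show "G \<noteq> {}" by (auto simp: G_def vec_eq_iff)
  show "is_flat A G"
    unfolding is_flat_def
  proof (intro allI impI notI)
    fix e assume e: "e \<notin> G" "column e A \<in> col_span A G"
    then obtain k where k: "\<And>i. i \<notin> G \<Longrightarrow> k i = 0" "\<And>r. column e A $ r = (\<Sum>i\<in>UNIV. A $ r $ i * k i)"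
      using col_span_combination by blast
    define a where "a i = k i - (if i = e then 1 else 0)" for i
    let ?S = "{i. a i \<noteq> 0}"
    have "relation A a"
      using k(2) unfolding relation_def a_def
      by (simp add: right_diff_distrib sum_subtractf column_def if_distrib[of "\<lambda>x. _ * x"] cong: if_cong)
    then have 0: "relpoly a (($) w) = 0" using w by (rule relpoly_recip)
    have ae: "a e = - 1" "e \<in> ?S" using k(1)[OF e(1)] by (auto simp: a_def)
    have "w $ e = 0" using e by (simp add: G_def)
    \<comment> \<open>Every summand except that of \<open>e\<close> contains the factor
      \<open>w $ e = 0\<close>.\<close>
    have "relpoly a (($) w) = a e * (\<Prod>j\<in>?S - {e}. w $ j) + (\<Sum>i\<in>?S - {e}. a i * (\<Prod>j\<in>?S - {i}. w $ j))"
      unfolding relpoly_def by (rule sum.remove) (use ae in auto)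
    also have "(\<Sum>i\<in>?S - {e}. a i * (\<Prod>j\<in>?S - {i}. w $ j)) = 0"
    proof (rule sum.neutral, rule ballI)
      fix i assume "i \<in> ?S - {e}"
      then have "(\<Prod>j\<in>?S - {i}. w $ j) = 0"
        using ae \<open>w $ e = 0\<close> by (intro prod_zero) auto
      then show "a i * (\<Prod>j\<in>?S - {i}. w $ j) = 0" by simp
    qed
    finally have "(\<Prod>j\<in>?S - {e}. w $ j) = 0" using 0 ae by simp
    then obtain j where "j \<in> ?S - {e}" "w $ j = 0" by auto
    then have "k j \<noteq> 0" "j \<notin> G" by (auto simp: a_def G_def split: if_splits)
    then show False using k(1) by blast
  qed
  have "\<exists>y\<in>row_space A. \<forall>i\<in>G. y $ i = inverse (w $ i)"
  proof (rule row_space_extend)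
    fix a assume a: "relation A a" "\<And>i. i \<notin> G \<Longrightarrow> a i = 0"
    have nz: "w $ j \<noteq> 0" if "a j \<noteq> 0" for j using a(2)[of j] that by (auto simp: G_def)
    have "relpoly a (($) w) = (\<Prod>j | a j \<noteq> 0. w $ j) * (\<Sum>i\<in>UNIV. a i * inverse (w $ i))"
      by (rule relpoly_nonzero) (rule nz)
    moreover have "(\<Prod>j | a j \<noteq> 0. w $ j) \<noteq> 0" using nz by simp
    ultimately show "(\<Sum>i\<in>UNIV. a i * inverse (w $ i)) = 0" using relpoly_recip[OF a(1) w] by simp
  qed
  then show "w \<in> stratum A G" by (simp add: stratum_def G_def)
qed

text \<open>The support \<open>G\<close> of \<open>w\<close> is a flat inside \<open>F\<close>.
  Cutting the vectors that approximate \<open>w\<close> down to \<open>F\<close> gives points of the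
  stratum of \<open>F\<close> that still converge to \<open>w\<close>.\<close>

lemma recip_section_dense:
  assumes w: "w \<in> recip_section A F" and f: "f \<in> pfun" and 0: "\<And>w'. w' \<in> stratum A F \<Longrightarrow> f (($) w') = 0"
  shows "f (($) w) = 0"
proof -
  define G where "G = {i. w $ i \<noteq> 0}"
  have "w \<in> recip_power 1 (proj_row_span A)" using w by (simp add: recip_section_def)
  note G = recip_power_stratum[OF this, folded G_def]
  have GF: "G \<subseteq> F" using w by (auto simp: recip_section_def coord_space_def G_def)
  obtain Y where Y: "\<And>n. Y n \<in> row_space A" "\<And>n i. Y n $ i \<noteq> 0"
    "\<And>i. (\<lambda>n. inverse (Y n $ i)) \<longlonglongrightarrow> w $ i" using stratum_limit[OF G(1,3)] by blast
  have "f (\<lambda>i. if i \<in> F then inverse (Y n $ i) else 0) = 0" for n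
  proof -
    have "f (($) (\<chi> i. if i \<in> F then inverse (Y n $ i) else 0)) = 0"
      by (intro 0 stratumI Y)
    moreover have "($) (\<chi> i. if i \<in> F then inverse (Y n $ i) else 0) = (\<lambda>i. if i \<in> F then inverse (Y n $ i) else 0)"
      by (simp add: fun_eq_iff)
    ultimately show ?thesis by simp
  qed
  moreover have "(\<lambda>n. f (\<lambda>i. if i \<in> F then inverse (Y n $ i) else 0)) \<longlonglongrightarrow> f (($) w)"
  proof (rule pfun_tendsto[OF f])
    fix i show "(\<lambda>n. if i \<in> F then inverse (Y n $ i) else 0) \<longlonglongrightarrow> w $ i"
    proof (cases "i \<in> F")
      case False
      then have "w $ i = 0" using GF by (auto simp: G_def)
      then show ?thesis using False by simp
    qed (use Y(3)[of i] in simp)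
  qed
  ultimately show ?thesis by (simp add: LIMSEQ_const_iff)
qed

lemma proj_closed_recip_section: "proj_closed (recip_section A F)"
proof -
  have "proj_closed (coord_space F)"
  proof (rule proj_closedI)
    fix x assume x: "x \<in> zariski_closure (coord_space F)"
    have "x $ i = 0" if "i \<notin> F" for i
      using zariski_closureD[OF x hfun_var[of i UNIV]] that by (simp add: coord_space_def)
    then show "x \<in> coord_space F" using zariski_closure_nonzero[OF x] by (simp add: coord_space_def)
  qed (simp add: coord_space_def)
  then show ?thesis
    unfolding recip_section_def recip_power_def by (intro proj_closed_Int proj_closed_zariski_closure)
qed

section \<open>Tangent spaces\<close>

lemma peval_derivative:
  fixes p :: "'n::finite mpoly"
  assumes g: "\<And>i. (g i has_field_derivative g' i) (at s)"
  shows "((\<lambda>s. peval p (\<lambda>i. g i s)) has_field_derivative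
    (\<Sum>i\<in>UNIV. peval (partial i p) (\<lambda>i. g i s) * g' i)) (at s)"
proof -
  let ?l = Poly_Mapping.lookup and ?K = "Poly_Mapping.keys p"
  have ev: "peval p x = (\<Sum>m\<in>?K. ?l p m * (\<Prod>v\<in>UNIV. x v ^ ?l m v))" for x
    by (simp add: peval_sum_superset[of ?K] monomial_prod_superset[of UNIV])
  have evp: "peval (partial i p) x * y =
      (\<Sum>m\<in>?K. ?l p m * ((of_nat (?l m i) * x i ^ (?l m i - 1) * y) * (\<Prod>v\<in>UNIV - {i}. x v ^ ?l m v)))" for i x y
  proof -
    have "peval (Poly_Mapping.single (m - Poly_Mapping.single i 1) (of_nat (?l m i) * ?l p m)) x =
        ?l p m * ((of_nat (?l m i) * x i ^ (?l m i - 1)) * (\<Prod>v\<in>UNIV - {i}. x v ^ ?l m v))" for m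
    proof -
      have "(\<Prod>v\<in>Poly_Mapping.keys (m - Poly_Mapping.single i 1). x v ^ ?l (m - Poly_Mapping.single i 1) v) =
          (\<Prod>v\<in>UNIV. x v ^ ?l (m - Poly_Mapping.single i 1) v)"
        by (rule monomial_prod_superset) auto
      also have "\<dots> = x i ^ (?l m i - 1) * (\<Prod>v\<in>UNIV - {i}. x v ^ ?l (m - Poly_Mapping.single i 1) v)"
        by (subst prod.remove[of UNIV i]) (simp_all add: lookup_minus)
      also have "(\<Prod>v\<in>UNIV - {i}. x v ^ ?l (m - Poly_Mapping.single i 1) v) = (\<Prod>v\<in>UNIV - {i}. x v ^ ?l m v)"
        by (rule prod.cong) (auto simp: lookup_minus lookup_single)
      finally show ?thesis by (simp add: peval_single)
    qed
    note single = this
    show ?thesis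
      unfolding partial_def peval_sum single sum_distrib_right
      by (rule sum.cong) (simp_all add: mult.assoc mult.commute mult.left_commute)
  qed
  have "((\<lambda>s. \<Prod>v\<in>UNIV. g v s ^ ?l m v) has_field_derivative
      (\<Sum>i\<in>UNIV. (of_nat (?l m i) * g i s ^ (?l m i - 1) * g' i) * (\<Prod>v\<in>UNIV - {i}. g v s ^ ?l m v))) (at s)" for m
  proof -
    have "((\<lambda>s. g v s ^ ?l m v) has_derivative (*) (of_nat (?l m v) * g v s ^ (?l m v - 1) * g' v)) (at s)" for v
      using DERIV_power[OF g[of v], of "?l m v"]
      by (simp add: has_field_derivative_def mult.assoc mult.commute mult.left_commute)
    then have "((\<lambda>s. \<Prod>v\<in>UNIV. g v s ^ ?l m v) has_derivative
      (\<lambda>y. \<Sum>i\<in>UNIV. (of_nat (?l m i) * g i s ^ (?l m i - 1) * g' i) * y * (\<Prod>v\<in>UNIV - {i}. g v s ^ ?l m v))) (at s)"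
      by (rule has_derivative_prod)
    then show ?thesis
      unfolding has_field_derivative_def
      by (rule has_derivative_eq_rhs, intro ext, unfold sum_distrib_right, intro sum.cong refl)
        (simp add: mult.assoc mult.commute mult.left_commute)
  qed
  then have "((\<lambda>s. \<Sum>m\<in>?K. ?l p m * (\<Prod>v\<in>UNIV. g v s ^ ?l m v)) has_field_derivative
      (\<Sum>m\<in>?K. ?l p m * (\<Sum>i\<in>UNIV. (of_nat (?l m i) * g i s ^ (?l m i - 1) * g' i) * (\<Prod>v\<in>UNIV - {i}. g v s ^ ?l m v)))) (at s)"
    by (intro DERIV_sum DERIV_cmult)
  moreover have "(\<Sum>m\<in>?K. ?l p m * (\<Sum>i\<in>UNIV. (of_nat (?l m i) * g i s ^ (?l m i - 1) * g' i) * (\<Prod>v\<in>UNIV - {i}. g v s ^ ?l m v)))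
      = (\<Sum>i\<in>UNIV. peval (partial i p) (\<lambda>i. g i s) * g' i)"
    unfolding evp sum_distrib_left by (rule sum.swap)
  ultimately show ?thesis unfolding ev by simp
qed

text \<open>The reciprocals of the line \<open>y - s v\<close> form a curve through \<open>w\<close>
  with velocity \<open>w\<^sup>2 v\<close>. It stays in the stratum of the support \<open>G\<close>
  of \<open>w\<close>, so the inclusion holds at every point of the section, also when
  \<open>G\<close> is smaller than \<open>F\<close>.\<close>

lemma tangent_space_superset:
  assumes w: "w \<in> recip_section A F" and v: "v \<in> row_space A"
  shows "(\<chi> i. w $ i ^ 2 * v $ i) \<in> tangent_space (recip_section A F) w"
  unfolding tangent_space_def
proof (intro CollectI ballI)
  fix p assume "p \<in> proj_ideal (recip_section A F)"
  then have p: "peval p (($) x) = 0" if "x \<in> recip_section A F" for x using that by (auto simp: proj_ideal_def)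
  define G where "G = {i. w $ i \<noteq> 0}"
  have "w \<in> recip_power 1 (proj_row_span A)" using w by (simp add: recip_section_def)
  note G = recip_power_stratum[OF this, folded G_def]
  have GF: "G \<subseteq> F" using w by (auto simp: recip_section_def coord_space_def G_def)
  obtain y where y: "y \<in> row_space A" "\<And>i. i \<in> G \<Longrightarrow> y $ i = inverse (w $ i)"
    using G(3) by (auto simp: stratum_def)
  define g where "g i s = (if i \<in> G then inverse (y $ i + (- s) * v $ i) else 0)" for i s
  have g0: "g i 0 = w $ i" for i using y(2)[of i] by (auto simp: g_def G_def)
  have "(g i has_field_derivative (w $ i ^ 2 * v $ i)) (at 0)" for i
  proof (cases "i \<in> G")
    case True
    then have nz: "y $ i \<noteq> 0" "y $ i = inverse (w $ i)" using y by (auto simp: G_def)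
    have "((\<lambda>s. inverse (y $ i + (- s) * v $ i)) has_field_derivative (w $ i ^ 2 * v $ i)) (at 0)"
      by (rule derivative_eq_intros refl | use nz in \<open>simp add: power2_eq_square\<close>)+
    then show ?thesis using True by (simp add: g_def[abs_def])
  next
    case False
    then show ?thesis by (simp add: g_def[abs_def] G_def)
  qed
  then have D: "((\<lambda>s. peval p (\<lambda>i. g i s)) has_field_derivative
      (\<Sum>i\<in>UNIV. peval (partial i p) (\<lambda>i. g i 0) * (w $ i ^ 2 * v $ i))) (at 0)"
    by (rule peval_derivative)
  have "\<forall>\<^sub>F s in at 0. \<forall>i\<in>G. y $ i + (- s) * v $ i \<noteq> 0"
  proof (rule eventually_ball_finite[OF finite], rule ballI)
    fix i assume "i \<in> G"
    then have "y $ i \<noteq> 0" using y by (auto simp: G_def)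
    moreover have "((\<lambda>s. y $ i + (- s) * v $ i) \<longlongrightarrow> y $ i + (- 0) * v $ i) (at 0)" by (intro tendsto_intros)
    ultimately show "\<forall>\<^sub>F s in at 0. y $ i + (- s) * v $ i \<noteq> 0"
      by (intro tendsto_imp_eventually_ne[where c = "y $ i"]) simp_all
  qed
  then have "\<forall>\<^sub>F s in nhds 0. \<forall>i\<in>G. y $ i + (- s) * v $ i \<noteq> 0"
    using y by (simp add: eventually_nhds_conv_at) (auto simp: G_def)
  then have "\<forall>\<^sub>F s in nhds 0. peval p (\<lambda>i. g i s) = 0"
  proof eventually_elim
    case (elim s)
    have "(\<chi> i. if i \<in> G then inverse ((y + (- s) *s v) $ i) else 0) \<in> stratum A G"
      using elim by (intro stratumI row_space_add row_space_scale y v) simp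
    then have "(\<chi> i. if i \<in> G then inverse ((y + (- s) *s v) $ i) else 0) \<in> recip_section A F"
      using stratum_subset_recip_section[OF G(1,2) GF] by blast
    moreover have "($) (\<chi> i. if i \<in> G then inverse ((y + (- s) *s v) $ i) else 0) = (\<lambda>i. g i s)"
      by (simp add: fun_eq_iff g_def)
    ultimately show ?case using p by metis
  qed
  then have "((\<lambda>s. 0) has_field_derivative
      (\<Sum>i\<in>UNIV. peval (partial i p) (\<lambda>i. g i 0) * (w $ i ^ 2 * v $ i))) (at 0)"
    using D by (subst (asm) DERIV_cong_ev[OF refl _ refl])
  then show "(\<Sum>i\<in>UNIV. peval (partial i p) (($) w) * (\<chi> i. w $ i ^ 2 * v $ i) $ i) = 0"
    using DERIV_unique[OF _ DERIV_const] by (simp add: g0)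
qed

lemma tangent_space_derivative:
  fixes f :: "('n::finite \<Rightarrow> complex) \<Rightarrow> complex"
  assumes "f \<in> hfun UNIV k" "\<And>x. x \<in> X \<Longrightarrow> f (($) x) = 0" "t \<in> tangent_space X w"
  shows "((\<lambda>s. f (\<lambda>i. w $ i + s * t $ i)) has_field_derivative 0) (at 0)"
proof -
  obtain p where p: "hom_degree k p" "\<And>x. peval p x = f x" using hfun_imp_hom[OF assms(1)] by blast
  have "p \<in> proj_ideal X" using p assms(2) by (auto simp: proj_ideal_def homogeneous_iff_hom_degree)
  then have 0: "(\<Sum>i\<in>UNIV. peval (partial i p) (($) w) * t $ i) = 0" using assms(3) by (auto simp: tangent_space_def)
  have "((\<lambda>s. w $ i + s * t $ i) has_field_derivative t $ i) (at 0)" for i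
    by (rule derivative_eq_intros refl | simp)+
  then have "((\<lambda>s. peval p (\<lambda>i. w $ i + s * t $ i)) has_field_derivative
    (\<Sum>i\<in>UNIV. peval (partial i p) (\<lambda>i. w $ i + 0 * t $ i) * t $ i)) (at 0)"
    by (rule peval_derivative)
  then show ?thesis using 0 by (simp add: p(2))
qed

lemma pfun_has_derivative:
  assumes "f \<in> pfun"
  shows "\<exists>D. ((\<lambda>s. f (\<lambda>i. w $ i + s * t $ i)) has_field_derivative D) (at 0)"
proof -
  obtain p where p: "\<And>x. peval p x = f x" using pfun_imp_peval[OF assms] by blast
  have "((\<lambda>s. w $ i + s * t $ i) has_field_derivative t $ i) (at 0)" for i
    by (rule derivative_eq_intros refl | simp)+
  from peval_derivative[where g = "\<lambda>i s. w $ i + s * t $ i", OF this, of p]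
  show ?thesis unfolding p by (rule exI)
qed

text \<open>Off \<open>F\<close> the coordinates themselves are equations. On \<open>F\<close>, each
  \<open>relpoly a\<close> factors near \<open>w\<close> as \<open>P\<close> times the sum of the
  \<open>a i / x i\<close>; this sum vanishes at \<open>w\<close> and \<open>P\<close> does not, so
  the derivative of the sum vanishes. Hence \<open>t / w\<^sup>2\<close> satisfies all relations on
  \<open>F\<close> and extends to the row space.\<close>

lemma tangent_space_subset:
  assumes w: "w \<in> stratum A F" and t: "t \<in> tangent_space (recip_section A F) w"
  shows "\<exists>v\<in>row_space A. t = (\<chi> i. w $ i ^ 2 * v $ i)"
proof -
  have wF: "w $ i = 0 \<longleftrightarrow> i \<notin> F" for i using w by (auto simp: stratum_def)
  have t0: "t $ i = 0" if "i \<notin> F" for i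
  proof -
    have "((\<lambda>s. w $ i + s * t $ i) has_field_derivative 0) (at 0)"
      by (rule tangent_space_derivative[OF hfun_var[of i UNIV] _ t])
        (use that in \<open>auto simp: recip_section_def coord_space_def\<close>)
    moreover have "((\<lambda>s. w $ i + s * t $ i) has_field_derivative t $ i) (at 0)"
      by (rule derivative_eq_intros refl | simp)+
    ultimately show ?thesis using DERIV_unique by blast
  qed
  have "\<exists>v\<in>row_space A. \<forall>i\<in>F. v $ i = t $ i / w $ i ^ 2"
  proof (rule row_space_extend)
    fix a assume a: "relation A a" "\<And>i. i \<notin> F \<Longrightarrow> a i = 0"
    let ?S = "{i. a i \<noteq> 0}"
    have SF: "?S \<subseteq> F" using a(2) by blast
    define P where "P x = (\<Prod>j\<in>?S. x j)" for x :: "'a \<Rightarrow> complex"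
    let ?x = "\<lambda>s i. w $ i + s * t $ i"
    let ?Q = "\<lambda>s. \<Sum>i\<in>?S. a i * inverse (?x s i)"
    have "P \<in> pfun" unfolding P_def[abs_def] by (intro pfun_prod pfun_var)
    then obtain P' where P': "((\<lambda>s. P (?x s)) has_field_derivative P') (at 0)"
      using pfun_has_derivative by blast
    have Q': "(?Q has_field_derivative (\<Sum>i\<in>?S. a i * - (t $ i / w $ i ^ 2))) (at 0)"
    proof (intro DERIV_sum DERIV_cmult)
      fix i assume "i \<in> ?S"
      then have "w $ i \<noteq> 0" using SF wF by blast
      then show "((\<lambda>s. inverse (?x s i)) has_field_derivative - (t $ i / w $ i ^ 2)) (at 0)"
        by (auto intro!: derivative_eq_intros simp: power2_eq_square field_simps)
    qed
    have "\<forall>\<^sub>F s in at 0. \<forall>i\<in>?S. ?x s i \<noteq> 0"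
    proof (rule eventually_ball_finite[OF finite], rule ballI)
      fix i assume "i \<in> ?S"
      then have "w $ i \<noteq> 0" using SF wF by blast
      moreover have "((\<lambda>s. ?x s i) \<longlongrightarrow> ?x 0 i) (at 0)" by (intro tendsto_intros)
      ultimately show "\<forall>\<^sub>F s in at 0. ?x s i \<noteq> 0"
        by (intro tendsto_imp_eventually_ne[where c = "w $ i"]) simp_all
    qed
    then have ev: "\<forall>\<^sub>F s in nhds 0. \<forall>i\<in>?S. ?x s i \<noteq> 0"
      using SF wF by (auto simp: eventually_nhds_conv_at)
    have "\<forall>\<^sub>F s in nhds 0. relpoly a (?x s) = P (?x s) * ?Q s"
      using ev
    proof eventually_elim
      case (elim s)
      have "relpoly a (?x s) = (\<Prod>j\<in>?S. ?x s j) * (\<Sum>i\<in>UNIV. a i * inverse (?x s i))"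
        by (rule relpoly_nonzero) (use elim in auto)
      also have "(\<Sum>i\<in>UNIV. a i * inverse (?x s i)) = ?Q s"
        by (rule sum.mono_neutral_right) auto
      finally show ?case by (simp add: P_def)
    qed
    moreover have "((\<lambda>s. relpoly a (?x s)) has_field_derivative 0) (at 0)"
      by (rule tangent_space_derivative[OF relpoly_hfun _ t]) (auto simp: recip_section_def relpoly_recip[OF a(1)])
    ultimately have "((\<lambda>s. P (?x s) * ?Q s) has_field_derivative 0) (at 0)"
      by (subst (asm) DERIV_cong_ev[OF refl _ refl])
    moreover have "((\<lambda>s. P (?x s) * ?Q s) has_field_derivative
        (P' * ?Q 0 + (\<Sum>i\<in>?S. a i * - (t $ i / w $ i ^ 2)) * P (?x 0))) (at 0)"
      by (rule DERIV_mult[OF P' Q'])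
    ultimately have 0: "P' * ?Q 0 + (\<Sum>i\<in>?S. a i * - (t $ i / w $ i ^ 2)) * P (?x 0) = 0"
      using DERIV_unique by blast
    have "?Q 0 = 0"
    proof -
      obtain y where y: "y \<in> row_space A" "\<forall>i\<in>F. y $ i = inverse (w $ i)" using w by (auto simp: stratum_def)
      have "?Q 0 = (\<Sum>i\<in>?S. a i * y $ i)" by (rule sum.cong) (use y SF in auto)
      also have "\<dots> = (\<Sum>i\<in>UNIV. a i * y $ i)" by (rule sum.mono_neutral_left) auto
      finally show ?thesis using row_space_relation[OF y(1) a(1)] by simp
    qed
    moreover have "P (?x 0) \<noteq> 0" using SF wF by (auto simp: P_def)
    ultimately have "(\<Sum>i\<in>?S. a i * - (t $ i / w $ i ^ 2)) = 0" using 0 by simp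
    then have "(\<Sum>i\<in>?S. a i * (t $ i / w $ i ^ 2)) = 0" by (simp add: sum_negf)
    moreover have "(\<Sum>i\<in>?S. a i * (t $ i / w $ i ^ 2)) = (\<Sum>i\<in>UNIV. a i * (t $ i / w $ i ^ 2))"
      by (rule sum.mono_neutral_left) auto
    ultimately show "(\<Sum>i\<in>UNIV. a i * (t $ i / w $ i ^ 2)) = 0" by simp
  qed
  then obtain v where v: "v \<in> row_space A" "\<forall>i\<in>F. v $ i = t $ i / w $ i ^ 2" by blast
  have "t = (\<chi> i. w $ i ^ 2 * v $ i)"
  proof (subst vec_eq_iff, rule allI)
    fix i show "t $ i = (\<chi> i. w $ i ^ 2 * v $ i) $ i"
      using v(2) t0[of i] wF[of i] by (cases "i \<in> F") simp_all
  qed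
  then show ?thesis using v by blast
qed

text \<open>Multiplication by \<open>w\<^sup>2\<close> discards exactly the coordinates off
  \<open>F\<close>, and on \<open>F\<close> a row-space vector is determined by its arbitrary values
  on a basis \<open>B\<close>. The vectors \<open>y b\<close> dual to \<open>B\<close> map to a
  basis.\<close>

lemma dim_tangent:
  fixes A :: "complex ^ 'n ^ 'm"
  assumes w: "w \<in> stratum A F"
  shows "vec.dim {\<chi> i. w $ i ^ 2 * v $ i | v. v \<in> row_space A} = matroid_rank A F"
proof -
  have wF: "w $ i = 0 \<longleftrightarrow> i \<notin> F" for i using w by (auto simp: stratum_def)
  obtain B where B: "B \<subseteq> F" "matroid_indep A B" "card B = matroid_rank A F"
    and "\<forall>i\<in>F. column i A \<in> col_span A B"
    using matroid_basis[of F A] by (elim exE conjE)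
  then have B4: "\<And>i. i \<in> F \<Longrightarrow> column i A \<in> col_span A B" by (elim bspec)
  have "\<forall>b. \<exists>y\<in>row_space A. \<forall>b'\<in>B. y $ b' = (if b' = b then 1 else 0)"
    by (intro allI row_space_extend_indep[OF B(2)])
  then obtain y where y: "\<And>b. y b \<in> row_space A" "\<And>b b'. b' \<in> B \<Longrightarrow> y b $ b' = (if b' = b then 1 else 0)" by metis
  obtain c where c: "\<And>v i. v \<in> row_space A \<Longrightarrow> i \<in> F \<Longrightarrow> v $ i = (\<Sum>b\<in>B. c i b * v $ b)"
    using row_space_coordinates[of F A B, OF B4] by metis
  have cy: "y b $ i = c i b" if "b \<in> B" "i \<in> F" for b i
  proof -
    have "y b $ i = (\<Sum>b'\<in>B. c i b' * y b $ b')" by (rule c[OF y(1) that(2)])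
    also have "\<dots> = (\<Sum>b'\<in>B. if b' = b then c i b else 0)" by (rule sum.cong) (use y in auto)
    finally show ?thesis using that by simp
  qed
  define T where "T v = (\<chi> i. w $ i ^ 2 * v $ i)" for v :: "complex ^ 'n"
  let ?W = "{\<chi> i. w $ i ^ 2 * v $ i | v. v \<in> row_space A}"
  have coord: "T (y b) $ b' = (if b' = b then w $ b' ^ 2 else 0)" if "b' \<in> B" for b b'
    using y(2)[OF that] by (simp add: T_def)
  have wB: "w $ b \<noteq> 0" if "b \<in> B" for b using wF B that by blast
  have inj: "inj_on (\<lambda>b. T (y b)) B"
  proof (rule inj_onI)
    fix b b' assume *: "b \<in> B" "b' \<in> B" "T (y b) = T (y b')"
    then have "T (y b) $ b = T (y b') $ b" by simp
    then show "b = b'" using coord[of b b] coord[of b b'] wB[of b] *(1,2) by (auto split: if_splits)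
  qed
  have "vec.dim ?W = card ((\<lambda>b. T (y b)) ` B)"
  proof (rule vec.dim_unique[OF _ _ _ refl])
    show "(\<lambda>b. T (y b)) ` B \<subseteq> ?W" using y(1) by (auto simp: T_def)
    show "?W \<subseteq> vec.span ((\<lambda>b. T (y b)) ` B)"
    proof
      fix x assume "x \<in> ?W"
      then obtain v where v: "v \<in> row_space A" "x = T v" by (auto simp: T_def)
      have "T v = (\<Sum>b\<in>B. (v $ b) *s T (y b))"
      proof (subst vec_eq_iff, rule allI)
        fix i show "T v $ i = (\<Sum>b\<in>B. (v $ b) *s T (y b)) $ i"
        proof (cases "i \<in> F")
          case True
          have "(\<Sum>b\<in>B. (v $ b) *s T (y b)) $ i = (\<Sum>b\<in>B. w $ i ^ 2 * (c i b * v $ b))"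
            by (simp add: T_def, rule sum.cong) (simp_all add: cy True)
          then show ?thesis using c[OF v(1) True] by (simp add: T_def sum_distrib_left)
        next
          case False
          then have "w $ i = 0" using wF by blast
          then show ?thesis by (simp add: T_def)
        qed
      qed
      also have "\<dots> \<in> vec.span ((\<lambda>b. T (y b)) ` B)" by (intro vec.span_sum vec.span_scale vec.span_base) auto
      finally show "x \<in> vec.span ((\<lambda>b. T (y b)) ` B)" using v by simp
    qed
    show "vec.independent ((\<lambda>b. T (y b)) ` B)"
    proof
      assume "vec.dependent ((\<lambda>b. T (y b)) ` B)"
      then obtain u where u: "\<exists>x\<in>(\<lambda>b. T (y b)) ` B. u x \<noteq> 0" "(\<Sum>x\<in>(\<lambda>b. T (y b)) ` B. u x *s x) = 0"
        using vec.dependent_finite[of "(\<lambda>b. T (y b)) ` B"] by auto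
      have "(\<Sum>b\<in>B. u (T (y b)) *s T (y b)) = 0" using u(2) inj by (simp add: sum.reindex)
      then have 0: "(\<Sum>b\<in>B. u (T (y b)) *s T (y b)) $ b' = 0" for b' by simp
      have "u (T (y b')) = 0" if "b' \<in> B" for b'
      proof -
        have "(\<Sum>b\<in>B. u (T (y b)) *s T (y b)) $ b' = (\<Sum>b\<in>B. if b = b' then u (T (y b)) * w $ b' ^ 2 else 0)"
          unfolding sum_component by (rule sum.cong) (use coord[OF that] in auto)
        then have "u (T (y b')) * w $ b' ^ 2 = 0" using 0[of b'] that by simp
        then show ?thesis using wB[OF that] by simp
      qed
      then show False using u(1) by blast
    qed
  qed
  then show ?thesis using inj B by (simp add: card_image)
qed

section \<open>Irreducibility and dimension of the strata\<close>

text \<open>Multiplying by the product of the \<open>y j\<close> turns the reciprocals into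
  polynomials, at the cost of a scalar that homogeneous functions do not notice.\<close>

lemma prod_cofactor:
  fixes y :: "'n::finite \<Rightarrow> complex"
  assumes "\<And>i. i \<in> F \<Longrightarrow> y i \<noteq> 0"
  shows "(if i \<in> F then \<Prod>j\<in>F - {i}. y j else 0) = (\<Prod>j\<in>F. y j) * (if i \<in> F then inverse (y i) else 0)"
  using assms[of i] by (simp add: prod.remove[of F i])

lemma stratum_coordinates:
  assumes "w \<in> stratum A F" "y \<in> row_space A" "\<And>i. i \<in> F \<Longrightarrow> y $ i = inverse (w $ i)"
  shows "(if i \<in> F then \<Prod>j\<in>F - {i}. y $ j else 0) = (\<Prod>j\<in>F. y $ j) * w $ i"
proof -
  have "y $ j \<noteq> 0" if "j \<in> F" for j using assms that by (auto simp: stratum_def)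
  then have "(if i \<in> F then \<Prod>j\<in>F - {i}. y $ j else 0) = (\<Prod>j\<in>F. y $ j) * (if i \<in> F then inverse (y $ i) else 0)"
    by (rule prod_cofactor)
  moreover have "(if i \<in> F then inverse (y $ i) else 0) = w $ i" using assms by (auto simp: stratum_def)
  ultimately show ?thesis by simp
qed

text \<open>
  Two points of the stratum are joined by the image of a line in the row space, so that the product
  of two homogeneous functions that do not vanish on the stratum does not vanish on it.
\<close>

lemma proj_irreducible_recip_section:
  fixes A :: "complex ^ 'n ^ 'm"
  assumes loopless: "is_flat A {}" and F: "is_flat A F" "F \<noteq> {}"
  shows "proj_irreducible (recip_section A F)"
  unfolding proj_irreducible_def
proof (intro conjI allI impI)
  let ?X = "recip_section A F"
  show "proj_closed ?X" by (rule proj_closed_recip_section)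
  show "?X \<noteq> {}" using stratum_nonempty[OF loopless] stratum_subset_recip_section[OF F order_refl] by blast
  fix Y1 Y2 assume Y: "proj_closed Y1 \<and> proj_closed Y2 \<and> ?X = Y1 \<union> Y2"
  show "?X = Y1 \<or> ?X = Y2"
  proof (rule ccontr)
    assume neg: "\<not> (?X = Y1 \<or> ?X = Y2)"
    \<comment> \<open>By density, a form that vanishes on \<open>Z\<close> but not on the whole
      section is nonzero somewhere on the stratum.\<close>
    have sep: "\<exists>k f w. f \<in> hfun UNIV k \<and> (\<forall>y\<in>Z. f (($) y) = 0) \<and> w \<in> stratum A F \<and> f (($) w) \<noteq> 0"
      if "proj_closed Z" "Z \<subseteq> ?X" "Z \<noteq> ?X" for Z
    proof -
      obtain x where x: "x \<in> ?X" "x \<notin> Z" using \<open>Z \<subseteq> ?X\<close> \<open>Z \<noteq> ?X\<close> by blast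
      have "x \<noteq> 0" using proj_closed_nonzero[OF proj_closed_recip_section x(1)] .
      obtain f k where f: "f \<in> hfun UNIV k" "\<And>y. y \<in> Z \<Longrightarrow> f (($) y) = 0" "f (($) x) \<noteq> 0"
        by (rule proj_closed_separate[OF \<open>proj_closed Z\<close> x(2) \<open>x \<noteq> 0\<close>]) (rule that; assumption)
      have "\<exists>w\<in>stratum A F. f (($) w) \<noteq> 0" using recip_section_dense[OF x(1) hfun_imp_pfun[OF f(1)]] f(3) by (rule_tac ccontr) simp
      then show ?thesis using f(1,2) by blast
    qed
    have "proj_closed Y1" "Y1 \<subseteq> ?X" "Y1 \<noteq> ?X" using Y neg by auto
    from sep[OF this] obtain k1 f1 w1 where f1: "f1 \<in> hfun UNIV k1" "\<forall>y\<in>Y1. f1 (($) y) = 0" "w1 \<in> stratum A F"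
      "f1 (($) w1) \<noteq> 0" by (elim exE conjE)
    have "proj_closed Y2" "Y2 \<subseteq> ?X" "Y2 \<noteq> ?X" using Y neg by auto
    from sep[OF this] obtain k2 f2 w2 where f2: "f2 \<in> hfun UNIV k2" "\<forall>y\<in>Y2. f2 (($) y) = 0" "w2 \<in> stratum A F"
      "f2 (($) w2) \<noteq> 0" by (elim exE conjE)
    obtain y1 where y1: "y1 \<in> row_space A" "\<And>i. i \<in> F \<Longrightarrow> y1 $ i = inverse (w1 $ i)"
      using f1(3) by (auto simp: stratum_def)
    obtain y2 where y2: "y2 \<in> row_space A" "\<And>i. i \<in> F \<Longrightarrow> y2 $ i = inverse (w2 $ i)"
      using f2(3) by (auto simp: stratum_def)
    \<comment> \<open>The line from \<open>y1\<close> to \<open>y2\<close>, and in \<open>S\<close>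
      its reciprocals without denominators, defined also where the line meets a coordinate
      hyperplane.\<close>
    define l where "l i = [:y1 $ i, y2 $ i - y1 $ i:]" for i
    define S where "S i = (if i \<in> F then \<Prod>j\<in>F - {i}. l j else 0)" for i
    have S: "poly (S i) t = (if i \<in> F then \<Prod>j\<in>F - {i}. poly (l j) t else 0)" for i t
      by (simp add: S_def poly_prod)
    obtain p1 where p1: "\<forall>t. f1 (\<lambda>i. poly (S i) t) = poly p1 t"
      using pfun_line[OF hfun_imp_pfun[OF f1(1)], of S] by (elim exE)
    obtain p2 where p2: "\<forall>t. f2 (\<lambda>i. poly (S i) t) = poly p2 t"
      using pfun_line[OF hfun_imp_pfun[OF f2(1)], of S] by (elim exE)
    have l1: "poly (l j) 0 = y1 $ j" and l2: "poly (l j) 1 = y2 $ j" for j by (simp_all add: l_def)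
    have "poly p1 0 \<noteq> 0"
    proof -
      have "poly (S i) 0 = (\<Prod>j\<in>F. y1 $ j) * w1 $ i" for i
        unfolding S l1 by (rule stratum_coordinates[OF f1(3) y1])
      then have "poly p1 0 = f1 (\<lambda>i. (\<Prod>j\<in>F. y1 $ j) * w1 $ i)"
        using p1[rule_format, of 0] by simp
      also have "\<dots> = (\<Prod>j\<in>F. y1 $ j) ^ k1 * f1 (($) w1)" by (rule hfun_scale[OF f1(1)])
      finally show ?thesis using f1(3,4) y1(2) by (auto simp: stratum_def)
    qed
    moreover have "poly p2 1 \<noteq> 0"
    proof -
      have "poly (S i) 1 = (\<Prod>j\<in>F. y2 $ j) * w2 $ i" for i
        unfolding S l2 by (rule stratum_coordinates[OF f2(3) y2])
      then have "poly p2 1 = f2 (\<lambda>i. (\<Prod>j\<in>F. y2 $ j) * w2 $ i)"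
        using p2[rule_format, of 1] by simp
      also have "\<dots> = (\<Prod>j\<in>F. y2 $ j) ^ k2 * f2 (($) w2)" by (rule hfun_scale[OF f2(1)])
      finally show ?thesis using f2(3,4) y2(2) by (auto simp: stratum_def)
    qed
    moreover have "poly (\<Prod>j\<in>F. l j) 0 \<noteq> 0"
      using f1(3) y1(2) by (auto simp: poly_prod l1 stratum_def)
    ultimately have "p1 \<noteq> 0" "p2 \<noteq> 0" "(\<Prod>j\<in>F. l j) \<noteq> 0" by (metis poly_0)+
    then have "p1 * p2 * (\<Prod>j\<in>F. l j) \<noteq> 0" by (metis mult_eq_0_iff)
    \<comment> \<open>The third factor absorbs the parameters at which the line leaves the domain of
      the reciprocals.\<close>
    moreover have "poly (p1 * p2 * (\<Prod>j\<in>F. l j)) t = 0" for t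
    proof (cases "\<forall>j\<in>F. poly (l j) t \<noteq> 0")
      case False
      then have "poly (\<Prod>j\<in>F. l j) t = 0" by (auto simp: poly_prod)
      then show ?thesis by simp
    next
      case True
      define y where "y = y1 + t *s (y2 - y1)"
      have y_l: "y $ j = poly (l j) t" for j by (simp add: y_def l_def algebra_simps)
      have "y2 - y1 = y2 + (- 1) *s y1" by (simp add: vec_eq_iff)
      then have "y2 - y1 \<in> row_space A" using y1(1) y2(1) by (simp only: row_space_add row_space_scale)
      then have y: "y \<in> row_space A" unfolding y_def by (intro row_space_add row_space_scale y1)
      define w where "w = (\<chi> i. if i \<in> F then inverse (y $ i) else 0)"
      have w: "w \<in> stratum A F" unfolding w_def using True y_l by (intro stratumI y) simp
      have wS: "poly (S i) t = (\<Prod>j\<in>F. y $ j) * w $ i" for i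
      proof -
        have "poly (S i) t = (if i \<in> F then \<Prod>j\<in>F - {i}. y $ j else 0)" by (simp add: S y_l)
        also have "\<dots> = (\<Prod>j\<in>F. y $ j) * w $ i"
          by (rule stratum_coordinates[OF w y]) (simp add: w_def)
        finally show ?thesis .
      qed
      have "w \<in> Y1 \<union> Y2" using w stratum_subset_recip_section[OF F order_refl] Y by auto
      then have "f1 (($) w) = 0 \<or> f2 (($) w) = 0" using f1(2) f2(2) by blast
      moreover have "poly p1 t = (\<Prod>j\<in>F. y $ j) ^ k1 * f1 (($) w)"
        using hfun_scale[OF f1(1), of "\<Prod>j\<in>F. y $ j" "($) w"] p1[rule_format, of t] by (simp add: wS)
      moreover have "poly p2 t = (\<Prod>j\<in>F. y $ j) ^ k2 * f2 (($) w)"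
        using hfun_scale[OF f2(1), of "\<Prod>j\<in>F. y $ j" "($) w"] p2[rule_format, of t] by (simp add: wS)
      ultimately show ?thesis by auto
    qed
    ultimately show False using poly_all_0_iff_0 by blast
  qed
qed

text \<open>A lower bound \<open>n\<close> for the Hilbert function of \<open>Z\<close> in degree
  \<open>D\<close>, stated by exhibiting forms that are independent as functions on
  \<open>Z\<close>.\<close>

definition hilbert_ge :: "(complex ^ 'n) set \<Rightarrow> nat \<Rightarrow> nat \<Rightarrow> bool" where
  "hilbert_ge Z D n \<longleftrightarrow> (\<exists>f. (\<forall>s<n. f s \<in> hfun UNIV D) \<and>
     (\<forall>b. (\<forall>x\<in>Z. (\<Sum>s<n. b s * f s (($) x)) = 0) \<longrightarrow> (\<forall>s<n. b s = 0)))"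

lemma hilbert_ge_0: "hilbert_ge Z D 0"
  by (simp add: hilbert_ge_def)

lemma hilbert_ge_1:
  assumes "x \<in> Z" "x \<noteq> 0"
  shows "hilbert_ge Z D 1"
proof -
  obtain i where i: "x $ i \<noteq> 0" using assms(2) by (auto simp: vec_eq_iff)
  have "(\<lambda>x. x i ^ D) \<in> hfun UNIV D" using hfun_power[OF hfun_var, of i UNIV D] by simp
  then show ?thesis unfolding hilbert_ge_def using assms(1) i by (intro exI[of _ "\<lambda>s x. x i ^ D"]) auto
qed

lemma hilbert_ge_mono: "hilbert_ge Z D n \<Longrightarrow> Z \<subseteq> Z' \<Longrightarrow> hilbert_ge Z' D n"
proof -
  assume "hilbert_ge Z D n" and sub: "Z \<subseteq> Z'"
  then obtain f where f: "\<forall>s<n. f s \<in> hfun UNIV D"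
    "\<forall>b. (\<forall>x\<in>Z. (\<Sum>s<n. b s * f s (($) x)) = 0) \<longrightarrow> (\<forall>s<n. b s = 0)"
    unfolding hilbert_ge_def by (elim exE conjE)
  have "\<forall>b. (\<forall>x\<in>Z'. (\<Sum>s<n. b s * f s (($) x)) = 0) \<longrightarrow> (\<forall>s<n. b s = 0)"
  proof (intro allI impI)
    fix b s assume "\<forall>x\<in>Z'. (\<Sum>s<n. b s * f s (($) x)) = 0" "s < n"
    then show "b s = 0" using f(2)[rule_format, of b s] sub by (simp add: subset_iff)
  qed
  with f(1) show ?thesis unfolding hilbert_ge_def by (intro exI[of _ f] conjI)
qed

lemma sum_lessThan_add: "(\<Sum>s<m + n. g s) = (\<Sum>s<m. g s) + (\<Sum>s<n. g (m + s :: nat) :: 'a :: comm_monoid_add)"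
  by (induction n) (simp_all add: add.assoc)

text \<open>The inequality of Hilbert functions \<open>H_Z(D) \<ge> H_Z'(D) + H_Z(D - e)\<close>. In
  a relation between forms independent on \<open>Z'\<close> and multiples of \<open>f\<close>,
  restriction to \<open>Z'\<close> removes the multiples; afterwards \<open>f\<close> can be
  cancelled because \<open>Z\<close> is irreducible.\<close>

lemma hilbert_ge_step:
  assumes Z: "proj_irreducible Z" "Z' \<subseteq> Z"
    and f: "f \<in> hfun UNIV e" "\<And>x. x \<in> Z' \<Longrightarrow> f (($) x) = 0" "x0 \<in> Z" "f (($) x0) \<noteq> 0"
    and D: "e \<le> D" "hilbert_ge Z' D m" "hilbert_ge Z (D - e) n"
  shows "hilbert_ge Z D (m + n)"
proof -
  obtain g where g: "\<forall>s<m. g s \<in> hfun UNIV D"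
    "\<forall>b. (\<forall>x\<in>Z'. (\<Sum>s<m. b s * g s (($) x)) = 0) \<longrightarrow> (\<forall>s<m. b s = 0)"
    using D(2) unfolding hilbert_ge_def by (elim exE conjE)
  obtain h where h: "\<forall>s<n. h s \<in> hfun UNIV (D - e)"
    "\<forall>b. (\<forall>x\<in>Z. (\<Sum>s<n. b s * h s (($) x)) = 0) \<longrightarrow> (\<forall>s<n. b s = 0)"
    using D(3) unfolding hilbert_ge_def by (elim exE conjE)
  define k where "k s = (if s < m then g s else (\<lambda>x. f x * h (s - m) x))" for s
  have "k s \<in> hfun UNIV D" if "s < m + n" for s
  proof (cases "s < m")
    case False
    then have "h (s - m) \<in> hfun UNIV (D - e)" using h(1) that by simp
    then show ?thesis using False hfun_mult[OF f(1), of "h (s - m)" "D - e"] D(1) by (simp add: k_def)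
  qed (use g in \<open>simp add: k_def\<close>)
  moreover have "\<forall>s<m + n. b s = 0" if b: "\<forall>x\<in>Z. (\<Sum>s<m + n. b s * k s (($) x)) = 0" for b
  proof -
    have split: "(\<Sum>s<m. b s * g s (($) x)) + f (($) x) * (\<Sum>s<n. b (m + s) * h s (($) x)) = 0" if "x \<in> Z" for x
    proof -
      have "(\<Sum>s<m. b s * k s (($) x)) = (\<Sum>s<m. b s * g s (($) x))" by (rule sum.cong) (simp_all add: k_def)
      moreover have "(\<Sum>s<n. b (m + s) * k (m + s) (($) x)) = f (($) x) * (\<Sum>s<n. b (m + s) * h s (($) x))"
        by (simp add: k_def sum_distrib_left mult.left_commute)
      ultimately show ?thesis using b[rule_format, OF that] by (simp add: sum_lessThan_add)
    qed
    have "(\<Sum>s<m. b s * g s (($) x)) = 0" if "x \<in> Z'" for x using split[of x] f(2)[OF that] Z(2) that by auto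
    then have b1: "\<forall>s<m. b s = 0" using g(2) by blast
    have "(\<forall>x\<in>Z. f (($) x) = 0) \<or> (\<forall>x\<in>Z. (\<Sum>s<n. b (m + s) * h s (($) x)) = 0)"
    proof (rule proj_irreducible_product[OF Z(1) f(1), where g = "\<lambda>x. \<Sum>s<n. b (m + s) * h s x" and l = "D - e"])
      show "(\<lambda>x. \<Sum>s<n. b (m + s) * h s x) \<in> hfun UNIV (D - e)" using h(1) by (intro hfun_sum hfun_cmult) simp
      show "f (($) x) * (\<Sum>s<n. b (m + s) * h s (($) x)) = 0" if "x \<in> Z" for x using split[OF that] b1 by simp
    qed
    then have "\<forall>x\<in>Z. (\<Sum>s<n. b (m + s) * h s (($) x)) = 0" using f(3,4) by blast
    then have "\<forall>s<n. b (m + s) = 0" using h(2)[rule_format, of "\<lambda>s. b (m + s)"] by blast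
    then show ?thesis using b1 by (metis add_diff_inverse_nat nat_add_left_cancel_less)
  qed
  ultimately show ?thesis unfolding hilbert_ge_def by (intro exI[of _ k]) blast
qed

lemma hilbert_ge_iterate:
  assumes Z: "proj_irreducible Z" "Z' \<subseteq> Z"
    and f: "f \<in> hfun UNIV e" "\<And>x. x \<in> Z' \<Longrightarrow> f (($) x) = 0" "x0 \<in> Z" "f (($) x0) \<noteq> 0"
    and Z': "\<And>D. D \<ge> D0 \<Longrightarrow> hilbert_ge Z' D n"
  shows "D \<ge> D0 + N * e \<Longrightarrow> hilbert_ge Z D (N * n)"
proof (induction N arbitrary: D)
  case 0
  then show ?case by (simp add: hilbert_ge_0)
next
  case (Suc N)
  have "hilbert_ge Z (D - e) (N * n)" by (rule Suc.IH) (use Suc.prems in simp)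
  then have "hilbert_ge Z D (n + N * n)"
    using Suc.prems by (intro hilbert_ge_step[OF Z f] Z') simp_all
  then show ?case by simp
qed

text \<open>Each step of the chain multiplies the bound by \<open>N\<close> and raises the degree by
  at most \<open>N * e\<close>. So the Hilbert function of \<open>Z k\<close> grows at least like
  the \<open>k\<close>-th power of the degree.\<close>

lemma hilbert_ge_chain:
  assumes Z: "\<And>i. i \<le> k \<Longrightarrow> proj_irreducible (Z i)" "\<And>i. i < k \<Longrightarrow> Z i \<subset> Z (Suc i)"
  shows "\<exists>e. \<forall>N. \<forall>D\<ge>k * N * e. hilbert_ge (Z k) D (N ^ k)"
proof -
  have closed: "proj_closed (Z i)" if "i \<le> k" for i using Z(1)[OF that] by (simp add: proj_irreducible_def)
  have "\<forall>i. \<exists>l f x. i < k \<longrightarrow> f \<in> hfun UNIV l \<and> (\<forall>y\<in>Z i. f (($) y) = 0) \<and> x \<in> Z (Suc i) \<and> f (($) x) \<noteq> 0"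
  proof
    fix i
    show "\<exists>l f x. i < k \<longrightarrow> f \<in> hfun UNIV l \<and> (\<forall>y\<in>Z i. f (($) y) = 0) \<and> x \<in> Z (Suc i) \<and> f (($) x) \<noteq> 0"
    proof (cases "i < k")
      case True
      then obtain x where x: "x \<in> Z (Suc i)" "x \<notin> Z i" using Z(2) by blast
      have cl: "proj_closed (Z i)" "proj_closed (Z (Suc i))" using closed True by simp_all
      obtain f l where "f \<in> hfun UNIV l" "\<And>y. y \<in> Z i \<Longrightarrow> f (($) y) = 0" "f (($) x) \<noteq> 0"
        by (rule proj_closed_separate[OF cl(1) x(2) proj_closed_nonzero[OF cl(2) x(1)]]) (rule that; assumption)
      then show ?thesis using x(1) by blast
    qed simp
  qed
  then obtain l where "\<forall>i. \<exists>f x. i < k \<longrightarrow> f \<in> hfun UNIV (l i) \<and> (\<forall>y\<in>Z i. f (($) y) = 0) \<and> x \<in> Z (Suc i) \<and> f (($) x) \<noteq> 0"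
    by (rule exE[OF choice])
  then have l: "\<exists>f x. f \<in> hfun UNIV (l i) \<and> (\<forall>y\<in>Z i. f (($) y) = 0) \<and> x \<in> Z (Suc i) \<and> f (($) x) \<noteq> 0"
    if "i < k" for i using that by simp
  define e where "e = (\<Sum>i<k. l i)"
  have le: "l i \<le> e" if "i < k" for i unfolding e_def using that by (intro member_le_sum) auto
  have "\<forall>D\<ge>i * N * e. hilbert_ge (Z i) D (N ^ i)" if "i \<le> k" for i N
    using that
  proof (induction i)
    case 0
    obtain x where "x \<in> Z 0" using Z(1)[of 0] by (auto simp: proj_irreducible_def)
    then have "hilbert_ge (Z 0) D 1" for D using hilbert_ge_1 proj_closed_nonzero[OF closed[of 0]] by blast
    then show ?case by simp
  next
    case (Suc i)
    then have i: "i < k" by simp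
    obtain f x where f: "f \<in> hfun UNIV (l i)" "\<forall>y\<in>Z i. f (($) y) = 0" "x \<in> Z (Suc i)" "f (($) x) \<noteq> 0"
      using l[OF i] by (elim exE conjE)
    show ?case
    proof (intro allI impI)
      fix D assume D: "Suc i * N * e \<le> D"
      have "hilbert_ge (Z (Suc i)) D (N * N ^ i)"
      proof (rule hilbert_ge_iterate[OF Z(1) _ f(1) _ f(3,4)])
        show "Suc i \<le> k" "Z i \<subseteq> Z (Suc i)" using i Z(2)[OF i] by auto
        show "f (($) y) = 0" if "y \<in> Z i" for y using f(2) that by blast
        show "hilbert_ge (Z i) D (N ^ i)" if "D \<ge> i * N * e" for D using Suc that by simp
        have "N * l i \<le> N * e" using le[OF i] by simp
        then have "i * N * e + N * l i \<le> i * N * e + N * e" by (rule add_left_mono)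
        also have "\<dots> = Suc i * N * e" by (simp add: algebra_simps)
        finally show "i * N * e + N * l i \<le> D" using D by (rule order_trans)
      qed
      then show "hilbert_ge (Z (Suc i)) D (N ^ Suc i)" by simp
    qed
  qed
  then show ?thesis by blast
qed

text \<open>
  On the stratum, functions of degree \<open>D\<close> are, up to a common factor, polynomials of degree
  \<open>D (card F - 1)\<close> in the coordinates of the row space that belong to a basis of \<open>F\<close>.
\<close>

lemma hilbert_le_recip_section:
  fixes A :: "complex ^ 'n ^ 'm"
  assumes n: "hilbert_ge (recip_section A F) D n" and r: "matroid_rank A F = Suc r"
  shows "n \<le> (D * (card F - 1) + 1) ^ r"
proof (rule ccontr)
  assume "\<not> ?thesis"
  then have big: "(D * (card F - 1) + 1) ^ r < n" by simp
  obtain B where B: "B \<subseteq> F" "matroid_indep A B" "card B = matroid_rank A F"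
    and "\<forall>i\<in>F. column i A \<in> col_span A B"
    using matroid_basis[of F A] by (elim exE conjE)
  then have B4: "\<And>i. i \<in> F \<Longrightarrow> column i A \<in> col_span A B" by (elim bspec)
  obtain c where c: "\<forall>v\<in>row_space A. \<forall>i\<in>F. v $ i = (\<Sum>b\<in>B. c i b * v $ b)"
    using row_space_coordinates[of F A B] B4 by blast
  obtain f where f: "\<forall>s<n. f s \<in> hfun UNIV D"
    "\<forall>b. (\<forall>x\<in>recip_section A F. (\<Sum>s<n. b s * f s (($) x)) = 0) \<longrightarrow> (\<forall>s<n. b s = 0)"
    using n unfolding hilbert_ge_def by (elim exE conjE)
  \<comment> \<open>The reciprocals without denominators, written in the coordinates from
    \<open>B\<close>. Each is a product of \<open>card F - 1\<close> linear forms in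
    \<open>card B = r + 1\<close> variables.\<close>
  define w where "w i x = (if i \<in> F then \<Prod>j\<in>F - {i}. \<Sum>b\<in>B. c j b * x b else 0)" for i and x :: "'n \<Rightarrow> complex"
  have w: "w i \<in> hfun B (card F - 1)" for i
  proof (cases "i \<in> F")
    case True
    have "(\<lambda>x. \<Prod>j\<in>F - {i}. \<Sum>b\<in>B. c j b * x b) \<in> hfun B (\<Sum>j\<in>F - {i}. 1)"
      by (intro hfun_prod hfun_sum hfun_cmult hfun_var)
    then show ?thesis using True by (simp add: w_def[abs_def])
  next
    case False
    then show ?thesis by (simp add: w_def[abs_def] hfun_zero)
  qed
  let ?E = "exps B (D * (card F - 1))"
  have "(\<lambda>x. f s (\<lambda>i. w i x)) \<in> mono_span ?E" if "s \<in> {..<n}" for s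
  proof -
    have "f s \<in> hfun UNIV D" using f(1) that by simp
    then show ?thesis by (intro hfun_mono_span hfun_compose w)
  qed
  moreover have "card ?E < card {..<n}" using card_exps_le[of B r "D * (card F - 1)"] B(3) r big by simp
  ultimately have "\<exists>b. (\<exists>s\<in>{..<n}. b s \<noteq> 0) \<and> (\<forall>x. (\<Sum>s<n. b s * f s (\<lambda>i. w i x)) = 0)"
    by (intro mono_span_dependent[OF finite_exps finite_lessThan])
  then obtain b where b: "\<exists>s\<in>{..<n}. b s \<noteq> 0" "\<forall>x. (\<Sum>s<n. b s * f s (\<lambda>i. w i x)) = 0" by (elim exE conjE)
  have 0: "(\<Sum>s<n. b s * f s (($) u)) = 0" if u: "u \<in> stratum A F" for u
  proof -
    obtain y where y: "y \<in> row_space A" "\<And>i. i \<in> F \<Longrightarrow> y $ i = inverse (u $ i)" using u by (auto simp: stratum_def)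
    let ?P = "\<Prod>j\<in>F. y $ j"
    have "?P \<noteq> 0" using u y(2) by (auto simp: stratum_def)
    have "w i (($) y) = ?P * u $ i" for i
    proof -
      have "w i (($) y) = (if i \<in> F then \<Prod>j\<in>F - {i}. y $ j else 0)"
        using c y(1) by (auto simp: w_def intro!: prod.cong)
      then show ?thesis using stratum_coordinates[OF u y] by simp
    qed
    then have "f s (\<lambda>i. w i (($) y)) = ?P ^ D * f s (($) u)" if "s < n" for s
      using hfun_scale[of "f s" UNIV D ?P "($) u"] f(1) that by simp
    then have "(\<Sum>s<n. b s * f s (\<lambda>i. w i (($) y))) = ?P ^ D * (\<Sum>s<n. b s * f s (($) u))"
      by (simp add: sum_distrib_left mult.left_commute)
    then show ?thesis using b(2) \<open>?P \<noteq> 0\<close> by simp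
  qed
  have "(\<lambda>x. \<Sum>s<n. b s * f s x) \<in> pfun"
    using f(1) hfun_imp_pfun by (intro pfun_sum pfun_cmult) blast
  then have "\<forall>x\<in>recip_section A F. (\<Sum>s<n. b s * f s (($) x)) = 0"
    using recip_section_dense[of _ A F "\<lambda>x. \<Sum>s<n. b s * f s x"] 0 by blast
  then show False using f(2) b(1) by blast
qed

lemma proj_dim_recip_section:
  fixes A :: "complex ^ 'n ^ 'm"
  assumes loopless: "is_flat A {}" and F: "is_flat A F" "F \<noteq> {}"
  shows "proj_dim (recip_section A F) + 1 = matroid_rank A F"
proof -
  let ?X = "recip_section A F"
  obtain i where "i \<in> F" using F by blast
  then have "{i} \<subseteq> F" "matroid_indep A {i}"
    using loopless matroid_indep_insert[of i "{}" A] matroid_indep_empty[of A] by (auto simp: is_flat_def)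
  then have "card {i} \<le> matroid_rank A F" by (rule matroid_rank_ge)
  then obtain r where r: "matroid_rank A F = Suc r" by (cases "matroid_rank A F") auto
  let ?S = "{k. \<exists>Z :: nat \<Rightarrow> (complex ^ 'n) set.
     (\<forall>i\<le>k. proj_irreducible (Z i) \<and> Z i \<subseteq> ?X) \<and> (\<forall>i<k. Z i \<subset> Z (Suc i))}"
  have upper: "k \<le> r" if kS: "k \<in> ?S" for k
  proof (rule ccontr)
    assume "\<not> k \<le> r"
    then have k: "Suc r \<le> k" by simp
    obtain Z :: "nat \<Rightarrow> (complex ^ 'n) set" where Z: "\<forall>i\<le>k. proj_irreducible (Z i) \<and> Z i \<subseteq> ?X" "\<forall>i<k. Z i \<subset> Z (Suc i)"
      using kS unfolding mem_Collect_eq by (elim exE conjE)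
    obtain e where e: "\<forall>N. \<forall>D\<ge>k * N * e. hilbert_ge (Z k) D (N ^ k)"
      using hilbert_ge_chain[of k Z] Z by auto
    \<comment> \<open>As \<open>N \<ge> 1\<close>, the upper bound is at most
      \<open>(N * K) ^ r\<close>. Comparison with \<open>N ^ (r + 1)\<close> would give
      \<open>N \<le> K ^ r\<close>, which the choice of \<open>N\<close> excludes.\<close>
    define K where "K = k * e * (card F - 1) + 1"
    define N where "N = K ^ r + 1"
    have "hilbert_ge (Z k) (k * N * e) (N ^ k)" using e by simp
    then have "hilbert_ge ?X (k * N * e) (N ^ k)" by (rule hilbert_ge_mono) (use Z in simp)
    then have "N ^ k \<le> (k * N * e * (card F - 1) + 1) ^ r" using r by (rule hilbert_le_recip_section)
    also have "\<dots> \<le> (N * K) ^ r" by (rule power_mono) (simp_all add: K_def N_def algebra_simps)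
    finally have "N ^ k \<le> N ^ r * K ^ r" by (simp add: power_mult_distrib)
    moreover have "N ^ Suc r \<le> N ^ k" using k by (intro power_increasing) (simp_all add: N_def)
    ultimately have "N ^ Suc r \<le> N ^ r * K ^ r" by (rule order_trans[rotated])
    moreover have "N ^ Suc r = N ^ r * N" "N ^ r > 0" by (simp_all add: N_def)
    ultimately have "N \<le> K ^ r" by (metis mult_le_cancel1)
    then show False by (simp add: N_def)
  qed
  have "r \<in> ?S"
  proof -
    obtain B where B: "B \<subseteq> F" "matroid_indep A B" "card B = matroid_rank A F"
      using matroid_basis[of F A] by (elim exE conjE)
    obtain h where h: "bij_betw h {0..<card B} B" using ex_bij_betw_nat_finite[of B] by auto
    then have hB: "h i \<in> B" if "i \<le> r" for i using that B r by (auto simp: bij_betw_def)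
    \<comment> \<open>The flat spanned by the first \<open>i + 1\<close> elements of the basis:
      starting with one element keeps every member nonempty and gives a chain of length
      \<open>r\<close>.\<close>
    define G where "G i = flat_closure A (h ` {..i})" for i
    have G: "is_flat A (G i)" "G i \<noteq> {}" for i
      using is_flat_flat_closure flat_closure_superset[of "h ` {..i}" A] by (auto simp: G_def)
    have GF: "G i \<subseteq> F" if "i \<le> r" for i
      unfolding G_def using hB B(1) that by (intro flat_closure_subset F) force
    have mono: "recip_section A G1 \<subseteq> recip_section A G2" if "G1 \<subseteq> G2" for G1 G2
      using that by (auto simp: recip_section_def coord_space_def)
    have GG: "G i \<subseteq> G (Suc i)" for i
      unfolding G_def using flat_closure_superset[of "h ` {..Suc i}" A]
      by (intro flat_closure_subset is_flat_flat_closure) (auto simp: atMost_Suc)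
    have strict: "recip_section A (G i) \<noteq> recip_section A (G (Suc i))" if i: "i < r" for i
    proof -
      have "h (Suc i) \<notin> h ` {..i}"
      proof
        assume "h (Suc i) \<in> h ` {..i}"
        then obtain j where "j \<le> i" "h (Suc i) = h j" by auto
        moreover have "Suc i \<in> {0..<card B}" "j \<in> {0..<card B}" using i B r \<open>j \<le> i\<close> by simp_all
        ultimately have "Suc i = j" by (intro inj_onD[OF bij_betw_imp_inj_on[OF h]])
        then show False using \<open>j \<le> i\<close> by simp
      qed
      moreover have "matroid_indep A (insert (h (Suc i)) (h ` {..i}))"
        using hB i by (intro matroid_indep_subset[OF B(2)]) auto
      ultimately have "column (h (Suc i)) A \<notin> col_span A (h ` {..i})" using matroid_indep_insert by blast
      then have out: "h (Suc i) \<notin> G i" by (simp add: G_def flat_closure_def)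
      have "h (Suc i) \<in> G (Suc i)" using flat_closure_superset[of "h ` {..Suc i}" A] by (auto simp: G_def)
      obtain w where w: "w \<in> stratum A (G (Suc i))" using stratum_nonempty[OF loopless] by blast
      then have "w $ h (Suc i) \<noteq> 0" using \<open>h (Suc i) \<in> G (Suc i)\<close> by (auto simp: stratum_def)
      then have "w \<notin> recip_section A (G i)" using out by (auto simp: recip_section_def coord_space_def)
      moreover have "w \<in> recip_section A (G (Suc i))" using w stratum_subset_recip_section[OF G order_refl] by blast
      ultimately show ?thesis by blast
    qed
    have "\<forall>i\<le>r. proj_irreducible (recip_section A (G i)) \<and> recip_section A (G i) \<subseteq> ?X"
      using proj_irreducible_recip_section[OF loopless G] mono[OF GF] by blast
    moreover have "\<forall>i<r. recip_section A (G i) \<subset> recip_section A (G (Suc i))"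
      using mono[OF GG] strict by blast
    ultimately show ?thesis by (intro CollectI exI[of _ "\<lambda>i. recip_section A (G i)"]) simp
  qed
  \<comment> \<open>For natural numbers \<open>Sup\<close> is meaningful only on bounded sets;
    \<open>upper\<close> provides the bound.\<close>
  then have "Sup ?S = r" using upper by (intro cSup_eq_maximum) auto
  then show ?thesis unfolding proj_dim_def r by simp
qed

section \<open>Minors and full rank\<close>

text \<open>Independence of the rows as an indexed family: two equal rows count as dependent,
  although they are one element of \<open>rows U\<close>.\<close>

definition rows_indep :: "complex ^ 'n ^ 'm \<Rightarrow> bool" where
  "rows_indep U \<longleftrightarrow> (\<forall>u. (\<forall>j. (\<Sum>r\<in>UNIV. u r * U $ r $ j) = 0) \<longrightarrow> (\<forall>r. u r = 0))"

lemma full_rank_iff: "rank U = CARD('m) \<longleftrightarrow> rows_indep (U :: complex ^ 'n ^ 'm)"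
proof
  assume rank: "rank U = CARD('m)"
  show "rows_indep U"
    unfolding rows_indep_def
  proof (intro allI impI)
    fix u s assume u: "\<forall>j. (\<Sum>r\<in>UNIV. u r * U $ r $ j) = 0"
    show "u s = 0"
    proof (rule ccontr)
      assume us: "u s \<noteq> 0"
      let ?R = "(\<lambda>r. row r U) ` (UNIV - {s})"
      have "row s U = (\<Sum>r\<in>UNIV - {s}. (- u r / u s) *s row r U)"
      proof (subst vec_eq_iff, rule allI)
        fix j
        have "u s * U $ s $ j = - (\<Sum>r\<in>UNIV - {s}. u r * U $ r $ j)"
          using u[rule_format, of j] by (simp add: sum.remove[of UNIV s] eq_neg_iff_add_eq_0)
        then have "U $ s $ j = (\<Sum>r\<in>UNIV - {s}. (- u r / u s) * U $ r $ j)"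
          using us by (simp add: field_simps sum_divide_distrib[symmetric] sum_negf)
        then show "row s U $ j = (\<Sum>r\<in>UNIV - {s}. (- u r / u s) *s row r U) $ j"
          by (simp add: row_def)
      qed
      also have "\<dots> \<in> vec.span ?R" by (intro vec.span_sum vec.span_scale vec.span_base) auto
      finally have s: "row s U \<in> vec.span ?R" .
      have "rows U \<subseteq> vec.span ?R"
      proof
        fix x assume "x \<in> rows U"
        then obtain r where "x = row r U" by (auto simp: rows_def)
        then show "x \<in> vec.span ?R" using s by (cases "r = s") (auto intro: vec.span_base)
      qed
      then have "vec.dim (rows U) \<le> card ?R" by (rule vec.dim_le_card) simp
      also have "\<dots> \<le> card (UNIV - {s})" by (rule card_image_le) simp
      also have "\<dots> < CARD('m)" by (intro psubset_card_mono) auto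
      finally show False using rank by (simp add: row_rank_def_gen)
    qed
  qed
next
  assume indep: "rows_indep U"
  have inj: "inj (\<lambda>r. row r U)"
  proof (rule injI)
    fix r s assume eq: "row r U = row s U"
    show "r = s"
    proof (rule ccontr)
      assume "r \<noteq> s"
      define u :: "'m \<Rightarrow> complex" where "u t = (if t = r then 1 else 0) - (if t = s then 1 else 0)" for t
      have "(\<Sum>t\<in>UNIV. u t * U $ t $ j) = U $ r $ j - U $ s $ j" for j
        by (simp add: u_def left_diff_distrib sum_subtractf if_distrib[of "\<lambda>x. x * _"] cong: if_cong)
      moreover have "U $ r $ j = U $ s $ j" for j using eq by (simp add: row_def vec_eq_iff)
      ultimately have "u r = 0" using indep unfolding rows_indep_def by simp
      then show False using \<open>r \<noteq> s\<close> by (simp add: u_def)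
    qed
  qed
  have rows: "rows U = (\<lambda>r. row r U) ` UNIV" by (auto simp: rows_def)
  have "vec.independent (rows U)"
  proof
    assume "vec.dependent (rows U)"
    then obtain v where v: "\<exists>x\<in>rows U. v x \<noteq> 0" "(\<Sum>x\<in>rows U. v x *s x) = 0"
      using vec.dependent_finite[of "rows U"] by (auto simp: rows)
    have "(\<Sum>r\<in>UNIV. v (row r U) *s row r U) = 0" using v(2) inj by (simp add: rows sum.reindex)
    then have "(\<Sum>r\<in>UNIV. v (row r U) *s row r U) $ j = 0" for j by simp
    then have "\<forall>j. (\<Sum>r\<in>UNIV. v (row r U) * U $ r $ j) = 0" by (simp add: row_def)
    then have "\<forall>r. v (row r U) = 0" using indep[unfolded rows_indep_def, rule_format, of "\<lambda>r. v (row r U)"] by blast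
    then show False using v(1) by (auto simp: rows)
  qed
  then have "vec.dim (rows U) = card (rows U)" by (rule vec.dim_eq_card_independent)
  also have "\<dots> = CARD('m)" unfolding rows by (rule card_image[OF inj])
  finally show "rank U = CARD('m)" by (simp add: row_rank_def_gen)
qed

lemma det_nonzero_iff:
  fixes S :: "complex ^ 'm ^ 'm"
  shows "det S \<noteq> 0 \<longleftrightarrow> (\<forall>x. S *v x = 0 \<longrightarrow> x = 0)"
  by (simp add: invertible_left_inverse matrix_left_invertible_ker flip: invertible_det_nz)

lemma minor_eq_0:
  fixes U :: "complex ^ 'n ^ 'm"
  assumes "\<not> rows_indep U"
  shows "minor U f = 0"
proof (rule ccontr)
  let ?S = "\<chi> i j. U $ i $ f j"
  assume "minor U f \<noteq> 0"
  then have nz: "\<forall>x. transpose ?S *v x = 0 \<longrightarrow> x = 0"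
    unfolding minor_def det_nonzero_iff[symmetric] by (simp add: det_transpose)
  obtain u s where u: "\<forall>j. (\<Sum>r\<in>UNIV. u r * U $ r $ j) = 0" "u s \<noteq> 0" using assms by (auto simp: rows_indep_def)
  have "transpose ?S *v (\<chi> r. u r) = 0"
    using u(1) by (simp add: vec_eq_iff matrix_vector_mult_def transpose_def mult.commute)
  then have "(\<chi> r. u r) = 0" using nz by blast
  then show False using u(2) by (simp add: vec_eq_iff)
qed

text \<open>A combination of rows that vanishes on a column basis \<open>B\<close> vanishes
  everywhere, so \<open>B\<close> has at least as many elements as there are rows; any injection
  into \<open>B\<close> selects independent columns.\<close>

lemma exists_nonzero_minor:
  fixes U :: "complex ^ 'n ^ 'm"
  assumes U: "rows_indep U"
  shows "\<exists>f. minor U f \<noteq> 0"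
proof -
  obtain B where B: "matroid_indep U B" and "\<forall>i\<in>UNIV. column i U \<in> col_span U B"
    using matroid_basis[of UNIV U] by (elim exE conjE)
  then obtain c where c: "\<forall>y\<in>row_space U. \<forall>i\<in>UNIV. y $ i = (\<Sum>b\<in>B. c i b * y $ b)"
    using row_space_coordinates[of UNIV U B] by blast
  have "CARD('m) \<le> card B"
  proof (rule ccontr)
    assume "\<not> ?thesis"
    then have "card B < card (UNIV :: 'm set)" by simp
    then obtain u where u: "\<exists>r\<in>UNIV. u r \<noteq> 0" "\<forall>b\<in>B. (\<Sum>r\<in>UNIV. u r * U $ r $ b) = 0"
      using linear_system_nontrivial[of B "UNIV :: 'm set" "\<lambda>r b. U $ r $ b"] by auto
    let ?y = "\<chi> i. \<Sum>r\<in>UNIV. u r * U $ r $ i"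
    have "?y $ i = (\<Sum>b\<in>B. c i b * ?y $ b)" for i using c row_space_combination[of u U] by blast
    then have "(\<Sum>r\<in>UNIV. u r * U $ r $ i) = 0" for i using u(2) by simp
    then show False using U u(1) unfolding rows_indep_def by blast
  qed
  then obtain f :: "'m \<Rightarrow> 'n" where f: "f ` UNIV \<subseteq> B" "inj f"
    using card_le_inj[of "UNIV :: 'm set" B] by auto
  let ?S = "\<chi> i j. U $ i $ f j"
  have "x = 0" if x: "?S *v x = 0" for x
  proof -
    define a where "a i = (if i \<in> range f then x $ inv f i else 0)" for i
    have "(\<Sum>i\<in>UNIV. U $ r $ i * a i) = 0" for r
    proof -
      have "(\<Sum>i\<in>UNIV. U $ r $ i * a i) = (\<Sum>i\<in>range f. U $ r $ i * a i)"
        by (rule sum.mono_neutral_right) (auto simp: a_def)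
      also have "\<dots> = (\<Sum>k\<in>UNIV. U $ r $ f k * x $ k)" using f(2) by (simp add: sum.reindex a_def)
      also have "\<dots> = (?S *v x) $ r" by (simp add: matrix_vector_mult_def)
      finally show ?thesis using x by simp
    qed
    then have "relation U a" by (simp add: relation_def)
    moreover have "a i = 0" if "i \<notin> B" for i using that f(1) by (auto simp: a_def)
    ultimately have "a (f k) = 0" for k using matroid_indep_relation[OF B] by blast
    then show "x = 0" using f(2) by (simp add: a_def vec_eq_iff)
  qed
  then have "minor U f \<noteq> 0" unfolding minor_def det_nonzero_iff by blast
  then show ?thesis by (intro exI[of _ f])
qed

text \<open>
  By Cramer's rule, the rows \<open>j \<mapsto> minor U (f(r := j))\<close> span the same space as the rows of \<open>U\<close> if
  \<open>minor U f \<noteq> 0\<close>.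
\<close>

lemma minor_row_combination:
  fixes U :: "complex ^ 'n ^ 'm"
  shows "(\<Sum>j\<in>UNIV. minor U (f(r := j)) * y $ j) = det (\<chi> i k. if k = r then (U *v y) $ i else U $ i $ f k)"
proof -
  have 1: "minor U (f(r := j)) = det (\<chi> k. if k = r then (\<chi> i. U $ i $ j) else (\<chi> i. U $ i $ f k))" for j
    unfolding minor_def by (subst det_transpose[symmetric]) (rule arg_cong[of _ _ det], simp add: vec_eq_iff transpose_def)
  have "(\<Sum>j\<in>UNIV. minor U (f(r := j)) * y $ j) =
      (\<Sum>j\<in>UNIV. det (\<chi> k. if k = r then y $ j *s (\<chi> i. U $ i $ j) else (\<chi> i. U $ i $ f k)))"
    unfolding 1 det_row_mul by (simp add: mult.commute)
  also have "\<dots> = det (\<chi> k. if k = r then (\<Sum>j\<in>UNIV. y $ j *s (\<chi> i. U $ i $ j)) else (\<chi> i. U $ i $ f k))"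
    by (rule det_linear_row_sum[symmetric]) simp
  also have "\<dots> = det (\<chi> i k. if k = r then (U *v y) $ i else U $ i $ f k)"
    by (subst (2) det_transpose[symmetric])
      (rule arg_cong[of _ _ det], simp add: vec_eq_iff transpose_def matrix_vector_mult_def mult.commute)
  finally show ?thesis .
qed

lemma minor_row_combination_0:
  fixes U :: "complex ^ 'n ^ 'm"
  assumes "U *v y = 0"
  shows "(\<Sum>j\<in>UNIV. minor U (f(r := j)) * y $ j) = 0"
proof -
  let ?M = "\<chi> i k. if k = r then (U *v y) $ i else U $ i $ f k"
  have "?M *v axis r 1 = 0"
    using assms by (simp add: vec_eq_iff matrix_vector_mult_def axis_def if_distrib[of "\<lambda>x. _ * x"] cong: if_cong)
  moreover have "axis r (1 :: complex) \<noteq> 0" by (simp add: axis_eq_0_iff)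
  ultimately have "det ?M = 0" using det_nonzero_iff[of ?M] by blast
  then show ?thesis by (simp add: minor_row_combination)
qed

text \<open>With \<open>S\<close> the invertible submatrix chosen by \<open>f\<close> and
  \<open>U y = S t\<close>, Cramer's rule identifies the sums with \<open>t r * det S\<close>,
  whence \<open>t = 0\<close>.\<close>

lemma kernel_minor_rows:
  fixes U :: "complex ^ 'n ^ 'm"
  assumes f: "minor U f \<noteq> 0" and y: "\<And>r. (\<Sum>j\<in>UNIV. minor U (f(r := j)) * y $ j) = 0"
  shows "U *v y = 0"
proof -
  let ?S = "\<chi> i k. U $ i $ f k"
  have "det ?S \<noteq> 0" using f by (simp add: minor_def)
  then have "invertible ?S" by (simp add: invertible_det_nz)
  then obtain T where "?S ** T = mat 1" by (auto simp: invertible_def)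
  then have S: "?S *v (T *v (U *v y)) = U *v y" by (metis matrix_vector_mul_assoc matrix_vector_mul_lid)
  have "(T *v (U *v y)) $ r = 0" for r
  proof -
    have "det (\<chi> i k. if k = r then (?S *v (T *v (U *v y))) $ i else ?S $ i $ k) = (T *v (U *v y)) $ r * det ?S"
      by (rule cramer_lemma)
    moreover have "det (\<chi> i k. if k = r then (?S *v (T *v (U *v y))) $ i else ?S $ i $ k) = 0"
      using y[of r] unfolding minor_row_combination S by (simp cong: if_cong)
    ultimately show ?thesis using \<open>det ?S \<noteq> 0\<close> by simp
  qed
  then have "T *v (U *v y) = 0" by (simp add: vec_eq_iff)
  then show ?thesis using S by simp
qed

lemma exists_full_rank_kernel:
  fixes x :: "complex ^ 'n"
  assumes "CARD('m::finite) < CARD('n)" "x \<noteq> 0"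
  shows "\<exists>U :: complex ^ 'n ^ 'm. rows_indep U \<and> U *v x = 0"
proof -
  obtain e where e: "x $ e \<noteq> 0" using assms(2) by (auto simp: vec_eq_iff)
  have "card (UNIV :: 'm set) \<le> card (UNIV - {e})" using assms(1) by simp
  then obtain h :: "'m \<Rightarrow> 'n" where h: "h ` UNIV \<subseteq> UNIV - {e}" "inj h"
    using card_le_inj[of "UNIV :: 'm set" "UNIV - {e}"] by auto
  then have he: "h r \<noteq> e" for r by blast
  \<comment> \<open>Row \<open>r\<close> is the unit vector at \<open>h r\<close>, corrected at
    \<open>e\<close> so as to annihilate \<open>x\<close>. The entries at the \<open>h r\<close>
    give independence.\<close>
  define U :: "complex ^ 'n ^ 'm" where
    "U = (\<chi> r j. (if j = h r then 1 else 0) - (if j = e then x $ h r / x $ e else 0))"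
  have "(U *v x) $ r = 0" for r
    using e by (simp add: U_def matrix_vector_mult_def left_diff_distrib sum_subtractf if_distrib[of "\<lambda>x. x * _"] cong: if_cong)
  moreover have "rows_indep U"
    unfolding rows_indep_def
  proof (intro allI impI)
    fix u r assume u: "\<forall>j. (\<Sum>r\<in>UNIV. u r * U $ r $ j) = 0"
    have "(\<Sum>s\<in>UNIV. u s * U $ s $ h r) = (\<Sum>s\<in>UNIV. if s = r then u r else 0)"
      by (rule sum.cong) (use he inj_eq[OF h(2)] in \<open>auto simp: U_def\<close>)
    then show "u r = 0" using u by simp
  qed
  ultimately show ?thesis by (intro exI[of _ U]) (simp add: vec_eq_iff)
qed

section \<open>Elimination\<close>

text \<open>At \<open>U0\<close> the quadrics have no common zero on \<open>X\<close>. By the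
  Nullstellensatz, all monomials of some degree \<open>D\<close> are combinations of the quadrics
  modulo forms vanishing on \<open>X\<close>. With the same cofactors and the quadrics of
  \<open>U\<close>, this becomes a square system \<open>C\<close> that has the vector of monomials
  of \<open>x\<close> in its kernel whenever \<open>x\<close> in \<open>X\<close> is a common zero
  for \<open>U\<close>. The equation of its singular locus is \<open>G\<close>.\<close>

lemma elimination:
  fixes U0 :: "'m::finite \<times> 'n::finite \<Rightarrow> complex" and X :: "(complex ^ 'n) set"
  assumes X: "proj_closed X"
    and no: "\<And>x. x \<in> X \<Longrightarrow> \<exists>r. (\<Sum>j\<in>UNIV. U0 (r, j) * x $ j ^ 2) \<noteq> 0"
  shows "\<exists>G\<in>pfun. G U0 \<noteq> 0 \<and>
    (\<forall>U x. x \<in> X \<longrightarrow> (\<forall>r. (\<Sum>j\<in>UNIV. U (r, j) * x $ j ^ 2) = 0) \<longrightarrow> G U = 0)"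
proof -
  define q where "q r x = (\<Sum>j\<in>UNIV. U0 (r, j) * x j ^ 2)" for r :: 'm and x :: "'n \<Rightarrow> complex"
  have q: "q r \<in> hfun UNIV 2" for r
    unfolding q_def[abs_def] using hfun_power[OF hfun_var, of _ UNIV 2] by (intro hfun_sum hfun_cmult) simp
  define V where "V N = {g \<in> hfun UNIV N. \<forall>x\<in>X. g (($) x) = 0}" for N
  \<comment> \<open>The cofactors of the quadrics in degree \<open>N\<close>. Since
    \<open>N - 2\<close> truncates to 0, they have to be set to 0 explicitly in degrees below
    2.\<close>
  define H where "H N = {h :: 'm \<Rightarrow> ('n \<Rightarrow> complex) \<Rightarrow> complex. (\<forall>r. h r \<in> hfun UNIV (N - 2)) \<and> (N < 2 \<longrightarrow> (\<forall>r. h r = (\<lambda>x. 0)))}" for N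
  define K where "K N = {f. \<exists>g\<in>V N. \<exists>h\<in>H N. f = (\<lambda>x. g x + (\<Sum>r\<in>UNIV. q r x * h r x))}" for N
  have KI: "(\<lambda>x. g x + (\<Sum>r\<in>UNIV. q r x * h r x)) \<in> K N" if "g \<in> V N" "h \<in> H N" for g h N
    using that unfolding K_def by blast
  have V0: "(\<lambda>x. 0) \<in> V N" for N by (simp add: V_def hfun_zero)
  have H0: "(\<lambda>r x. 0) \<in> H N" for N by (simp add: H_def hfun_zero)
  have qh: "(\<lambda>x. s x * h r x) \<in> hfun UNIV N" if h: "h \<in> H N" and s: "s \<in> hfun UNIV 2" for s h r N
  proof (cases "N < 2")
    case True
    then show ?thesis using h by (simp add: H_def hfun_zero)
  next
    case False
    have "h r \<in> hfun UNIV (N - 2)" using h by (simp add: H_def)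
    moreover have "2 + (N - 2) = N" using False by simp
    ultimately show ?thesis using hfun_mult[OF s, of "h r" "N - 2"] by (simp only:)
  qed
  have "\<exists>D>0. \<forall>a\<in>exps UNIV D. mono_fun a \<in> K D"
  proof (rule homogeneous_nullstellensatz_degree)
    fix N :: nat
    show "K N \<subseteq> hfun UNIV N"
    proof
      fix f assume "f \<in> K N"
      then obtain g h where f: "g \<in> V N" "h \<in> H N" "f = (\<lambda>x. g x + (\<Sum>r\<in>UNIV. q r x * h r x))"
        unfolding K_def by blast
      have "g \<in> hfun UNIV N" using f(1) by (simp add: V_def)
      then show "f \<in> hfun UNIV N" unfolding f(3) by (intro hfun_add hfun_sum qh[OF f(2) q])
    qed
    show "(\<lambda>x. 0) \<in> K N" using KI[OF V0 H0] by simp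
    fix f f' assume "f' \<in> K N"
    then obtain g' h' where f': "g' \<in> V N" "h' \<in> H N" "f' = (\<lambda>x. g' x + (\<Sum>r\<in>UNIV. q r x * h' r x))"
      unfolding K_def by blast
    show "(\<lambda>x. f x + f' x) \<in> K N" if fK: "f \<in> K N"
    proof -
      obtain g h where f: "g \<in> V N" "h \<in> H N" "f = (\<lambda>x. g x + (\<Sum>r\<in>UNIV. q r x * h r x))"
        using fK unfolding K_def by blast
      have "(\<lambda>x. g x + g' x) \<in> V N" using f(1) f'(1) by (simp add: V_def hfun_add)
      moreover have "(\<lambda>r x. h r x + h' r x) \<in> H N" using f(2) f'(2) by (simp add: H_def hfun_add)
      ultimately have "(\<lambda>x. (g x + g' x) + (\<Sum>r\<in>UNIV. q r x * (h r x + h' r x))) \<in> K N" by (rule KI)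
      then show ?thesis by (simp add: f(3) f'(3) distrib_left sum.distrib add.assoc add.left_commute)
    qed
    show "(\<lambda>x. f x * f' x) \<in> K (M + N)" if fM: "f \<in> hfun UNIV M" for M
    proof -
      have "(\<lambda>x. f x * g' x) \<in> V (M + N)" using f'(1) hfun_mult[OF fM, of g' N] by (simp add: V_def)
      moreover have "(\<lambda>r x. f x * h' r x) \<in> H (M + N)"
      proof (cases "N < 2")
        case True
        then have "h' = (\<lambda>r x. 0)" using f'(2) by (auto simp: H_def)
        then show ?thesis using H0[of "M + N"] by simp
      next
        case False
        have "(\<lambda>x. f x * h' r x) \<in> hfun UNIV (M + (N - 2))" for r
          using hfun_mult[OF fM, of "h' r" "N - 2"] f'(2) by (simp add: H_def)
        then show ?thesis using False by (simp add: H_def)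
      qed
      ultimately have "(\<lambda>x. f x * g' x + (\<Sum>r\<in>UNIV. q r x * (f x * h' r x))) \<in> K (M + N)" by (rule KI)
      then show ?thesis by (simp add: f'(3) distrib_left sum_distrib_left mult.left_commute)
    qed
  next
    fix x assume 0: "\<forall>N. \<forall>f\<in>K N. f x = 0"
    show "x = (\<lambda>v. 0)"
    proof (rule ccontr)
      assume "x \<noteq> (\<lambda>v. 0)"
      define y where "y = (\<chi> i. x i)"
      have yx: "($) y = x" by (simp add: y_def fun_eq_iff)
      have "y \<noteq> 0" using \<open>x \<noteq> (\<lambda>v. 0)\<close> by (auto simp: y_def vec_eq_iff fun_eq_iff)
      have "y \<in> X"
      proof (rule ccontr)
        assume "y \<notin> X"
        obtain f k where f: "f \<in> hfun UNIV k" "\<And>y. y \<in> X \<Longrightarrow> f (($) y) = 0" "f (($) y) \<noteq> 0"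
          by (rule proj_closed_separate[OF X \<open>y \<notin> X\<close> \<open>y \<noteq> 0\<close>]) (rule that; assumption)
        have "f \<in> V k" using f by (simp add: V_def)
        from KI[OF this H0] have "f \<in> K k" by simp
        then show False using 0 f(3) yx by simp
      qed
      moreover have "q r x = 0" for r
      proof -
        have "(\<lambda>s x. if s = r then 1 else 0) \<in> H 2" by (simp add: H_def hfun_const hfun_zero)
        from KI[OF V0 this] have "(\<lambda>x. \<Sum>s\<in>UNIV. q s x * (if s = r then 1 else 0)) \<in> K 2" by simp
        from bspec[OF spec[OF 0] this] have "(\<Sum>s\<in>UNIV. q s x * (if s = r then 1 else 0)) = 0" .
        then show ?thesis by (simp add: if_distrib[of "\<lambda>x. _ * x"] cong: if_cong)
      qed
      ultimately show False using no[of y] by (simp add: q_def yx[symmetric])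
    qed
  qed
  then obtain D where D: "D > 0" "\<And>a. a \<in> exps UNIV D \<Longrightarrow> mono_fun a \<in> K D" by blast
  let ?E = "exps (UNIV :: 'n set) D"
  have "\<forall>a. \<exists>gh. a \<in> ?E \<longrightarrow> fst gh \<in> V D \<and> snd gh \<in> H D \<and>
      mono_fun a = (\<lambda>x. fst gh x + (\<Sum>r\<in>UNIV. q r x * snd gh r x))"
    using D(2) unfolding K_def by fastforce
  from choice[OF this] obtain gh where gh: "\<And>a. a \<in> ?E \<Longrightarrow> fst (gh a) \<in> V D"
    "\<And>a. a \<in> ?E \<Longrightarrow> snd (gh a) \<in> H D"
    "\<And>a. a \<in> ?E \<Longrightarrow> mono_fun a = (\<lambda>x. fst (gh a) x + (\<Sum>r\<in>UNIV. q r x * snd (gh a) r x))" by blast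
  have "\<forall>arj. \<exists>c. fst arj \<in> ?E \<longrightarrow>
      (\<forall>x. x (snd (snd arj)) ^ 2 * snd (gh (fst arj)) (fst (snd arj)) x = (\<Sum>b\<in>?E. c b * mono_fun b x))"
  proof
    fix arj :: "('n \<Rightarrow> nat) \<times> 'm \<times> 'n"
    obtain a r j where arj: "arj = (a, r, j)" by (cases arj)
    have ms: "(\<lambda>x. x j ^ 2 * snd (gh a) r x) \<in> mono_span ?E" if "a \<in> ?E"
      using qh[OF gh(2)[OF that], of "\<lambda>x. x j ^ 2" r] hfun_power[OF hfun_var, of j UNIV 2]
      by (intro hfun_mono_span) simp
    show "\<exists>c. fst arj \<in> ?E \<longrightarrow>
      (\<forall>x. x (snd (snd arj)) ^ 2 * snd (gh (fst arj)) (fst (snd arj)) x = (\<Sum>b\<in>?E. c b * mono_fun b x))"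
    proof (cases "a \<in> ?E")
      case True
      then obtain c where "(\<lambda>x. x j ^ 2 * snd (gh a) r x) = (\<lambda>x. \<Sum>b\<in>?E. c b * mono_fun b x)"
        using ms unfolding mono_span_def by blast
      then have "x j ^ 2 * snd (gh a) r x = (\<Sum>b\<in>?E. c b * mono_fun b x)" for x by (rule fun_cong)
      then show ?thesis unfolding arj fst_conv snd_conv by (intro exI[of _ c] impI allI)
    qed (simp add: arj)
  qed
  from choice[OF this] obtain c0 where "\<forall>arj. fst arj \<in> ?E \<longrightarrow>
      (\<forall>x. x (snd (snd arj)) ^ 2 * snd (gh (fst arj)) (fst (snd arj)) x = (\<Sum>b\<in>?E. c0 arj b * mono_fun b x))" by (elim exE)
  then have c0: "x j ^ 2 * snd (gh a) r x = (\<Sum>b\<in>?E. c0 (a, r, j) b * mono_fun b x)" if "a \<in> ?E" for a r j x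
    using that spec[of _ "(a, r, j)"] by fastforce
  \<comment> \<open>Applied to the monomials of \<open>x\<close>, row \<open>a\<close> is the
    monomial \<open>a\<close> plus the quadrics of \<open>U\<close> minus those of
    \<open>U0\<close>, times the cofactors. Inserting the representation of the monomial leaves a
    form vanishing on \<open>X\<close> plus the quadrics of \<open>U\<close> times the
    cofactors.\<close>
  define C where "C a b U = (if a = b then 1 else 0) +
    (\<Sum>r\<in>UNIV. \<Sum>j\<in>UNIV. (U (r, j) - U0 (r, j)) * c0 (a, r, j) b)" for a b and U :: "'m \<times> 'n \<Rightarrow> complex"
  have "\<exists>G\<in>pfun. G U0 \<noteq> 0 \<and>
    (\<forall>U v. (\<exists>a\<in>?E. v a \<noteq> 0) \<and> (\<forall>a\<in>?E. (\<Sum>b\<in>?E. C a b U * v b) = 0) \<longrightarrow> G U = 0)"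
  proof (rule singular_locus_equation[OF finite_exps])
    show "C a b \<in> pfun" for a b
      unfolding C_def[abs_def] by (intro pfun_add pfun_const pfun_sum pfun_mult pfun_diff pfun_var)
    show "C a b U0 = (if a = b then 1 else 0)" for a b by (simp add: C_def)
  qed
  then obtain G where G: "G \<in> pfun" "G U0 \<noteq> 0"
    "\<forall>U v. (\<exists>a\<in>?E. v a \<noteq> 0) \<and> (\<forall>a\<in>?E. (\<Sum>b\<in>?E. C a b U * v b) = 0) \<longrightarrow> G U = 0" by (elim bexE conjE)
  have "G U = 0" if x: "x \<in> X" "\<forall>r. (\<Sum>j\<in>UNIV. U (r, j) * x $ j ^ 2) = 0" for U x
  proof (rule G(3)[rule_format, of "\<lambda>a. mono_fun a (($) x)"], intro conjI ballI)
    have "x \<noteq> 0" using proj_closed_nonzero[OF X x(1)] .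
    then obtain i where i: "x $ i \<noteq> 0" by (auto simp: vec_eq_iff)
    have "(\<lambda>w. if w = i then D else 0) \<in> ?E" by (simp add: exps_def)
    then show "\<exists>a\<in>?E. mono_fun a (($) x) \<noteq> 0" using i by (intro bexI[of _ "\<lambda>w. if w = i then D else 0"]) (simp_all add: mono_fun_axis)
    fix a assume a: "a \<in> ?E"
    let ?v = "\<lambda>a. mono_fun a (($) x)" and ?h = "\<lambda>r. snd (gh a) r (($) x)"
    have "(\<Sum>b\<in>?E. C a b U * ?v b) =
        ?v a + (\<Sum>b\<in>?E. \<Sum>r\<in>UNIV. \<Sum>j\<in>UNIV. (U (r, j) - U0 (r, j)) * (c0 (a, r, j) b * ?v b))"
    proof -
      have "(\<Sum>b\<in>?E. (if a = b then 1 else 0) * ?v b) = (\<Sum>b\<in>?E. if a = b then ?v b else 0)" by (rule sum.cong) simp_all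
      then have "(\<Sum>b\<in>?E. (if a = b then 1 else 0) * ?v b) = ?v a" using a by (simp add: finite_exps)
      then show ?thesis by (simp add: C_def distrib_right sum.distrib sum_distrib_right mult.assoc)
    qed
    also have "(\<Sum>b\<in>?E. \<Sum>r\<in>UNIV. \<Sum>j\<in>UNIV. (U (r, j) - U0 (r, j)) * (c0 (a, r, j) b * ?v b)) =
        (\<Sum>r\<in>UNIV. \<Sum>j\<in>UNIV. (U (r, j) - U0 (r, j)) * (x $ j ^ 2 * ?h r))"
      unfolding c0[OF a] sum_distrib_left
      by (subst sum.swap, rule sum.cong[OF refl], rule sum.swap)
    also have "\<dots> = (\<Sum>r\<in>UNIV. ((\<Sum>j\<in>UNIV. U (r, j) * x $ j ^ 2) - (\<Sum>j\<in>UNIV. U0 (r, j) * x $ j ^ 2)) * ?h r)"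
      by (simp add: left_diff_distrib sum_subtractf sum_distrib_right mult.assoc)
    also have "\<dots> = - (\<Sum>r\<in>UNIV. q r (($) x) * ?h r)" using x(2) by (simp add: q_def sum_negf)
    also have "?v a = fst (gh a) (($) x) + (\<Sum>r\<in>UNIV. q r (($) x) * ?h r)"
      using fun_cong[OF gh(3)[OF a], of "($) x"] .
    also have "fst (gh a) (($) x) = 0" using gh(1)[OF a] x(1) by (simp add: V_def)
    finally show "(\<Sum>b\<in>?E. C a b U * ?v b) = 0" by simp
  qed
  then show ?thesis using G(1,2) by blast
qed

section \<open>The principal matroid determinant\<close>

text \<open>
  The condition on \<open>(x, z)\<close> says that \<open>x\<^sup>2\<close> lies in the kernel of \<open>A\<cdot>diag(z)\<close>, and also that \<open>z\<close> annihilates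
  the tangent space \<open>{x\<^sup>2v. v \<in> row_space A}\<close> of the stratum of \<open>x\<close>.
\<close>

definition conormal :: "complex ^ 'n ^ 'm \<Rightarrow> complex ^ 'n \<Rightarrow> complex ^ 'n \<Rightarrow> bool" where
  "conormal A x z \<longleftrightarrow> relation A (\<lambda>i. z $ i * x $ i ^ 2)"

definition diag_mult :: "complex ^ 'n ^ 'm \<Rightarrow> complex ^ 'n \<Rightarrow> complex ^ 'n ^ 'm" where
  "diag_mult A z = (\<chi> r j. A $ r $ j * z $ j)"

lemma minor_pfun:
  assumes "\<And>r j. (\<lambda>x. V x $ r $ j) \<in> pfun"
  shows "(\<lambda>x. minor (V x) f) \<in> pfun"
  unfolding minor_def det_def by (simp, intro pfun_sum pfun_mult pfun_const pfun_prod assms)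

lemma minor_hfun:
  fixes V :: "('v \<Rightarrow> complex) \<Rightarrow> complex ^ 'n ^ 'm"
  assumes "\<And>r j. (\<lambda>x. V x $ r $ j) \<in> hfun UNIV 1"
  shows "(\<lambda>x. minor (V x) f) \<in> hfun UNIV CARD('m)"
proof -
  have "(\<lambda>x. \<Prod>i\<in>UNIV. V x $ i $ f (p i)) \<in> hfun UNIV (\<Sum>i\<in>(UNIV :: 'm set). 1)" for p
    by (intro hfun_prod assms)
  then show ?thesis
    unfolding minor_def det_def by (simp, intro hfun_sum hfun_cmult)
qed

lemma peval_principal_matroid_determinant:
  fixes A :: "complex ^ 'n ^ 'm"
  shows "peval (psubst (\<lambda>(i, j). Const (A $ i $ j) * Var j) (psubst (minor generic_matrix) P)) (($) z) =
    peval P (minor (diag_mult A z))"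
proof -
  have "peval (minor generic_matrix f) (\<lambda>v. peval (case v of (i, j) \<Rightarrow> Const (A $ i $ j) * Var j) (($) z)) =
      minor (diag_mult A z) f" for f :: "'m \<Rightarrow> 'n"
    unfolding minor_def peval_det
    by (rule arg_cong[of _ _ det]) (simp add: vec_eq_iff generic_matrix_def diag_mult_def peval_Var peval_mult peval_Const)
  then show ?thesis by (simp add: peval_psubst)
qed

text \<open>
  A polynomial in the minors of \<open>U\<close> that vanishes if \<open>U\<close> kills the squares of a point of \<open>L\<^sup>-\<^sup>1\<close> also vanishes
  on the Chow hypersurface of \<open>L\<^sup>-\<^sup>2\<close>: given a point \<open>x\<close> of \<open>L\<^sup>-\<^sup>2\<close> in the kernel of \<open>U\<close>, modify \<open>U\<close> in one column so
  that it kills a variable square \<open>y\<close>, and use that \<open>L\<^sup>-\<^sup>2\<close> is the closure of these \<open>y\<close>.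
\<close>

lemma vanishing_on_chow_hypersurface:
  fixes A :: "complex ^ 'n ^ 'm" and U :: "complex ^ 'n ^ 'm"
  assumes Q: "Q \<in> pfun"
    and van: "\<And>(V :: complex ^ 'n ^ 'm) w. w \<in> recip_power 1 (proj_row_span A) \<Longrightarrow>
      (\<And>r. (\<Sum>j\<in>UNIV. V $ r $ j * w $ j ^ 2) = 0) \<Longrightarrow> Q (minor V) = 0"
    and x: "x \<in> recip_power 2 (proj_row_span A)" and Ux: "U *v x = 0"
  shows "Q (minor U) = 0"
proof -
  have "x \<noteq> 0" using x zariski_closure_nonzero unfolding recip_power_def by blast
  then obtain e where e: "x $ e \<noteq> 0" by (auto simp: vec_eq_iff)
  \<comment> \<open>If \<open>y e = 1\<close>, changing column \<open>e\<close> in this way makes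
    \<open>V y\<close> kill \<open>y\<close>, and nothing is changed if \<open>U\<close> kills
    \<open>y\<close> already. For general points the argument is \<open>y / y e\<close>, which is
    why homogenization follows.\<close>
  define V where "V y = (\<chi> r j. U $ r $ j - (if j = e then \<Sum>k\<in>UNIV. U $ r $ k * y k else 0))"
    for y :: "'n \<Rightarrow> complex"
  define g where "g y = Q (minor (V y))" for y
  have V_pfun: "(\<lambda>y. V y $ r $ j) \<in> pfun" for r j
  proof (cases "j = e")
    case True
    then show ?thesis
      by (simp add: V_def[abs_def]) (intro pfun_diff pfun_const pfun_sum pfun_mult pfun_var)
  next
    case False
    then show ?thesis by (simp add: V_def[abs_def] pfun_const)
  qed
  have "g \<in> pfun" unfolding g_def[abs_def] by (rule pfun_compose[OF Q minor_pfun[OF V_pfun]])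
  from homogenize[OF this, of e] obtain M h where h: "h \<in> hfun UNIV M"
    "\<And>y. y e \<noteq> 0 \<Longrightarrow> h y = y e ^ M * g (\<lambda>i. y i / y e)" by blast
  have "h (($) x) = 0"
  proof (rule zariski_closureD[OF x[unfolded recip_power_def] h(1)])
    fix y assume "y \<in> {\<chi> i. inverse (x $ i ^ 2) |x. x \<in> proj_row_span A \<and> (\<forall>i. x $ i \<noteq> 0)}"
    then obtain u where u: "u \<in> proj_row_span A" "\<forall>i. u $ i \<noteq> 0" "y = (\<chi> i. inverse (u $ i ^ 2))" by blast
    define w where "w = (\<chi> i. inverse (u $ i ^ 1))"
    have "w $ e \<noteq> 0" using u(2) by (simp add: w_def)
    then have "w \<noteq> 0" by auto
    have "w \<in> {\<chi> i. inverse (x $ i ^ 1) |x. x \<in> proj_row_span A \<and> (\<forall>i. x $ i \<noteq> 0)}"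
      using u(1,2) unfolding w_def by blast
    then have w: "w \<in> recip_power 1 (proj_row_span A)"
      using \<open>w \<noteq> 0\<close> unfolding recip_power_def by (rule zariski_closure_base)
    have yw: "y $ i = w $ i ^ 2" for i by (simp add: u(3) w_def power_inverse)
    have ye: "y $ e \<noteq> 0" using yw \<open>w $ e \<noteq> 0\<close> by simp
    have "Q (minor (V (\<lambda>i. y $ i / y $ e))) = 0"
    proof (rule van[OF w])
      fix r
      have "(\<Sum>j\<in>UNIV. V (\<lambda>i. y $ i / y $ e) $ r $ j * w $ j ^ 2) =
          (\<Sum>j\<in>UNIV. U $ r $ j * y $ j) - (\<Sum>k\<in>UNIV. U $ r $ k * (y $ k / y $ e)) * y $ e"
        by (simp add: V_def yw[symmetric] left_diff_distrib sum_subtractf if_distrib[of "\<lambda>x. x * _"] cong: if_cong)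
      also have "(\<Sum>k\<in>UNIV. U $ r $ k * (y $ k / y $ e)) * y $ e = (\<Sum>j\<in>UNIV. U $ r $ j * y $ j)"
        unfolding sum_distrib_right using ye by simp
      finally show "(\<Sum>j\<in>UNIV. V (\<lambda>i. y $ i / y $ e) $ r $ j * w $ j ^ 2) = 0" by simp
    qed
    then show "h (($) y) = 0" using h(2)[of "($) y"] ye by (simp add: g_def)
  qed
  then have "g (\<lambda>i. x $ i / x $ e) = 0" using h(2)[of "($) x"] e by simp
  moreover have "V (\<lambda>i. x $ i / x $ e) = U"
  proof -
    have "(\<Sum>k\<in>UNIV. U $ r $ k * (x $ k / x $ e)) = (U *v x) $ r / x $ e" for r
      by (simp add: matrix_vector_mult_def sum_divide_distrib)
    then show ?thesis using Ux by (simp add: V_def vec_eq_iff)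
  qed
  ultimately show ?thesis by (simp add: g_def)
qed

text \<open>The choice \<open>Q = P\<close>, \<open>R = 1\<close> shows that \<open>P\<close>
  vanishes on the Chow hypersurface, and \<open>A\<cdot>diag(z)\<close> belongs to it if it has full
  rank, because it kills the squares of \<open>x\<close>. Otherwise all its minors are 0.\<close>

lemma chow_form_zero:
  fixes A :: "complex ^ 'n ^ 'm" and P :: "('m \<Rightarrow> 'n) mpoly"
  assumes P: "is_chow_form (recip_power 2 (proj_row_span A)) P"
    and small: "CARD('m) < CARD('n)"
    and x: "x \<in> recip_power 1 (proj_row_span A)" and z: "conormal A x z"
  shows "peval P (minor (diag_mult A z)) = 0"
proof -
  let ?X = "recip_power 2 (proj_row_span A)"
  define x2 where "x2 = (\<chi> i. x $ i ^ 2)"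
  have x2: "x2 \<in> ?X"
    unfolding x2_def using stratum_power_recip[OF recip_power_stratum[OF x], of 2] by simp
  then have "x2 \<noteq> 0" using zariski_closure_nonzero unfolding recip_power_def by blast
  have chow: "peval P (minor U) = 0" if "rows_indep U" "U *v x2 = 0" for U :: "complex ^ 'n ^ 'm"
  proof -
    have "\<exists>R. \<forall>U :: complex ^ 'n ^ 'm. rank U = CARD('m) \<longrightarrow> peval P (minor U) = peval P (minor U) * peval R (minor U)"
      by (rule exI[of _ 1]) (simp add: peval_1)
    then have "\<forall>U\<in>(chow_hypersurface ?X :: (complex ^ 'n ^ 'm) set). peval P (minor U) = 0"
      using P unfolding is_chow_form_def by blast
    moreover have "U \<in> chow_hypersurface ?X"
      using that x2 \<open>x2 \<noteq> 0\<close> by (auto simp: chow_hypersurface_def full_rank_iff)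
    ultimately show ?thesis by blast
  qed
  show ?thesis
  proof (cases "rows_indep (diag_mult A z)")
    case True
    have "diag_mult A z *v x2 = 0"
      using z by (simp add: conormal_def relation_def diag_mult_def x2_def matrix_vector_mult_def vec_eq_iff mult.assoc)
    then show ?thesis by (rule chow[OF True])
  next
    case False
    then have "minor (diag_mult A z) = (\<lambda>f. 0)" by (simp add: minor_eq_0 fun_eq_iff)
    \<comment> \<open>\<open>P\<close> is 0 at the zero vector unless it is a nonzero constant; that
      is excluded by any full-rank matrix killing \<open>x2\<close>, which exists because
      \<open>d < n\<close>.\<close>
    moreover obtain U :: "complex ^ 'n ^ 'm" where U: "rows_indep U" "U *v x2 = 0"
      using exists_full_rank_kernel[OF small \<open>x2 \<noteq> 0\<close>] by blast
    obtain k where "hom_degree k P" using P by (auto simp: is_chow_form_def homogeneous_iff_hom_degree)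
    from hfun_scale[OF hom_imp_hfun[OF this], of 0 "minor U"] have "peval P (\<lambda>f. 0) = 0" using chow[OF U] by simp
    ultimately show ?thesis by simp
  qed
qed

text \<open>In the full-rank case without a conormal point, elimination yields a polynomial in the
  minors that vanishes on the Chow hypersurface but not at \<open>A\<cdot>diag(z)\<close>. It is a
  multiple of \<open>P\<close> on full-rank matrices, so \<open>P\<close> cannot vanish
  there.\<close>

lemma chow_form_zeroD:
  fixes A :: "complex ^ 'n ^ 'm" and P :: "('m \<Rightarrow> 'n) mpoly"
  assumes P: "is_chow_form (recip_power 2 (proj_row_span A)) P"
    and A: "rows_indep A" and loopless: "is_flat A {}"
    and zero: "peval P (minor (diag_mult A z)) = 0"
  shows "\<exists>x\<in>recip_power 1 (proj_row_span A). conormal A x z"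
proof (cases "rows_indep (diag_mult A z)")
  case False
  \<comment> \<open>Here a vector \<open>y\<close> of the row space is supported where \<open>z\<close> vanishes; take the point of a parallel class.\<close>
  then obtain u s where u: "\<forall>j. (\<Sum>r\<in>UNIV. u r * (A $ r $ j * z $ j)) = 0" "u s \<noteq> 0"
    by (auto simp: rows_indep_def diag_mult_def)
  define y where "y = (\<chi> i. \<Sum>r\<in>UNIV. u r * A $ r $ i)"
  have yz: "y $ i * z $ i = 0" for i using u(1) by (simp add: y_def sum_distrib_right mult.assoc)
  obtain e where e: "y $ e \<noteq> 0" using A u(2) unfolding rows_indep_def y_def by auto
  define F where "F = flat_closure A {e}"
  have F: "is_flat A F" "F \<noteq> {}"
    using is_flat_flat_closure flat_closure_superset[of "{e}" A] by (auto simp: F_def)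
  have zF: "z $ j = 0" if "j \<in> F" for j
  proof -
    have "column j A \<in> col_span A {e}" using that by (simp add: F_def flat_closure_def)
    then obtain k where k: "\<And>i. i \<notin> {e} \<Longrightarrow> k i = 0" "\<And>r. column j A $ r = (\<Sum>i\<in>UNIV. A $ r $ i * k i)"
      using col_span_combination by blast
    have "(\<Sum>i\<in>UNIV. A $ r $ i * k i) = (\<Sum>i\<in>UNIV. if i = e then A $ r $ e * k e else 0)" for r
      by (rule sum.cong) (use k(1) in auto)
    then have Aj: "A $ r $ j = A $ r $ e * k e" for r using k(2)[of r] by (simp add: column_def)
    have "k e \<noteq> 0"
    proof
      assume "k e = 0"
      then have "column j A = 0" using Aj by (simp add: vec_eq_iff column_def)
      then show False using loopless by (auto simp: is_flat_def col_span_def vec.span_zero)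
    qed
    moreover have "y $ j = y $ e * k e" by (simp add: y_def Aj sum_distrib_right mult.assoc)
    ultimately show ?thesis using yz[of j] e by simp
  qed
  obtain w where w: "w \<in> stratum A F" using stratum_nonempty[OF loopless] by blast
  have "w \<in> recip_power 1 (proj_row_span A)"
    using w stratum_subset_recip_section[OF F order_refl] by (auto simp: recip_section_def)
  moreover have "(\<lambda>i. z $ i * w $ i ^ 2) = (\<lambda>i. 0)"
  proof
    fix i show "z $ i * w $ i ^ 2 = 0" using zF[of i] w by (cases "i \<in> F") (auto simp: stratum_def)
  qed
  then have "conormal A w z" by (simp add: conormal_def relation_def)
  ultimately show ?thesis by blast
next
  case True
  let ?U = "diag_mult A z" and ?X = "recip_power 1 (proj_row_span A)"
  obtain f where f: "minor ?U f \<noteq> 0" using exists_nonzero_minor[OF True] by (elim exE)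
  \<comment> \<open>A matrix whose entries are minors. It kills whatever the original matrix kills,
    and has the same kernel if the minor of \<open>f\<close> is nonzero; so elimination in its
    entries gives polynomials in the minors.\<close>
  define hat where "hat m = (\<lambda>(r, j). m (f(r := j)))" for m :: "('m \<Rightarrow> 'n) \<Rightarrow> complex"
  show ?thesis
  proof (rule ccontr)
    assume neg: "\<not> ?thesis"
    have "proj_closed ?X" unfolding recip_power_def by (rule proj_closed_zariski_closure)
    moreover have "\<exists>r. (\<Sum>j\<in>UNIV. hat (minor ?U) (r, j) * x $ j ^ 2) \<noteq> 0" if x: "x \<in> ?X" for x
    proof (rule ccontr)
      assume "\<not> ?thesis"
      then have "(\<Sum>j\<in>UNIV. minor ?U (f(r := j)) * (\<chi> i. x $ i ^ 2) $ j) = 0" for r by (simp add: hat_def)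
      then have "?U *v (\<chi> i. x $ i ^ 2) = 0" by (rule kernel_minor_rows[OF f])
      then have "conormal A x z"
        by (simp add: conormal_def relation_def diag_mult_def matrix_vector_mult_def vec_eq_iff mult.assoc)
      then show False using neg x by blast
    qed
    ultimately have "\<exists>G\<in>pfun. G (hat (minor ?U)) \<noteq> 0 \<and>
        (\<forall>U x. x \<in> ?X \<longrightarrow> (\<forall>r. (\<Sum>j\<in>UNIV. U (r, j) * x $ j ^ 2) = 0) \<longrightarrow> G U = 0)"
      by (rule elimination)
    then obtain G where G: "G \<in> pfun" "G (hat (minor ?U)) \<noteq> 0"
      "\<forall>U x. x \<in> ?X \<longrightarrow> (\<forall>r. (\<Sum>j\<in>UNIV. U (r, j) * x $ j ^ 2) = 0) \<longrightarrow> G U = 0" by (elim bexE conjE)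
    define Q where "Q m = G (hat m)" for m
    have "(\<lambda>m. hat m rj) \<in> pfun" for rj
      by (cases rj) (simp add: hat_def pfun_var)
    then have Q: "Q \<in> pfun" unfolding Q_def[abs_def] by (rule pfun_compose[OF G(1)])
    then obtain q where q: "\<And>m. peval q m = Q m" using pfun_imp_peval by blast
    have van: "Q (minor V) = 0"
      if "w \<in> ?X" "\<And>r. (\<Sum>j\<in>UNIV. V $ r $ j * w $ j ^ 2) = 0" for V :: "complex ^ 'n ^ 'm" and w
    proof -
      have "V *v (\<chi> i. w $ i ^ 2) = 0" using that(2) by (simp add: matrix_vector_mult_def vec_eq_iff)
      from minor_row_combination_0[OF this]
      have "\<forall>r. (\<Sum>j\<in>UNIV. hat (minor V) (r, j) * w $ j ^ 2) = 0" by (simp add: hat_def)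
      then show ?thesis using G(3) that(1) unfolding Q_def by blast
    qed
    have "\<forall>V\<in>(chow_hypersurface (recip_power 2 (proj_row_span A)) :: (complex ^ 'n ^ 'm) set). peval q (minor V) = 0"
    proof
      fix V :: "complex ^ 'n ^ 'm" assume "V \<in> chow_hypersurface (recip_power 2 (proj_row_span A))"
      then obtain x where x: "x \<in> recip_power 2 (proj_row_span A)" "V *v x = 0" by (auto simp: chow_hypersurface_def)
      have "Q (minor V) = 0"
        by (rule vanishing_on_chow_hypersurface[OF Q _ x]) (rule van)
      then show "peval q (minor V) = 0" by (simp add: q)
    qed
    then obtain R where "\<forall>V :: complex ^ 'n ^ 'm. rank V = CARD('m) \<longrightarrow> peval q (minor V) = peval P (minor V) * peval R (minor V)"
      using P unfolding is_chow_form_def by blast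
    then have "peval q (minor ?U) = 0" using True zero by (simp add: full_rank_iff)
    then show False using G(2) by (simp add: q Q_def)
  qed
qed

section \<open>Conormal vectors, tangent spaces and the zero locus\<close>

lemma conormal_iff:
  "conormal A x z \<longleftrightarrow> (\<forall>v\<in>row_space A. (\<Sum>i\<in>UNIV. z $ i * (\<chi> i. x $ i ^ 2 * v $ i) $ i) = 0)"
proof
  assume "conormal A x z"
  then show "\<forall>v\<in>row_space A. (\<Sum>i\<in>UNIV. z $ i * (\<chi> i. x $ i ^ 2 * v $ i) $ i) = 0"
    using row_space_relation[of _ A "\<lambda>i. z $ i * x $ i ^ 2"] by (simp add: conormal_def mult.assoc)
next
  assume *: "\<forall>v\<in>row_space A. (\<Sum>i\<in>UNIV. z $ i * (\<chi> i. x $ i ^ 2 * v $ i) $ i) = 0"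
  have "row r A \<in> row_space A" for r unfolding row_space_def by (rule vec.span_base) (auto simp: rows_def)
  then have "(\<Sum>i\<in>UNIV. z $ i * (\<chi> i. x $ i ^ 2 * row r A $ i) $ i) = 0" for r using * by blast
  then show "conormal A x z"
    by (simp add: conormal_def relation_def row_def mult.assoc mult.commute mult.left_commute)
qed

theorem theorem3p11:
  fixes A :: "complex ^ 'n ^ 'm"
    and L :: "(complex ^ 'n) set"
    and E :: "'n mpoly"
  assumes "L = proj_row_span A"
    and "rank A = CARD('m)"
    and "CARD('m) < CARD('n)"
    and "\<forall>i. \<not> L \<subseteq> {x. x $ i = 0}"
    and "is_principal_matroid_determinant A E"
  shows "zero_locus E = (\<Union>F\<in>flats A. dual_variety (recip_power 1 L \<inter> coord_space F))"
proof -
  have A: "rows_indep A" using assms(2) by (simp add: full_rank_iff)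
  have loopless: "is_flat A {}"
    unfolding is_flat_def
  proof (intro allI impI notI)
    fix e assume "column e A \<in> col_span A {}"
    then have 0: "column e A = 0" by (simp add: col_span_def)
    have rel: "relation A (\<lambda>i. if i = e then 1 else 0)"
      using 0 by (simp add: relation_def vec_eq_iff column_def if_distrib[of "\<lambda>x. _ * x"] cong: if_cong)
    have "y $ e = 0" if "y \<in> row_space A" for y
      using row_space_relation[OF that rel] by (simp add: if_distrib[of "\<lambda>x. x * _"] cong: if_cong)
    then have "L \<subseteq> {x. x $ e = 0}" using assms(1) by (auto simp: proj_row_span_def row_space_def)
    then show False using assms(4) by blast
  qed
  obtain P :: "('m \<Rightarrow> 'n) mpoly" where P: "is_chow_form (recip_power 2 (proj_row_span A)) P"
    "E = psubst (\<lambda>(i, j). Const (A $ i $ j) * Var j) (psubst (minor generic_matrix) P)"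
    using assms(5) by (auto simp: is_principal_matroid_determinant_def is_resultant_def)
  have E: "peval E (($) z) = peval P (minor (diag_mult A z))" for z
    unfolding P(2) by (rule peval_principal_matroid_determinant)
  \<comment> \<open>\<open>E\<close> as a form in \<open>z\<close>. Since a dual variety is a
    closure, vanishing on it is tested with homogeneous functions.\<close>
  define h where "h x = peval P (minor (\<chi> r j. A $ r $ j * x j))" for x
  have hE: "h (($) z) = peval E (($) z)" for z by (simp add: h_def E diag_mult_def)
  obtain k where k: "hom_degree k P" using P(1) by (auto simp: is_chow_form_def homogeneous_iff_hom_degree)
  have h: "h \<in> hfun UNIV (k * CARD('m))"
    unfolding h_def[abs_def]
  proof (rule hfun_compose[OF hom_imp_hfun[OF k] minor_hfun])
    fix r j
    show "(\<lambda>x. (\<chi> r j. A $ r $ j * x j) $ r $ j) \<in> hfun UNIV 1"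
      using hfun_cmult[OF hfun_var[of j UNIV], of "A $ r $ j"] by simp
  qed
  have X: "recip_power 1 L \<inter> coord_space F = recip_section A F" for F by (simp add: assms(1) recip_section_def)
  show ?thesis
    unfolding X
  proof (intro subset_antisym subsetI)
    fix z assume "z \<in> zero_locus E"
    then have z: "z \<noteq> 0" "peval P (minor (diag_mult A z)) = 0" by (simp_all add: zero_locus_def E)
    obtain x where x: "x \<in> recip_power 1 (proj_row_span A)" "conormal A x z"
      using chow_form_zeroD[OF P(1) A loopless z(2)] by blast
    \<comment> \<open>The flat to use is the support of \<open>x\<close>: in the section of its own
      support the tangent space at \<open>x\<close> is known exactly and \<open>x\<close> is
      smooth.\<close>
    define G where "G = {i. x $ i \<noteq> 0}"
    note G = recip_power_stratum[OF x(1), folded G_def]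
    have xG: "x \<in> recip_section A G" using stratum_subset_recip_section[OF G(1,2) order_refl] G(3) by blast
    have tangent: "tangent_space (recip_section A G) x = {\<chi> i. x $ i ^ 2 * v $ i | v. v \<in> row_space A}"
      using tangent_space_subset[OF G(3)] tangent_space_superset[OF xG] by blast
    have "smooth_point (recip_section A G) x"
      using xG dim_tangent[OF G(3)] proj_dim_recip_section[OF loopless G(1,2)]
      by (simp add: smooth_point_def tangent)
    moreover have "\<forall>y\<in>tangent_space (recip_section A G) x. (\<Sum>i\<in>UNIV. z $ i * y $ i) = 0"
      using x(2) unfolding tangent conormal_iff by blast
    ultimately have "z \<in> dual_variety (recip_section A G)"
      unfolding dual_variety_def using z(1) by (intro zariski_closure_base CollectI conjI exI[of _ x])
    moreover have "G \<in> flats A" using G(1) by (simp add: flats_iff)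
    ultimately show "z \<in> (\<Union>F\<in>flats A. dual_variety (recip_section A F))" by blast
  next
    fix z assume "z \<in> (\<Union>F\<in>flats A. dual_variety (recip_section A F))"
    then obtain F where z: "z \<in> dual_variety (recip_section A F)" by blast
    have "h (($) z) = 0"
    proof (rule zariski_closureD[OF z[unfolded dual_variety_def] h])
      fix z' assume "z' \<in> {z. z \<noteq> 0 \<and> (\<exists>x. smooth_point (recip_section A F) x \<and>
        (\<forall>y\<in>tangent_space (recip_section A F) x. (\<Sum>i\<in>UNIV. z $ i * y $ i) = 0))}"
      then obtain x where x: "x \<in> recip_section A F"
        "\<forall>y\<in>tangent_space (recip_section A F) x. (\<Sum>i\<in>UNIV. z' $ i * y $ i) = 0"
        by (auto simp: smooth_point_def)
      \<comment> \<open>The point \<open>x\<close> may have a support smaller than \<open>F\<close>;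
        its tangent space still contains all \<open>x\<^sup>2 v\<close>.\<close>
      have "conormal A x z'" unfolding conormal_iff using x(2) tangent_space_superset[OF x(1)] by blast
      moreover have "x \<in> recip_power 1 (proj_row_span A)" using x(1) by (simp add: recip_section_def)
      ultimately show "h (($) z') = 0"
        unfolding hE E using chow_form_zero[OF P(1) assms(3)] by blast
    qed
    then show "z \<in> zero_locus E"
      using zariski_closure_nonzero[OF z[unfolded dual_variety_def]] by (simp add: zero_locus_def hE)
  qed
qed

end
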